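(* Let $(\mathbb{C},p:\dot{\mathcal{U}}\to\mathcal{U})$ be a natural model. (a) $(\mathbb{C},p)$ supports a unit type and dependent sum types if and only if $p$ (regarded as a polynomial $1\to 1$ in $\widehat{\mathbb{C}}$) can be equipped with the structure of a polynomial pseudomonad $\mathbb{P}$ in $\widehat{\mathbb{C}}$. (b) $(\mathbb{C},p)$ additionally supports dependent product types if and only if $p$ can be equipped with the structure of a polynomial pseudoalgebra over $\mathbb{P}$.
   Context: **Natural models.** $\widehat{\mathbb{C}}=\mathbf{Set}^{\mathbb{C}^{\mathrm{op}}}$, $\mathsf{y}$ is the Yoneda embedding, elements $x\in P(\Gamma)$ are identified with maps $\mathsf{y}(\Gamma)\to P$. A natural model $(\mathbb{C},p)$ consists of a small category $\mathbb{C}$ with a distinguished terminal object, presheaves $\mathcal{U},\dot{\mathcal{U}}$, a natural transformation $p:\dot{\mathcal{U}}\to\mathcal{U}$ and, for each $\Gamma$ and $A\in\mathcal{U}(\Gamma)$, a chosen object $\Gamma\cdot A$, morphism $\mathsf{p}_A:\Gamma\cdot A\to\Gamma$ and element $\mathsf{q}_A\in\dot{\mathcal{U}}(\Gamma\cdot A)$ such that the square with top $\mathsf{q}_A$, right $p$, left $\mathsf{y}(\mathsf{p}_A)$, bottom $A$ is a pullback. With $[A]$ the fibre of $p$ over $A\in\mathcal{U}$ in the internal language, $(\mathbb{C},p)$ supports (admits) a unit type if there are $\widehat{\mathbb{1}}:1\to\mathcal{U}$, $\widehat\star:1\to\dot{\mathcal{U}}$ exhibiting $\mathrm{id}_1$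 as a pullback of $p$; dependent sum types if there are $\widehat\Sigma:\sum_{A:\mathcal{U}}\mathcal{U}^{[A]}\to\mathcal{U}$ and $\widehat{\mathsf{pair}}:\sum_{A:\mathcal{U}}\sum_{B:\mathcal{U}^{[A]}}\sum_{a:[A]}[B(a)]\to\dot{\mathcal{U}}$ exhibiting the projection $(A,B,a,b)\mapsto(A,B)$ as a pullback of $p$; dependent product types if there are $\widehat\Pi:\sum_{A:\mathcal{U}}\mathcal{U}^{[A]}\to\mathcal{U}$ and $\widehat\lambda:\sum_{A:\mathcal{U}}\dot{\mathcal{U}}^{[A]}\to\dot{\mathcal{U}}$ exhibiting $\sum_{A:\mathcal{U}}p^{[A]}$ as a pullback of $p$. **Polynomials $1\to1$.** Let $\mathcal{E}$ be locally cartesian closed. A morphism $f:B\to A$ of $\mathcal{E}$ is regarded as a polynomial $1\to1$, with extension $\mathrm{P}_f:\mathcal{E}\to\mathcal{E}$, $\mathrm{P}_f(X)=\sum_{a\in A}X^{B_a}$. The identity polynomial is $i_1=\mathrm{id}_1$. The composite of $f:B\to A$ and $g:D\to C$ is $g\cdot f:\sum_{c\in C}\sum_{m\in A^{D_c}}\sum_{d\in D_c}B_{m(d)}\to\sum_{c\in C}A^{D_c}$, and $\mathrm{P}_{g\cdot f}\cong\mathrm{P}_g\circ\mathrm{P}_f$. A morphism of polynomials $\varphi:f\Rightarrow g$ consists of $\varphi_0:A\to C$, a pullback $D_\varphi$ of $g$ along $\varphi_0$ (with projection $\varphi_1:D_\varphi\to D$) and a morphism $\varphi_2:D_\varphi\to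 B$ over $A$; it is cartesian if $\varphi_2$ is invertible, in which case it amounts to a pullback square $(\varphi_0:A\to C,\ B\to D)$ from $f$ to $g$. Cartesian morphisms $\varphi$ induce cartesian natural transformations $\mathrm{P}_\varphi:\mathrm{P}_f\Rightarrow\mathrm{P}_g$. Polynomials and cartesian morphisms form a bicategory; $\varphi\cdot\psi$ denotes horizontal composition. An adjustment $\alpha:\varphi\Rrightarrow\psi$ between morphisms $\varphi,\psi:f\Rightarrow g$ is a morphism $\alpha:D_\varphi\to D_\psi$ with $\psi_2\circ\alpha=\varphi_2$; if $\psi$ is cartesian there is exactly one. Objects of $\mathcal{E}$, polynomials, cartesian morphisms and adjustments form a tricategory (a bicategory enriched in 2-categories) $\mathfrak{Poly}^{\mathrm{cart}}_{\mathcal{E}}$. **Polynomial pseudomonad.** A pseudomonad in $\mathfrak{Poly}^{\mathrm{cart}}_{\mathcal{E}}$. For a polynomial $t:1\to1$: cartesian morphisms $\eta:i_1\Rightarrow t$, $\mu:t\cdot t\Rightarrow t$ and invertible adjustments $\alpha:\mu\circ(t\cdot\mu)\Rrightarrow\mu\circ(\mu\cdot t)$, $\lambda:\mu\circ(t\cdot\eta)\Rrightarrow\mathrm{id}_t$, $\rho:\mu\circ(\eta\cdot t)\Rrightarrow\mathrm{id}_t$ satisfying the usual pseudomonad coherence axioms: the two composites $\mu\circ(t\cdot\mu)\circ(t\cdot t\cdot\mu)\Rrightarrow\mu\circ(\mu\cdot t)\circ(\mu\cdot t\cdot t)$, one built from $t\cdot\alpha$, $\alpha$, $\alpha\cdot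 t$ and the other from $\alpha$, the interchange isomorphism and $\alpha$, agree; and the composite of $\alpha$ whiskered with $t\cdot\eta\cdot t$ followed by $\mu\circ(\lambda\cdot t)$ equals $\mu\circ(t\cdot\rho)$. **Lift and polynomial pseudoalgebras.** Let $\mathcal{K}=\mathfrak{Poly}^{\mathrm{cart}}_{\mathcal{E}}(1,1)$: the 2-category whose objects are morphisms of $\mathcal{E}$, whose 1-cells are cartesian morphisms (pullback squares) and whose 2-cells are adjustments. A polynomial pseudomonad $\mathbb{P}=(p,\eta,\mu,\dots)$ on $1$ induces a pseudomonad $\mathbb{P}^+=(P,h,m,\dots)$ on $\mathcal{K}$ with $P(f)=\mathrm{P}_p(f)$, $P(\varphi)=\mathrm{P}_p$ applied to the pullback square $\varphi$, $h_f$ the naturality square of $\mathrm{P}_\eta$ at $f$, $m_f$ the naturality square of $\mathrm{P}_\mu$ at $f$, and the (unique) adjustments as remaining data. A polynomial pseudoalgebra over $\mathbb{P}$ is a pseudoalgebra for $\mathbb{P}^+$: a morphism $f$ of $\mathcal{E}$, a cartesian morphism $\zeta:\mathrm{P}_p(f)\Rightarrow f$, and invertible adjustments $\sigma:\zeta\circ P(\zeta)\Rrightarrow\zeta\circ m_f$ and $\tau:\zeta\circ h_f\Rrightarrow\mathrm{id}_f$ satisfying the usual two pseudoalgebra coherence axioms (associativity pasting equation relating $\sigma$ and the associator of $\mathbb{P}^+$, and the unit equation relating $\sigma$, $\tau$ and the unitor). In (b), "$p$ equipped with the structure" means $f=p$. *)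

theory Defs
  imports Main "HOL-Library.FuncSet"
begin

section \<open>Small categories and presheaves\<close>

record ('o, 'm) cat_data =
  Obj :: "'o set"
  Arr :: "'m set"
  Dom :: "'m \<Rightarrow> 'o"
  Cod :: "'m \<Rightarrow> 'o"
  Idn :: "'o \<Rightarrow> 'm"
  Cmp :: "'m \<Rightarrow> 'm \<Rightarrow> 'm"

text \<open>
  \<open>Act P \<sigma> x\<close> is the restriction of \<open>x \<in> P(Cod \<sigma>)\<close> along \<open>\<sigma>\<close>.  Every presheaf has its own type of
  elements; this is what allows exponentials to be formed, HOL having no type of sets that is
  closed under function spaces.
\<close>

record ('o, 'm, 'a) psh =
  El :: "'o \<Rightarrow> 'a set"
  Act :: "'m \<Rightarrow> 'a \<Rightarrow> 'a"

text \<open>A map of presheaves \<open>f : B \<rightarrow> A\<close>, together with \<open>B\<close> and \<open>A\<close>; also seen as a polynomial \<open>1 \<rightarrow> 1\<close>.\<close>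

record ('o, 'm, 'b, 'a) mor =
  mdom :: "('o, 'm, 'b) psh"
  mcod :: "('o, 'm, 'a) psh"
  mmap :: "'o \<Rightarrow> 'b \<Rightarrow> 'a"

text \<open>
  A morphism \<open>\<phi> : f \<Rightarrow> g\<close> of polynomials: \<open>base\<close> is \<open>\<phi>\<^sub>0\<close>, \<open>apex\<close> is \<open>D\<^sub>\<phi>\<close>, \<open>proj\<close> is \<open>\<phi>\<^sub>1\<close> and \<open>bwd\<close>
  is \<open>\<phi>\<^sub>2\<close>.  The other leg \<open>D\<^sub>\<phi> \<rightarrow> A\<close> of the pullback must be \<open>f \<circ> \<phi>\<^sub>2\<close>, because \<open>\<phi>\<^sub>2\<close> is a morphism
  over \<open>A\<close>, so it is not recorded separately.
\<close>

record ('o, 'm, 'b, 'a, 'd, 'c, 'e) pmor =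
  src :: "('o, 'm, 'b, 'a) mor"
  tgt :: "('o, 'm, 'd, 'c) mor"
  base :: "'o \<Rightarrow> 'a \<Rightarrow> 'c"
  apex :: "('o, 'm, 'e) psh"
  proj :: "'o \<Rightarrow> 'e \<Rightarrow> 'd"
  bwd :: "'o \<Rightarrow> 'e \<Rightarrow> 'b"

text \<open>Unit, multiplication, and the three adjustments \<open>\<alpha>\<close>, \<open>\<lambda>\<close>, \<open>\<rho>\<close> of a pseudomonad.\<close>

record ('eta, 'mu, 'alpha, 'lam, 'rho) pseudomonad_data =
  p_eta :: 'eta
  p_mu :: 'mu
  p_alpha :: 'alpha
  p_lam :: 'lam
  p_rho :: 'rho

text \<open>The types of elements of \<open>\<Sum>a\<in>A. X\<^bsup>B\<^sub>a\<^esup>\<close> and of \<open>\<Sum>c\<in>C. \<Sum>m\<in>A\<^bsup>D\<^sub>c\<^esup>. \<Sum>d\<in>D\<^sub>c. B\<^bsub>m(d)\<^esub>\<close>.\<close>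

type_synonym ('m, 'b, 'a, 'x) ext_el = "'a \<times> ('m \<times> 'b \<Rightarrow> 'x)"

type_synonym ('m, 'd, 'c, 'b, 'a) comp_el = "('m, 'd, 'c, 'a) ext_el \<times> 'd \<times> 'b"

locale category =
  fixes C :: "('o, 'm) cat_data"
  assumes Dom_in: "f \<in> Arr C \<Longrightarrow> Dom C f \<in> Obj C"
    and Cod_in: "f \<in> Arr C \<Longrightarrow> Cod C f \<in> Obj C"
    and Idn_in: "X \<in> Obj C \<Longrightarrow> Idn C X \<in> Arr C"
    and Dom_Idn: "X \<in> Obj C \<Longrightarrow> Dom C (Idn C X) = X"
    and Cod_Idn: "X \<in> Obj C \<Longrightarrow> Cod C (Idn C X) = X"
    and Cmp_in: "\<lbrakk>f \<in> Arr C; g \<in> Arr C; Cod C g = Dom C f\<rbrakk> \<Longrightarrow> Cmp C f g \<in> Arr C"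
    and Dom_Cmp: "\<lbrakk>f \<in> Arr C; g \<in> Arr C; Cod C g = Dom C f\<rbrakk> \<Longrightarrow> Dom C (Cmp C f g) = Dom C g"
    and Cod_Cmp: "\<lbrakk>f \<in> Arr C; g \<in> Arr C; Cod C g = Dom C f\<rbrakk> \<Longrightarrow> Cod C (Cmp C f g) = Cod C f"
    and Cmp_Idn_left: "f \<in> Arr C \<Longrightarrow> Cmp C (Idn C (Cod C f)) f = f"
    and Cmp_Idn_right: "f \<in> Arr C \<Longrightarrow> Cmp C f (Idn C (Dom C f)) = f"
    and Cmp_assoc: "\<lbrakk>f \<in> Arr C; g \<in> Arr C; h \<in> Arr C; Cod C g = Dom C f; Cod C h = Dom C g\<rbrakk>
      \<Longrightarrow> Cmp C (Cmp C f g) h = Cmp C f (Cmp C g h)"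
begin

definition presheaf :: "('o, 'm, 'a) psh \<Rightarrow> bool" where
  "presheaf P \<longleftrightarrow>
     (\<forall>\<sigma>\<in>Arr C. \<forall>x\<in>El P (Cod C \<sigma>). Act P \<sigma> x \<in> El P (Dom C \<sigma>)) \<and>
     (\<forall>\<Gamma>\<in>Obj C. \<forall>x\<in>El P \<Gamma>. Act P (Idn C \<Gamma>) x = x) \<and>
     (\<forall>\<sigma>\<in>Arr C. \<forall>\<tau>\<in>Arr C. Cod C \<tau> = Dom C \<sigma> \<longrightarrow>
        (\<forall>x\<in>El P (Cod C \<sigma>). Act P (Cmp C \<sigma> \<tau>) x = Act P \<tau> (Act P \<sigma> x)))"

definition nat_trans :: "('o, 'm, 'a) psh \<Rightarrow> ('o, 'm, 'b) psh \<Rightarrow> ('o \<Rightarrow> 'a \<Rightarrow> 'b) \<Rightarrow> bool" where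
  "nat_trans P Q \<alpha> \<longleftrightarrow>
     (\<forall>\<Gamma>\<in>Obj C. \<forall>x\<in>El P \<Gamma>. \<alpha> \<Gamma> x \<in> El Q \<Gamma>) \<and>
     (\<forall>\<sigma>\<in>Arr C. \<forall>x\<in>El P (Cod C \<sigma>). \<alpha> (Dom C \<sigma>) (Act P \<sigma> x) = Act Q \<sigma> (\<alpha> (Cod C \<sigma>) x))"

text \<open>Natural transformations are total functions; only their values on elements of \<open>P\<close> matter.\<close>

definition nt_eq :: "('o, 'm, 'a) psh \<Rightarrow> ('o \<Rightarrow> 'a \<Rightarrow> 'b) \<Rightarrow> ('o \<Rightarrow> 'a \<Rightarrow> 'b) \<Rightarrow> bool" where
  "nt_eq P \<alpha> \<beta> \<longleftrightarrow> (\<forall>\<Gamma>\<in>Obj C. \<forall>x\<in>El P \<Gamma>. \<alpha> \<Gamma> x = \<beta> \<Gamma> x)"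

definition nt_comp :: "('o \<Rightarrow> 'b \<Rightarrow> 'c) \<Rightarrow> ('o \<Rightarrow> 'a \<Rightarrow> 'b) \<Rightarrow> 'o \<Rightarrow> 'a \<Rightarrow> 'c" where
  "nt_comp \<beta> \<alpha> = (\<lambda>\<Gamma> x. \<beta> \<Gamma> (\<alpha> \<Gamma> x))"

definition nt_id :: "'o \<Rightarrow> 'a \<Rightarrow> 'a" where
  "nt_id = (\<lambda>\<Gamma> x. x)"

definition invertible :: "('o, 'm, 'a) psh \<Rightarrow> ('o, 'm, 'b) psh \<Rightarrow> ('o \<Rightarrow> 'a \<Rightarrow> 'b) \<Rightarrow> bool" where
  "invertible P Q \<alpha> \<longleftrightarrow>
     (\<exists>\<beta>. nat_trans Q P \<beta> \<and> nt_eq P (nt_comp \<beta> \<alpha>) nt_id \<and> nt_eq Q (nt_comp \<alpha> \<beta>) nt_id)"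

definition morphism :: "('o, 'm, 'b, 'a) mor \<Rightarrow> bool" where
  "morphism f \<longleftrightarrow> presheaf (mdom f) \<and> presheaf (mcod f) \<and> nat_trans (mdom f) (mcod f) (mmap f)"

definition yoneda :: "'o \<Rightarrow> ('o, 'm, 'm) psh" where
  "yoneda \<Gamma> = \<lparr>El = (\<lambda>\<Delta>. {\<sigma> \<in> Arr C. Dom C \<sigma> = \<Delta> \<and> Cod C \<sigma> = \<Gamma>}), Act = (\<lambda>\<tau> \<sigma>. Cmp C \<sigma> \<tau>)\<rparr>"

definition yoneda_arr :: "'m \<Rightarrow> 'o \<Rightarrow> 'm \<Rightarrow> 'm" where
  "yoneda_arr \<sigma> = (\<lambda>\<Delta> \<tau>. Cmp C \<sigma> \<tau>)"

text \<open>The map \<open>y(\<Gamma>) \<rightarrow> P\<close> corresponding to \<open>x \<in> P(\<Gamma>)\<close>.\<close>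

definition yoneda_el :: "('o, 'm, 'a) psh \<Rightarrow> 'a \<Rightarrow> 'o \<Rightarrow> 'm \<Rightarrow> 'a" where
  "yoneda_el P x = (\<lambda>\<Delta> \<sigma>. Act P \<sigma> x)"

text \<open>
  The square with top \<open>t : P \<rightarrow> X\<close>, left \<open>l : P \<rightarrow> Y\<close>, right \<open>r : X \<rightarrow> Z\<close> and bottom \<open>b : Y \<rightarrow> Z\<close> is a
  pullback.  HOL cannot quantify over the element type of the test object \<open>T\<close> inside a formula.  The
  type of arrows is taken, so that \<open>T\<close> ranges over all representables in particular; by
  \<open>pullback_square_universal\<close> below the universal property then holds for test objects of
  every element type.
\<close>

definition pullback_square ::
  "('o, 'm, 'p) psh \<Rightarrow> ('o, 'm, 'x) psh \<Rightarrow> ('o, 'm, 'y) psh \<Rightarrow> ('o, 'm, 'z) psh \<Rightarrow>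
   ('o \<Rightarrow> 'p \<Rightarrow> 'x) \<Rightarrow> ('o \<Rightarrow> 'p \<Rightarrow> 'y) \<Rightarrow> ('o \<Rightarrow> 'x \<Rightarrow> 'z) \<Rightarrow> ('o \<Rightarrow> 'y \<Rightarrow> 'z) \<Rightarrow> bool" where
  "pullback_square P X Y Z t l r b \<longleftrightarrow>
     presheaf P \<and> presheaf X \<and> presheaf Y \<and> presheaf Z \<and>
     nat_trans P X t \<and> nat_trans P Y l \<and> nat_trans X Z r \<and> nat_trans Y Z b \<and>
     nt_eq P (nt_comp r t) (nt_comp b l) \<and>
     (\<forall>(T :: ('o, 'm, 'm) psh) h k.
        presheaf T \<and> nat_trans T X h \<and> nat_trans T Y k \<and> nt_eq T (nt_comp r h) (nt_comp b k) \<longrightarrow>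
        (\<exists>u. nat_trans T P u \<and> nt_eq T (nt_comp t u) h \<and> nt_eq T (nt_comp l u) k) \<and>
        (\<forall>u v. nat_trans T P u \<and> nt_eq T (nt_comp t u) h \<and> nt_eq T (nt_comp l u) k \<and>
               nat_trans T P v \<and> nt_eq T (nt_comp t v) h \<and> nt_eq T (nt_comp l v) k \<longrightarrow>
               nt_eq T u v))"

lemma presheaf_yoneda: "presheaf (yoneda \<Gamma>)"
  unfolding presheaf_def yoneda_def
  by (auto simp: Cmp_in Dom_Cmp Cod_Cmp Cmp_Idn_right Cmp_assoc Dom_in Cod_in)

lemma nat_trans_yoneda_el:
  assumes "presheaf P" "x \<in> El P \<Gamma>"
  shows "nat_trans (yoneda \<Gamma>) P (yoneda_el P x)"
  using assms unfolding presheaf_def nat_trans_def yoneda_def yoneda_el_def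
  by (auto simp: Dom_Cmp)

lemma pullback_mediator:
  fixes P :: "('o, 'm, 'p) psh" and T :: "('o, 'm, 't) psh"
  assumes P: "presheaf P" and T: "presheaf T"
    and t: "nat_trans P X t" and l: "nat_trans P Y l"
    and U: "\<And>\<Gamma> x y. \<lbrakk>\<Gamma> \<in> Obj C; x \<in> El X \<Gamma>; y \<in> El Y \<Gamma>; r \<Gamma> x = b \<Gamma> y\<rbrakk> \<Longrightarrow>
      \<exists>!z. z \<in> El P \<Gamma> \<and> t \<Gamma> z = x \<and> l \<Gamma> z = y"
    and h: "nat_trans T X h" and k: "nat_trans T Y k" and eq: "nt_eq T (nt_comp r h) (nt_comp b k)"
  shows "(\<exists>u. nat_trans T P u \<and> nt_eq T (nt_comp t u) h \<and> nt_eq T (nt_comp l u) k) \<and>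
    (\<forall>u v. nat_trans T P u \<and> nt_eq T (nt_comp t u) h \<and> nt_eq T (nt_comp l u) k \<and>
           nat_trans T P v \<and> nt_eq T (nt_comp t v) h \<and> nt_eq T (nt_comp l v) k \<longrightarrow> nt_eq T u v)"
proof -
  have ex1: "\<exists>!z. z \<in> El P \<Gamma> \<and> t \<Gamma> z = h \<Gamma> x \<and> l \<Gamma> z = k \<Gamma> x"
    if "\<Gamma> \<in> Obj C" "x \<in> El T \<Gamma>" for \<Gamma> x
    using that h k eq unfolding nat_trans_def nt_eq_def nt_comp_def by (intro U) auto
  define u where "u = (\<lambda>\<Gamma> x. THE z. z \<in> El P \<Gamma> \<and> t \<Gamma> z = h \<Gamma> x \<and> l \<Gamma> z = k \<Gamma> x)"
  have u: "u \<Gamma> x \<in> El P \<Gamma> \<and> t \<Gamma> (u \<Gamma> x) = h \<Gamma> x \<and> l \<Gamma> (u \<Gamma> x) = k \<Gamma> x"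
    if "\<Gamma> \<in> Obj C" "x \<in> El T \<Gamma>" for \<Gamma> x
    unfolding u_def using theI'[OF ex1[OF that]] .
  have "u (Dom C \<sigma>) (Act T \<sigma> x) = Act P \<sigma> (u (Cod C \<sigma>) x)"
    if s: "\<sigma> \<in> Arr C" and x: "x \<in> El T (Cod C \<sigma>)" for \<sigma> x
  proof -
    have x': "Act T \<sigma> x \<in> El T (Dom C \<sigma>)" using T s x unfolding presheaf_def by blast
    have c: "u (Cod C \<sigma>) x \<in> El P (Cod C \<sigma>)" "t (Cod C \<sigma>) (u (Cod C \<sigma>) x) = h (Cod C \<sigma>) x"
      "l (Cod C \<sigma>) (u (Cod C \<sigma>) x) = k (Cod C \<sigma>) x"
      using u[OF Cod_in[OF s] x] by auto
    have "Act P \<sigma> (u (Cod C \<sigma>) x) \<in> El P (Dom C \<sigma>)" using P s c(1) unfolding presheaf_def by blast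
    moreover have "t (Dom C \<sigma>) (Act P \<sigma> (u (Cod C \<sigma>) x)) = h (Dom C \<sigma>) (Act T \<sigma> x)"
      using t h s c x unfolding nat_trans_def by auto
    moreover have "l (Dom C \<sigma>) (Act P \<sigma> (u (Cod C \<sigma>) x)) = k (Dom C \<sigma>) (Act T \<sigma> x)"
      using l k s c x unfolding nat_trans_def by auto
    ultimately show ?thesis
      using ex1[OF Dom_in[OF s] x'] u[OF Dom_in[OF s] x'] by blast
  qed
  then have "nat_trans T P u" unfolding nat_trans_def using u by blast
  moreover have "nt_eq T (nt_comp t u) h" "nt_eq T (nt_comp l u) k"
    unfolding nt_eq_def nt_comp_def using u by auto
  moreover have "nt_eq T v w"
    if v: "nat_trans T P v" "nt_eq T (nt_comp t v) h" "nt_eq T (nt_comp l v) k"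
      and w: "nat_trans T P w" "nt_eq T (nt_comp t w) h" "nt_eq T (nt_comp l w) k" for v w
    unfolding nt_eq_def
  proof (intro ballI)
    fix \<Gamma> x assume x: "\<Gamma> \<in> Obj C" "x \<in> El T \<Gamma>"
    have "v \<Gamma> x \<in> El P \<Gamma> \<and> t \<Gamma> (v \<Gamma> x) = h \<Gamma> x \<and> l \<Gamma> (v \<Gamma> x) = k \<Gamma> x"
      "w \<Gamma> x \<in> El P \<Gamma> \<and> t \<Gamma> (w \<Gamma> x) = h \<Gamma> x \<and> l \<Gamma> (w \<Gamma> x) = k \<Gamma> x"
      using v w x unfolding nat_trans_def nt_eq_def nt_comp_def by auto
    then show "v \<Gamma> x = w \<Gamma> x" using ex1[OF x] by blast
  qed
  ultimately show ?thesis by blast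
qed

lemma pullback_square_iff:
  fixes P :: "('o, 'm, 'p) psh" and X :: "('o, 'm, 'x) psh"
    and Y :: "('o, 'm, 'y) psh" and Z :: "('o, 'm, 'z) psh"
  shows "pullback_square P X Y Z t l r b \<longleftrightarrow>
     presheaf P \<and> presheaf X \<and> presheaf Y \<and> presheaf Z \<and>
     nat_trans P X t \<and> nat_trans P Y l \<and> nat_trans X Z r \<and> nat_trans Y Z b \<and>
     nt_eq P (nt_comp r t) (nt_comp b l) \<and>
     (\<forall>\<Gamma>\<in>Obj C. \<forall>x\<in>El X \<Gamma>. \<forall>y\<in>El Y \<Gamma>. r \<Gamma> x = b \<Gamma> y \<longrightarrow>
        (\<exists>!z. z \<in> El P \<Gamma> \<and> t \<Gamma> z = x \<and> l \<Gamma> z = y))"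
    (is "_ \<longleftrightarrow> ?R")
proof
  assume pb: "pullback_square P X Y Z t l r b"
  then have pre: "presheaf P" "presheaf X" "presheaf Y"
    and nat: "nat_trans P X t" "nat_trans P Y l" "nat_trans X Z r" "nat_trans Y Z b"
    unfolding pullback_square_def by auto
  have ex: "\<exists>u. nat_trans T P u \<and> nt_eq T (nt_comp t u) h \<and> nt_eq T (nt_comp l u) k"
    if "presheaf T" "nat_trans T X h" "nat_trans T Y k" "nt_eq T (nt_comp r h) (nt_comp b k)"
    for T :: "('o, 'm, 'm) psh" and h k
    using pb that unfolding pullback_square_def by blast
  have uq: "nt_eq T u v"
    if "presheaf T" "nat_trans T X h" "nat_trans T Y k" "nt_eq T (nt_comp r h) (nt_comp b k)"
      "nat_trans T P u" "nt_eq T (nt_comp t u) h" "nt_eq T (nt_comp l u) k"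
      "nat_trans T P v" "nt_eq T (nt_comp t v) h" "nt_eq T (nt_comp l v) k"
    for T :: "('o, 'm, 'm) psh" and h k u v
    using pb that unfolding pullback_square_def by blast
  have "\<exists>!z. z \<in> El P \<Gamma> \<and> t \<Gamma> z = x \<and> l \<Gamma> z = y"
    if \<Gamma>: "\<Gamma> \<in> Obj C" and x: "x \<in> El X \<Gamma>" and y: "y \<in> El Y \<Gamma>" and eq: "r \<Gamma> x = b \<Gamma> y" for \<Gamma> x y
  proof -
    let ?T = "yoneda \<Gamma>" and ?h = "yoneda_el X x" and ?k = "yoneda_el Y y"
    have T: "presheaf ?T" "nat_trans ?T X ?h" "nat_trans ?T Y ?k"
      using presheaf_yoneda nat_trans_yoneda_el pre x y by auto
    have co: "nt_eq ?T (nt_comp r ?h) (nt_comp b ?k)"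
      unfolding nt_eq_def nt_comp_def
    proof (intro ballI)
      fix \<Delta> \<sigma> assume "\<Delta> \<in> Obj C" "\<sigma> \<in> El (yoneda \<Gamma>) \<Delta>"
      then have s: "\<sigma> \<in> Arr C" "Dom C \<sigma> = \<Delta>" "Cod C \<sigma> = \<Gamma>" by (auto simp: yoneda_def)
      have "r \<Delta> (Act X \<sigma> x) = Act Z \<sigma> (r \<Gamma> x)" "b \<Delta> (Act Y \<sigma> y) = Act Z \<sigma> (b \<Gamma> y)"
        using nat(3,4) s x y unfolding nat_trans_def by auto
      then show "r \<Delta> (yoneda_el X x \<Delta> \<sigma>) = b \<Delta> (yoneda_el Y y \<Delta> \<sigma>)"
        using eq by (simp add: yoneda_el_def)
    qed
    have i: "Idn C \<Gamma> \<in> El ?T \<Gamma>" using \<Gamma> by (simp add: yoneda_def Idn_in Dom_Idn Cod_Idn)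
    have ids: "Act X (Idn C \<Gamma>) x = x" "Act Y (Idn C \<Gamma>) y = y"
      using pre \<Gamma> x y unfolding presheaf_def by auto
    obtain u where u: "nat_trans ?T P u" "nt_eq ?T (nt_comp t u) ?h" "nt_eq ?T (nt_comp l u) ?k"
      using ex[OF T co] by blast
    show ?thesis
    proof (rule ex1I)
      show "u \<Gamma> (Idn C \<Gamma>) \<in> El P \<Gamma> \<and> t \<Gamma> (u \<Gamma> (Idn C \<Gamma>)) = x \<and> l \<Gamma> (u \<Gamma> (Idn C \<Gamma>)) = y"
        using u i \<Gamma> ids unfolding nat_trans_def nt_eq_def nt_comp_def yoneda_el_def by auto
    next
      fix z assume z: "z \<in> El P \<Gamma> \<and> t \<Gamma> z = x \<and> l \<Gamma> z = y"
      have v: "nat_trans ?T P (yoneda_el P z)" using nat_trans_yoneda_el pre z by auto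
      have "nt_eq ?T (nt_comp t (yoneda_el P z)) ?h" "nt_eq ?T (nt_comp l (yoneda_el P z)) ?k"
        using nat(1,2) z unfolding nt_eq_def nt_comp_def nat_trans_def yoneda_el_def yoneda_def by auto
      then have "nt_eq ?T (yoneda_el P z) u" using uq[OF T co v _ _ u] by blast
      then have "Act P (Idn C \<Gamma>) z = u \<Gamma> (Idn C \<Gamma>)"
        using \<Gamma> i unfolding nt_eq_def yoneda_el_def by auto
      then show "z = u \<Gamma> (Idn C \<Gamma>)" using pre(1) \<Gamma> z unfolding presheaf_def by auto
    qed
  qed
  then show ?R using pb unfolding pullback_square_def by blast
next
  assume R: ?R
  then have "presheaf P" "nat_trans P X t" "nat_trans P Y l"
    "\<And>\<Gamma> x y. \<lbrakk>\<Gamma> \<in> Obj C; x \<in> El X \<Gamma>; y \<in> El Y \<Gamma>; r \<Gamma> x = b \<Gamma> y\<rbrakk> \<Longrightarrow>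
      \<exists>!z. z \<in> El P \<Gamma> \<and> t \<Gamma> z = x \<and> l \<Gamma> z = y"
    by blast+
  note M = pullback_mediator[OF this(1) _ this(2-4)]
  show "pullback_square P X Y Z t l r b"
    unfolding pullback_square_def
    using R by (intro conjI allI impI) (blast, blast, blast, blast, blast, blast, blast, blast, blast,
      (erule conjE)+, rule M[THEN conjunct1], assumption+,
      (erule conjE)+, rule M[THEN conjunct2, rule_format], assumption+, blast)
qed

lemma pullback_square_universal:
  fixes T :: "('o, 'm, 't) psh"
  assumes "pullback_square P X Y Z t l r b" "presheaf T"
    "nat_trans T X h" "nat_trans T Y k" "nt_eq T (nt_comp r h) (nt_comp b k)"
  shows "(\<exists>u. nat_trans T P u \<and> nt_eq T (nt_comp t u) h \<and> nt_eq T (nt_comp l u) k) \<and>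
    (\<forall>u v. nat_trans T P u \<and> nt_eq T (nt_comp t u) h \<and> nt_eq T (nt_comp l u) k \<and>
           nat_trans T P v \<and> nt_eq T (nt_comp t v) h \<and> nt_eq T (nt_comp l v) k \<longrightarrow> nt_eq T u v)"
  using assms(1)[unfolded pullback_square_iff] assms(2-) by (intro pullback_mediator[where r = r and b = b]) blast+


section \<open>Polynomials and their extensions\<close>

definition one_psh :: "('o, 'm, unit) psh" where
  "one_psh = \<lparr>El = (\<lambda>_. {()}), Act = (\<lambda>_ _. ())\<rparr>"

definition id_poly :: "('o, 'm, unit, unit) mor" where
  "id_poly = \<lparr>mdom = one_psh, mcod = one_psh, mmap = nt_id\<rparr>"

text \<open>
  The elements of the fibre of \<open>f : B \<rightarrow> A\<close> over \<open>a \<in> A(\<Gamma>)\<close>, that is, of the presheaf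
  \<open>y(\<Gamma>) \<times>\<^sub>A B\<close>, at all stages \<open>\<sigma> : \<Delta> \<rightarrow> \<Gamma>\<close>.
\<close>

definition fib :: "('o, 'm, 'b, 'a) mor \<Rightarrow> 'o \<Rightarrow> 'a \<Rightarrow> ('m \<times> 'b) set" where
  "fib f \<Gamma> a = {(\<sigma>, b). \<sigma> \<in> Arr C \<and> Cod C \<sigma> = \<Gamma> \<and> b \<in> El (mdom f) (Dom C \<sigma>) \<and>
                         mmap f (Dom C \<sigma>) b = Act (mcod f) \<sigma> a}"

text \<open>
  \<open>P\<^sub>f(X) = \<Sum>a\<in>A. X\<^bsup>B\<^sub>a\<^esup>\<close>: an element at \<open>\<Gamma>\<close> is a pair of \<open>a \<in> A(\<Gamma>)\<close> and a natural transformation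
  \<open>y(\<Gamma>) \<times>\<^sub>A B \<rightarrow> X\<close>.
\<close>

definition pext :: "('o, 'm, 'b, 'a) mor \<Rightarrow> ('o, 'm, 'x) psh \<Rightarrow> ('o, 'm, ('m, 'b, 'a, 'x) ext_el) psh" where
  "pext f X = \<lparr>
     El = (\<lambda>\<Gamma>. {(a, m). a \<in> El (mcod f) \<Gamma> \<and> m \<in> extensional (fib f \<Gamma> a) \<and>
                (\<forall>(\<sigma>, b) \<in> fib f \<Gamma> a. m (\<sigma>, b) \<in> El X (Dom C \<sigma>)) \<and>
                (\<forall>(\<sigma>, b) \<in> fib f \<Gamma> a. \<forall>\<tau>\<in>Arr C. Cod C \<tau> = Dom C \<sigma> \<longrightarrow>
                   m (Cmp C \<sigma> \<tau>, Act (mdom f) \<tau> b) = Act X \<tau> (m (\<sigma>, b)))}),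
     Act = (\<lambda>\<sigma> (a, m). (Act (mcod f) \<sigma> a,
              restrict (\<lambda>(\<tau>, b). m (Cmp C \<sigma> \<tau>, b)) (fib f (Dom C \<sigma>) (Act (mcod f) \<sigma> a))))\<rparr>"

text \<open>\<open>P\<^sub>f\<close> on a morphism \<open>h : X \<rightarrow> Y\<close>.\<close>

definition pext_map ::
  "('o, 'm, 'b, 'a) mor \<Rightarrow> ('o \<Rightarrow> 'x \<Rightarrow> 'y) \<Rightarrow> 'o \<Rightarrow> ('m, 'b, 'a, 'x) ext_el \<Rightarrow> ('m, 'b, 'a, 'y) ext_el" where
  "pext_map f h = (\<lambda>\<Gamma> (a, m). (a, restrict (\<lambda>(\<sigma>, b). h (Dom C \<sigma>) (m (\<sigma>, b))) (fib f \<Gamma> a)))"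

text \<open>
  The composite \<open>g \<cdot> f\<close>.  An element \<open>m\<close> of \<open>A\<^bsup>D\<^sub>c\<^esup>\<close> at stage \<open>\<Gamma>\<close> is applied to \<open>d \<in> D(\<Gamma>)\<close> as
  \<open>m (id\<^sub>\<Gamma>, d)\<close>.
\<close>

definition comp_dom ::
  "('o, 'm, 'd, 'c) mor \<Rightarrow> ('o, 'm, 'b, 'a) mor \<Rightarrow> ('o, 'm, ('m, 'd, 'c, 'b, 'a) comp_el) psh" where
  "comp_dom g f = \<lparr>
     El = (\<lambda>\<Gamma>. {(w, d, b). w \<in> El (pext g (mcod f)) \<Gamma> \<and>
                 d \<in> El (mdom g) \<Gamma> \<and> mmap g \<Gamma> d = fst w \<and>
                 b \<in> El (mdom f) \<Gamma> \<and> mmap f \<Gamma> b = snd w (Idn C \<Gamma>, d)}),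
     Act = (\<lambda>\<sigma> (w, d, b). (Act (pext g (mcod f)) \<sigma> w, Act (mdom g) \<sigma> d, Act (mdom f) \<sigma> b))\<rparr>"

definition pcomp ::
  "('o, 'm, 'd, 'c) mor \<Rightarrow> ('o, 'm, 'b, 'a) mor \<Rightarrow>
   ('o, 'm, ('m, 'd, 'c, 'b, 'a) comp_el, ('m, 'd, 'c, 'a) ext_el) mor" (infixr "\<odot>" 75) where
  "g \<odot> f = \<lparr>mdom = comp_dom g f, mcod = pext g (mcod f), mmap = (\<lambda>\<Gamma>. fst)\<rparr>"

text \<open>The isomorphism \<open>X \<rightarrow> P\<^sub>i(X)\<close> for the identity polynomial \<open>i\<close>.\<close>

definition ext_id :: "('o, 'm, 'x) psh \<Rightarrow> 'o \<Rightarrow> 'x \<Rightarrow> ('m, unit, unit, 'x) ext_el" where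
  "ext_id X = (\<lambda>\<Gamma> x. ((), restrict (\<lambda>(\<sigma>, _). Act X \<sigma> x) (fib id_poly \<Gamma> ())))"

text \<open>The isomorphism \<open>P\<^sub>g(P\<^sub>f(X)) \<rightarrow> P\<^bsub>g \<cdot> f\<^esub>(X)\<close>.\<close>

definition ext_comp ::
  "('o, 'm, 'd, 'c) mor \<Rightarrow> ('o, 'm, 'b, 'a) mor \<Rightarrow> 'o \<Rightarrow>
   ('m, 'd, 'c, ('m, 'b, 'a, 'x) ext_el) ext_el \<Rightarrow>
   ('m, ('m, 'd, 'c, 'b, 'a) comp_el, ('m, 'd, 'c, 'a) ext_el, 'x) ext_el" where
  "ext_comp g f = (\<lambda>\<Gamma> (c, n).
     let w = (c, restrict (\<lambda>(\<sigma>, d). fst (n (\<sigma>, d))) (fib g \<Gamma> c))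
     in (w, restrict (\<lambda>(\<sigma>, (_, d, b)). snd (n (\<sigma>, d)) (Idn C (Dom C \<sigma>), b)) (fib (g \<odot> f) \<Gamma> w)))"


section \<open>Morphisms of polynomials and adjustments\<close>

definition poly_mor ::
  "('o, 'm, 'b, 'a) mor \<Rightarrow> ('o, 'm, 'd, 'c) mor \<Rightarrow> ('o, 'm, 'b, 'a, 'd, 'c, 'e) pmor \<Rightarrow> bool" where
  "poly_mor f g \<phi> \<longleftrightarrow> src \<phi> = f \<and> tgt \<phi> = g \<and> morphism f \<and> morphism g \<and>
     nat_trans (apex \<phi>) (mdom f) (bwd \<phi>) \<and>
     pullback_square (apex \<phi>) (mdom g) (mcod f) (mcod g)
       (proj \<phi>) (nt_comp (mmap f) (bwd \<phi>)) (mmap g) (base \<phi>)"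

definition cartesian ::
  "('o, 'm, 'b, 'a) mor \<Rightarrow> ('o, 'm, 'd, 'c) mor \<Rightarrow> ('o, 'm, 'b, 'a, 'd, 'c, 'e) pmor \<Rightarrow> bool" where
  "cartesian f g \<phi> \<longleftrightarrow> poly_mor f g \<phi> \<and> invertible (apex \<phi>) (mdom f) (bwd \<phi>)"

text \<open>The cartesian morphism given by a pullback square.\<close>

definition of_square ::
  "('o, 'm, 'b, 'a) mor \<Rightarrow> ('o, 'm, 'd, 'c) mor \<Rightarrow> ('o \<Rightarrow> 'a \<Rightarrow> 'c) \<Rightarrow> ('o \<Rightarrow> 'b \<Rightarrow> 'd) \<Rightarrow>
   ('o, 'm, 'b, 'a, 'd, 'c, 'b) pmor" where
  "of_square f g h k =
     \<lparr>src = f, tgt = g, base = h, apex = mdom f, proj = k, bwd = nt_id\<rparr>"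

definition id_mor :: "('o, 'm, 'b, 'a) mor \<Rightarrow> ('o, 'm, 'b, 'a, 'b, 'a, 'b) pmor" where
  "id_mor f = of_square f f nt_id nt_id"

text \<open>
  Vertical composition; \<open>D\<^bsub>\<psi> \<circ> \<phi>\<^esub>\<close> is the pullback of \<open>\<psi>\<^sub>2\<close> along \<open>\<phi>\<^sub>1\<close>.
\<close>

definition vcomp ::
  "('o, 'm, 'd, 'c, 'k, 'h, 'e2) pmor \<Rightarrow> ('o, 'm, 'b, 'a, 'd, 'c, 'e1) pmor \<Rightarrow>
   ('o, 'm, 'b, 'a, 'k, 'h, 'e1 \<times> 'e2) pmor" (infixr "\<bullet>" 70) where
  "\<psi> \<bullet> \<phi> = \<lparr>
     src = src \<phi>, tgt = tgt \<psi>,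
     base = nt_comp (base \<psi>) (base \<phi>),
     apex = \<lparr>El = (\<lambda>\<Gamma>. {(x, y). x \<in> El (apex \<phi>) \<Gamma> \<and> y \<in> El (apex \<psi>) \<Gamma> \<and> proj \<phi> \<Gamma> x = bwd \<psi> \<Gamma> y}),
             Act = (\<lambda>\<sigma> (x, y). (Act (apex \<phi>) \<sigma> x, Act (apex \<psi>) \<sigma> y))\<rparr>,
     proj = (\<lambda>\<Gamma> (x, y). proj \<psi> \<Gamma> y),
     bwd = (\<lambda>\<Gamma> (x, y). bwd \<phi> \<Gamma> x)\<rparr>"

text \<open>
  The component \<open>P\<^sub>\<phi> : P\<^sub>f(X) \<rightarrow> P\<^sub>g(X)\<close> of a morphism \<open>\<phi> : f \<Rightarrow> g\<close>: precomposition with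
  \<open>D\<^bsub>\<phi>\<^sub>0(a)\<^esub> \<cong> (D\<^sub>\<phi>)\<^sub>a \<rightarrow> B\<^sub>a\<close>.
\<close>

definition pext_nat ::
  "('o, 'm, 'b, 'a, 'd, 'c, 'e) pmor \<Rightarrow> 'o \<Rightarrow> ('m, 'b, 'a, 'x) ext_el \<Rightarrow> ('m, 'd, 'c, 'x) ext_el" where
  "pext_nat \<phi> = (\<lambda>\<Gamma> (a, m). (base \<phi> \<Gamma> a,
     restrict (\<lambda>(\<sigma>, d). m (\<sigma>, bwd \<phi> (Dom C \<sigma>)
         (THE e. e \<in> El (apex \<phi>) (Dom C \<sigma>) \<and> proj \<phi> (Dom C \<sigma>) e = d \<and>
                 mmap (src \<phi>) (Dom C \<sigma>) (bwd \<phi> (Dom C \<sigma>) e) = Act (mcod (src \<phi>)) \<sigma> a)))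
       (fib (tgt \<phi>) \<Gamma> (base \<phi> \<Gamma> a))))"

text \<open>
  Horizontal composition \<open>\<psi> \<cdot> \<phi> : g \<cdot> f \<Rightarrow> g' \<cdot> f'\<close> of \<open>\<phi> : f \<Rightarrow> f'\<close> and \<open>\<psi> : g \<Rightarrow> g'\<close>; its apex is
  \<open>\<Sum>c\<in>C. \<Sum>m\<in>A\<^bsup>D\<^sub>c\<^esup>. \<Sum>e\<in>(D\<^sub>\<psi>)\<^sub>c. (D\<^sub>\<phi>)\<^bsub>m(\<psi>\<^sub>2(e))\<^esub>\<close>.
\<close>

definition hcomp ::
  "('o, 'm, 'd, 'c, 'd', 'c', 'e2) pmor \<Rightarrow> ('o, 'm, 'b, 'a, 'b', 'a', 'e1) pmor \<Rightarrow>
   ('o, 'm, ('m, 'd, 'c, 'b, 'a) comp_el, ('m, 'd, 'c, 'a) ext_el,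
    ('m, 'd', 'c', 'b', 'a') comp_el, ('m, 'd', 'c', 'a') ext_el,
    ('m, 'd, 'c, 'a) ext_el \<times> 'e2 \<times> 'e1) pmor" (infixr "\<star>" 75) where
  "\<psi> \<star> \<phi> = (let g = src \<psi>; f = src \<phi>;
                h = nt_comp (pext_nat \<psi>) (pext_map g (base \<phi>)) in \<lparr>
     src = g \<odot> f, tgt = tgt \<psi> \<odot> tgt \<phi>,
     base = h,
     apex = \<lparr>El = (\<lambda>\<Gamma>. {(w, e, x). w \<in> El (pext g (mcod f)) \<Gamma> \<and>
                 e \<in> El (apex \<psi>) \<Gamma> \<and> mmap g \<Gamma> (bwd \<psi> \<Gamma> e) = fst w \<and>
                 x \<in> El (apex \<phi>) \<Gamma> \<and> mmap f \<Gamma> (bwd \<phi> \<Gamma> x) = snd w (Idn C \<Gamma>, bwd \<psi> \<Gamma> e)}),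
             Act = (\<lambda>\<sigma> (w, e, x). (Act (pext g (mcod f)) \<sigma> w, Act (apex \<psi>) \<sigma> e, Act (apex \<phi>) \<sigma> x))\<rparr>,
     proj = (\<lambda>\<Gamma> (w, e, x). (h \<Gamma> w, proj \<psi> \<Gamma> e, proj \<phi> \<Gamma> x)),
     bwd = (\<lambda>\<Gamma> (w, e, x). (w, bwd \<psi> \<Gamma> e, bwd \<phi> \<Gamma> x))\<rparr>)"

text \<open>The constraints \<open>h \<cdot> (g \<cdot> f) \<Rightarrow> (h \<cdot> g) \<cdot> f\<close>, \<open>t \<Rightarrow> t \<cdot> i\<close> and \<open>t \<Rightarrow> i \<cdot> t\<close>.\<close>

definition assoc where
  "assoc h g f = of_square (h \<odot> g \<odot> f) ((h \<odot> g) \<odot> f) (ext_comp h g)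
     (\<lambda>\<Gamma> (w, z, (v, d, b)). let w' = ext_comp h g \<Gamma> w in (w', (fst w', z, d), b))"

definition runit where
  "runit t = (let h = (\<lambda>\<Gamma> a. (a, restrict (\<lambda>_. ()) (fib t \<Gamma> a)))
     in of_square t (t \<odot> id_poly) h (\<lambda>\<Gamma> b. (h \<Gamma> (mmap t \<Gamma> b), b, ())))"

definition lunit where
  "lunit t = of_square t (id_poly \<odot> t) (ext_id (mcod t)) (\<lambda>\<Gamma> b. (ext_id (mcod t) \<Gamma> (mmap t \<Gamma> b), (), b))"

definition adjustment ::
  "('o, 'm, 'b, 'a, 'd, 'c, 'e1) pmor \<Rightarrow> ('o, 'm, 'b, 'a, 'd, 'c, 'e2) pmor \<Rightarrow>
   ('o \<Rightarrow> 'e1 \<Rightarrow> 'e2) \<Rightarrow> bool" where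
  "adjustment \<phi> \<psi> \<alpha> \<longleftrightarrow> src \<phi> = src \<psi> \<and> tgt \<phi> = tgt \<psi> \<and>
     poly_mor (src \<phi>) (tgt \<phi>) \<phi> \<and> poly_mor (src \<psi>) (tgt \<psi>) \<psi> \<and>
     nat_trans (apex \<phi>) (apex \<psi>) \<alpha> \<and> nt_eq (apex \<phi>) (nt_comp (bwd \<psi>) \<alpha>) (bwd \<phi>)"

definition inv_adjustment ::
  "('o, 'm, 'b, 'a, 'd, 'c, 'e1) pmor \<Rightarrow> ('o, 'm, 'b, 'a, 'd, 'c, 'e2) pmor \<Rightarrow>
   ('o \<Rightarrow> 'e1 \<Rightarrow> 'e2) \<Rightarrow> bool" where
  "inv_adjustment \<phi> \<psi> \<alpha> \<longleftrightarrow> adjustment \<phi> \<psi> \<alpha> \<and>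
     (\<exists>\<beta>. adjustment \<psi> \<phi> \<beta> \<and> nt_eq (apex \<phi>) (nt_comp \<beta> \<alpha>) nt_id \<and> nt_eq (apex \<psi>) (nt_comp \<alpha> \<beta>) nt_id)"

text \<open>
  The unique adjustment into a cartesian morphism \<open>\<psi>\<close>, which is \<open>\<psi>\<^sub>2\<^sup>-\<^sup>1 \<circ> \<phi>\<^sub>2\<close>.  All structural 2-cells
  of the tricategory (associativity of vertical composition, interchange, naturality of \<open>assoc\<close>,
  the pentagon, functoriality of whiskering) are of this form.
\<close>

definition coh ::
  "('o, 'm, 'b, 'a, 'd, 'c, 'e1) pmor \<Rightarrow> ('o, 'm, 'b, 'a, 'd, 'c, 'e2) pmor \<Rightarrow> 'o \<Rightarrow> 'e1 \<Rightarrow> 'e2" where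
  "coh \<phi> \<psi> = (\<lambda>\<Gamma> x. THE y. y \<in> El (apex \<psi>) \<Gamma> \<and> bwd \<psi> \<Gamma> y = bwd \<phi> \<Gamma> x)"

text \<open>Composition of adjustments, in diagrammatic order.\<close>

abbreviation adj_then :: "('o \<Rightarrow> 'a \<Rightarrow> 'b) \<Rightarrow> ('o \<Rightarrow> 'b \<Rightarrow> 'c) \<Rightarrow> 'o \<Rightarrow> 'a \<Rightarrow> 'c" (infixl "\<triangleright>" 60) where
  "\<alpha> \<triangleright> \<beta> \<equiv> nt_comp \<beta> \<alpha>"

text \<open>
  Whiskering of \<open>\<alpha> : \<phi> \<Rrightarrow> \<phi>'\<close> to \<open>\<psi> \<circ> \<alpha> : \<psi> \<circ> \<phi> \<Rrightarrow> \<psi> \<circ> \<phi>'\<close>, for cartesian \<open>\<psi>\<close>, with \<open>\<phi>'\<close> as second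
  argument.  Since \<open>\<phi>\<^sub>1\<close> and \<open>\<phi>'\<^sub>1 \<circ> \<alpha>\<close> may differ, the component in \<open>D\<^sub>\<psi>\<close> has to be recomputed.
\<close>

definition post ::
  "('o, 'm, 'd, 'c, 'k, 'h, 'e) pmor \<Rightarrow> ('o, 'm, 'b, 'a, 'd, 'c, 'e2) pmor \<Rightarrow>
   ('o \<Rightarrow> 'e1 \<Rightarrow> 'e2) \<Rightarrow> 'o \<Rightarrow> 'e1 \<times> 'e \<Rightarrow> 'e2 \<times> 'e" where
  "post \<psi> \<phi>' \<alpha> = (\<lambda>\<Gamma> (x, y).
     (\<alpha> \<Gamma> x, THE y'. y' \<in> El (apex \<psi>) \<Gamma> \<and> bwd \<psi> \<Gamma> y' = proj \<phi>' \<Gamma> (\<alpha> \<Gamma> x)))"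

text \<open>Whiskering of \<open>\<alpha> : \<psi> \<Rrightarrow> \<psi>'\<close> to \<open>\<alpha> \<circ> \<phi> : \<psi> \<circ> \<phi> \<Rrightarrow> \<psi>' \<circ> \<phi>\<close>.\<close>

definition pre :: "('o \<Rightarrow> 'e1 \<Rightarrow> 'e2) \<Rightarrow> 'o \<Rightarrow> 'e \<times> 'e1 \<Rightarrow> 'e \<times> 'e2" where
  "pre \<alpha> = (\<lambda>\<Gamma> (x, y). (x, \<alpha> \<Gamma> y))"

text \<open>Horizontal whiskering of an adjustment \<open>\<alpha>\<close> with a polynomial \<open>t\<close>, to \<open>t \<cdot> \<alpha>\<close> and to \<open>\<alpha> \<cdot> t\<close>.\<close>

definition hleft :: "('o \<Rightarrow> 'e1 \<Rightarrow> 'e2) \<Rightarrow> 'o \<Rightarrow> 'w \<times> 'e \<times> 'e1 \<Rightarrow> 'w \<times> 'e \<times> 'e2" where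
  "hleft \<alpha> = (\<lambda>\<Gamma> (w, e, x). (w, e, \<alpha> \<Gamma> x))"

definition hright :: "('o \<Rightarrow> 'e1 \<Rightarrow> 'e2) \<Rightarrow> 'o \<Rightarrow> 'w \<times> 'e1 \<times> 'e \<Rightarrow> 'w \<times> 'e2 \<times> 'e" where
  "hright \<alpha> = (\<lambda>\<Gamma> (w, e, x). (w, \<alpha> \<Gamma> e, x))"


section \<open>Polynomial pseudomonads\<close>

text \<open>
  With the constraints of the bicategory made explicit, the three adjustments are
  \<open>\<alpha> : \<mu> \<circ> (t \<cdot> \<mu>) \<Rrightarrow> \<mu> \<circ> (\<mu> \<cdot> t) \<circ> assoc\<close>, \<open>\<lambda> : \<mu> \<circ> (t \<cdot> \<eta>) \<circ> runit \<Rrightarrow> id\<close> and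
  \<open>\<rho> : \<mu> \<circ> (\<eta> \<cdot> t) \<circ> lunit \<Rrightarrow> id\<close>.
\<close>

definition pseudomonad_assoc_axiom where
  "pseudomonad_assoc_axiom t \<mu> \<alpha> \<longleftrightarrow>
    (let I = id_mor t; II = id_mor (t \<odot> t); A = assoc t t t;
         S = \<mu> \<bullet> (I \<star> \<mu>) \<bullet> (I \<star> I \<star> \<mu>);
         T = \<mu> \<bullet> (\<mu> \<star> I) \<bullet> ((\<mu> \<star> I) \<star> I) \<bullet> assoc (t \<odot> t) t t \<bullet> assoc t t (t \<odot> t);
         L = \<mu> \<bullet> (I \<star> \<mu>);
         R = \<mu> \<bullet> (\<mu> \<star> I) \<bullet> A;
         X = (I \<star> (\<mu> \<star> I)) \<bullet> (I \<star> A);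
         Y = assoc t (t \<odot> t) t \<bullet> (I \<star> A);
         J1 = (\<mu> \<star> I) \<bullet> (II \<star> \<mu>);
         J2 = (I \<star> \<mu>) \<bullet> (\<mu> \<star> II);
         B = assoc t t (t \<odot> t);
         Z = (\<mu> \<star> II) \<bullet> B
     in nt_eq (apex S)
          (coh S (\<mu> \<bullet> (I \<star> L)) \<triangleright> post \<mu> (I \<star> R) (hleft \<alpha>) \<triangleright>
           coh (\<mu> \<bullet> (I \<star> R)) (L \<bullet> X) \<triangleright> pre \<alpha> \<triangleright>
           coh (R \<bullet> X) ((\<mu> \<bullet> (L \<star> I)) \<bullet> Y) \<triangleright> pre (post \<mu> (R \<star> I) (hright \<alpha>)) \<triangleright>
           coh ((\<mu> \<bullet> (R \<star> I)) \<bullet> Y) T)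
          (coh S (L \<bullet> (I \<star> I \<star> \<mu>)) \<triangleright> pre \<alpha> \<triangleright>
           coh (R \<bullet> (I \<star> I \<star> \<mu>)) ((\<mu> \<bullet> J1) \<bullet> B) \<triangleright> pre (post \<mu> J2 (coh J1 J2)) \<triangleright>
           coh ((\<mu> \<bullet> J2) \<bullet> B) (L \<bullet> Z) \<triangleright> pre \<alpha> \<triangleright>
           coh (R \<bullet> Z) T))"

definition pseudomonad_unit_axiom where
  "pseudomonad_unit_axiom t \<eta> \<mu> \<alpha> lam rho \<longleftrightarrow>
    (let I = id_mor t;
         L = \<mu> \<bullet> (I \<star> \<mu>);
         R = \<mu> \<bullet> (\<mu> \<star> I) \<bullet> assoc t t t;
         Z = (I \<star> (\<eta> \<star> I)) \<bullet> (I \<star> lunit t);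
         S = \<mu> \<bullet> (I \<star> (\<mu> \<bullet> (\<eta> \<star> I) \<bullet> lunit t))
     in nt_eq (apex S)
          (coh S (L \<bullet> Z) \<triangleright> pre \<alpha> \<triangleright>
           coh (R \<bullet> Z) (\<mu> \<bullet> ((\<mu> \<bullet> (I \<star> \<eta>) \<bullet> runit t) \<star> I)) \<triangleright> post \<mu> (I \<star> I) (hright lam))
          (post \<mu> (I \<star> I) (hleft rho)))"

definition polynomial_pseudomonad where
  "polynomial_pseudomonad t M \<longleftrightarrow>
    (let \<eta> = p_eta M; \<mu> = p_mu M; I = id_mor t in
       morphism t \<and> cartesian id_poly t \<eta> \<and> cartesian (t \<odot> t) t \<mu> \<and>
       inv_adjustment (\<mu> \<bullet> (I \<star> \<mu>)) (\<mu> \<bullet> (\<mu> \<star> I) \<bullet> assoc t t t) (p_alpha M) \<and>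
       inv_adjustment (\<mu> \<bullet> (I \<star> \<eta>) \<bullet> runit t) I (p_lam M) \<and>
       inv_adjustment (\<mu> \<bullet> (\<eta> \<star> I) \<bullet> lunit t) I (p_rho M) \<and>
       pseudomonad_assoc_axiom t \<mu> (p_alpha M) \<and>
       pseudomonad_unit_axiom t \<eta> \<mu> (p_alpha M) (p_lam M) (p_rho M))"

text \<open>
  The type constraints choose a type for the elements of the apexes of \<open>\<eta>\<close> and \<open>\<mu>\<close>, namely that of
  the domain of the source polynomial; this is no restriction, as the apex of a cartesian morphism
  is isomorphic to that domain.
\<close>

definition has_pseudomonad_structure :: "('o, 'm, 'v, 'u) mor \<Rightarrow> bool" where
  "has_pseudomonad_structure t \<longleftrightarrow>
    (\<exists>(\<eta> :: ('o, 'm, unit, unit, 'v, 'u, unit) pmor)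
      (\<mu> :: ('o, 'm, ('m, 'v, 'u, 'v, 'u) comp_el, ('m, 'v, 'u, 'u) ext_el, 'v, 'u,
             ('m, 'v, 'u, 'v, 'u) comp_el) pmor) \<alpha> lam rho.
      polynomial_pseudomonad t \<lparr>p_eta = \<eta>, p_mu = \<mu>, p_alpha = \<alpha>, p_lam = lam, p_rho = rho\<rparr>)"


section \<open>The lifted pseudomonad and polynomial pseudoalgebras\<close>

definition lift_obj where
  "lift_obj p f = \<lparr>mdom = pext p (mdom f), mcod = pext p (mcod f), mmap = pext_map p (mmap f)\<rparr>"

definition lift_mor where
  "lift_mor p \<phi> = \<lparr>src = lift_obj p (src \<phi>), tgt = lift_obj p (tgt \<phi>),
     base = pext_map p (base \<phi>), apex = pext p (apex \<phi>),
     proj = pext_map p (proj \<phi>), bwd = pext_map p (bwd \<phi>)\<rparr>"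

text \<open>
  The naturality squares at \<open>f\<close> of \<open>P\<^sub>\<eta>\<close> and \<open>P\<^sub>\<mu>\<close>, precomposed with the isomorphisms \<open>Id \<cong> P\<^sub>i\<close> and
  \<open>P\<^sub>p \<circ> P\<^sub>p \<cong> P\<^bsub>p \<cdot> p\<^esub>\<close>.
\<close>

definition lift_unit where
  "lift_unit p \<eta> f = of_square f (lift_obj p f)
     (nt_comp (pext_nat \<eta>) (ext_id (mcod f))) (nt_comp (pext_nat \<eta>) (ext_id (mdom f)))"

definition lift_mult where
  "lift_mult p \<mu> f = of_square (lift_obj p (lift_obj p f)) (lift_obj p f)
     (nt_comp (pext_nat \<mu>) (ext_comp p p)) (nt_comp (pext_nat \<mu>) (ext_comp p p))"

text \<open>The associator, the unitor and the naturality of the multiplication of the lifted pseudomonad.\<close>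

definition lift_associator where
  "lift_associator p \<mu> f = coh (lift_mult p \<mu> f \<bullet> lift_mor p (lift_mult p \<mu> f))
                               (lift_mult p \<mu> f \<bullet> lift_mult p \<mu> (lift_obj p f))"

definition lift_unitor where
  "lift_unitor p \<eta> \<mu> f = coh (lift_mult p \<mu> f \<bullet> lift_mor p (lift_unit p \<eta> f)) (id_mor (lift_obj p f))"

definition lift_mult_nat where
  "lift_mult_nat p \<mu> \<phi> = coh (lift_mult p \<mu> (tgt \<phi>) \<bullet> lift_mor p (lift_mor p \<phi>))
                             (lift_mor p \<phi> \<bullet> lift_mult p \<mu> (src \<phi>))"

definition pseudoalgebra_assoc_axiom where
  "pseudoalgebra_assoc_axiom p \<mu> f \<zeta> \<sigma> \<longleftrightarrow>
    (let P\<zeta> = lift_mor p \<zeta>; PP\<zeta> = lift_mor p P\<zeta>;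
         m = lift_mult p \<mu> f; mP = lift_mult p \<mu> (lift_obj p f); Pm = lift_mor p m;
         L = \<zeta> \<bullet> P\<zeta>; R = \<zeta> \<bullet> m;
         S = \<zeta> \<bullet> P\<zeta> \<bullet> PP\<zeta>; T = \<zeta> \<bullet> m \<bullet> mP
     in nt_eq (apex S)
          (coh S (\<zeta> \<bullet> lift_mor p L) \<triangleright> post \<zeta> (lift_mor p R) (pext_map p \<sigma>) \<triangleright>
           coh (\<zeta> \<bullet> lift_mor p R) (L \<bullet> Pm) \<triangleright> pre \<sigma> \<triangleright>
           coh (R \<bullet> Pm) (\<zeta> \<bullet> (m \<bullet> Pm)) \<triangleright> post \<zeta> (m \<bullet> mP) (lift_associator p \<mu> f))
          (coh S (L \<bullet> PP\<zeta>) \<triangleright> pre \<sigma> \<triangleright>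
           coh (R \<bullet> PP\<zeta>) (\<zeta> \<bullet> (m \<bullet> PP\<zeta>)) \<triangleright> post \<zeta> (P\<zeta> \<bullet> mP) (lift_mult_nat p \<mu> \<zeta>) \<triangleright>
           coh (\<zeta> \<bullet> (P\<zeta> \<bullet> mP)) (L \<bullet> mP) \<triangleright> pre \<sigma> \<triangleright>
           coh (R \<bullet> mP) T))"

definition pseudoalgebra_unit_axiom where
  "pseudoalgebra_unit_axiom p \<eta> \<mu> f \<zeta> \<sigma> \<tau> \<longleftrightarrow>
    (let P\<zeta> = lift_mor p \<zeta>; h = lift_unit p \<eta> f; m = lift_mult p \<mu> f; Ph = lift_mor p h;
         I = id_mor (lift_obj p f); PI = lift_mor p (id_mor f);
         L = \<zeta> \<bullet> P\<zeta>; R = \<zeta> \<bullet> m; S = \<zeta> \<bullet> lift_mor p (\<zeta> \<bullet> h)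
     in nt_eq (apex S)
          (coh S (L \<bullet> Ph) \<triangleright> pre \<sigma> \<triangleright>
           coh (R \<bullet> Ph) (\<zeta> \<bullet> (m \<bullet> Ph)) \<triangleright> post \<zeta> I (lift_unitor p \<eta> \<mu> f) \<triangleright>
           coh (\<zeta> \<bullet> I) (\<zeta> \<bullet> PI))
          (post \<zeta> PI (pext_map p \<tau>)))"

definition polynomial_pseudoalgebra where
  "polynomial_pseudoalgebra p M f \<zeta> \<sigma> \<tau> \<longleftrightarrow>
     morphism f \<and> cartesian (lift_obj p f) f \<zeta> \<and>
     inv_adjustment (\<zeta> \<bullet> lift_mor p \<zeta>) (\<zeta> \<bullet> lift_mult p (p_mu M) f) \<sigma> \<and>
     inv_adjustment (\<zeta> \<bullet> lift_unit p (p_eta M) f) (id_mor f) \<tau> \<and>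
     pseudoalgebra_assoc_axiom p (p_mu M) f \<zeta> \<sigma> \<and>
     pseudoalgebra_unit_axiom p (p_eta M) (p_mu M) f \<zeta> \<sigma> \<tau>"

text \<open>The element type of the apex of \<open>\<zeta>\<close> is fixed for the same reason as in \<open>has_pseudomonad_structure\<close>.\<close>

definition has_pseudoalgebra_structure where
  "has_pseudoalgebra_structure (p :: ('o, 'm, 'v, 'u) mor) M (f :: ('o, 'm, 'b, 'a) mor) \<longleftrightarrow>
    (\<exists>(\<zeta> :: ('o, 'm, ('m, 'v, 'u, 'b) ext_el, ('m, 'v, 'u, 'a) ext_el, 'b, 'a,
             ('m, 'v, 'u, 'b) ext_el) pmor) \<sigma> \<tau>.
      polynomial_pseudoalgebra p M f \<zeta> \<sigma> \<tau>)"


section \<open>Type formers\<close>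

definition supports_unit :: "('o, 'm, 'v, 'u) mor \<Rightarrow> bool" where
  "supports_unit p \<longleftrightarrow>
    (\<exists>unit_ty star. pullback_square one_psh (mdom p) one_psh (mcod p) star nt_id (mmap p) unit_ty)"

text \<open>
  \<open>pext p U\<close> is \<open>\<Sum>A:U. U\<^bsup>[A]\<^esup>\<close>, and \<open>comp_dom p p\<close> is \<open>\<Sum>A:U. \<Sum>B:U\<^bsup>[A]\<^esup>. \<Sum>a:[A]. [B(a)]\<close> with elements
  \<open>((A, B), a, b)\<close>.
\<close>

definition supports_Sigma :: "('o, 'm, 'v, 'u) mor \<Rightarrow> bool" where
  "supports_Sigma p \<longleftrightarrow>
    (\<exists>Sigma_ty pair. pullback_square (comp_dom p p) (mdom p) (pext p (mcod p)) (mcod p)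
                      pair (\<lambda>\<Gamma> ((A, B), a, b). (A, B)) (mmap p) Sigma_ty)"

definition supports_Pi :: "('o, 'm, 'v, 'u) mor \<Rightarrow> bool" where
  "supports_Pi p \<longleftrightarrow>
    (\<exists>Pi_ty lam. pullback_square (pext p (mdom p)) (mdom p) (pext p (mcod p)) (mcod p)
                  lam (pext_map p (mmap p)) (mmap p) Pi_ty)"

end


section \<open>Natural models\<close>

text \<open>
  \<open>p : U' \<rightarrow> U\<close> carries the two presheaves; \<open>ctx \<Gamma> A\<close>, \<open>wk \<Gamma> A\<close> and \<open>var \<Gamma> A\<close> are \<open>\<Gamma>\<cdot>A\<close>, \<open>p\<^sub>A\<close> and \<open>q\<^sub>A\<close>.
\<close>

locale natural_model = category C
  for C :: "('o, 'm) cat_data" +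
  fixes emp :: 'o
    and p :: "('o, 'm, 'v, 'u) mor"
    and ctx :: "'o \<Rightarrow> 'u \<Rightarrow> 'o"
    and wk :: "'o \<Rightarrow> 'u \<Rightarrow> 'm"
    and var :: "'o \<Rightarrow> 'u \<Rightarrow> 'v"
  assumes emp_in: "emp \<in> Obj C"
    and emp_terminal: "\<Gamma> \<in> Obj C \<Longrightarrow> \<exists>!\<sigma>. \<sigma> \<in> Arr C \<and> Dom C \<sigma> = \<Gamma> \<and> Cod C \<sigma> = emp"
    and morphism_p: "morphism p"
    and ctx_in: "\<lbrakk>\<Gamma> \<in> Obj C; A \<in> El (mcod p) \<Gamma>\<rbrakk> \<Longrightarrow> ctx \<Gamma> A \<in> Obj C"
    and wk_in: "\<lbrakk>\<Gamma> \<in> Obj C; A \<in> El (mcod p) \<Gamma>\<rbrakk> \<Longrightarrow>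
      wk \<Gamma> A \<in> Arr C \<and> Dom C (wk \<Gamma> A) = ctx \<Gamma> A \<and> Cod C (wk \<Gamma> A) = \<Gamma>"
    and var_in: "\<lbrakk>\<Gamma> \<in> Obj C; A \<in> El (mcod p) \<Gamma>\<rbrakk> \<Longrightarrow> var \<Gamma> A \<in> El (mdom p) (ctx \<Gamma> A)"
    and ctx_pullback: "\<lbrakk>\<Gamma> \<in> Obj C; A \<in> El (mcod p) \<Gamma>\<rbrakk> \<Longrightarrow>
      pullback_square (yoneda (ctx \<Gamma> A)) (mdom p) (yoneda \<Gamma>) (mcod p)
        (yoneda_el (mdom p) (var \<Gamma> A)) (yoneda_arr (wk \<Gamma> A)) (mmap p) (yoneda_el (mcod p) A)"

end

theory Submission
  imports Defs
begin

text \<open>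
  A unit type is a cartesian morphism \<open>i\<^sub>1 \<Rightarrow> p\<close>, dependent sums are a cartesian morphism
  \<open>p \<cdot> p \<Rightarrow> p\<close>, and dependent products a cartesian morphism \<open>P\<^sub>p(p) \<Rightarrow> p\<close>.  All composites entering
  the definitions of pseudomonads and pseudoalgebras are again cartesian: \<open>P\<^sub>p\<close> preserves pullbacks,
  and \<open>P\<^sub>\<phi>\<close> is a cartesian transformation for cartesian \<open>\<phi>\<close>.  Between cartesian morphisms adjustments
  exist and are unique, because the backward component of the target is invertible.  Hence the
  structure 2-cells come for free, and each coherence axiom compares two maps with the same image
  under an injective \<open>bwd\<close>.
\<close>

text \<open>The obstacle is that the apex of a cartesian morphism is only isomorphic to the domain
  of its source, while composites have apexes made of pairs and triples. Each composite is therefore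
  compared with an ordinary pullback square, whose top side is \<open>top_map\<close>. Pullbacks,
  invertibility and P_f are all handled on elements at a stage \<Gamma>, which
  \<open>pullback_square_iff\<close> makes legitimate. Uniqueness of adjustments is used through the
  predicate \<open>over\<close>, which drops naturality: a map of apexes that commutes with
  \<open>bwd\<close> is already determined when its target is cartesian. This suits the maps in the
  axioms, several of which are given by definite description. In checking the axioms, naturality
  comes back only where P_p is applied to an adjustment, because the result must again be a family
  natural in the stage.\<close>

context category
begin

section \<open>Elementwise rules for presheaves and natural transformations\<close>

lemma Act_El: "\<lbrakk>presheaf P; \<sigma> \<in> Arr C; Cod C \<sigma> = \<Gamma>; x \<in> El P \<Gamma>\<rbrakk> \<Longrightarrow> Act P \<sigma> x \<in> El P (Dom C \<sigma>)"
  unfolding presheaf_def by blast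

lemma Act_Idn: "\<lbrakk>presheaf P; \<Gamma> \<in> Obj C; x \<in> El P \<Gamma>\<rbrakk> \<Longrightarrow> Act P (Idn C \<Gamma>) x = x"
  unfolding presheaf_def by blast

lemma Act_Cmp: "\<lbrakk>presheaf P; \<sigma> \<in> Arr C; \<tau> \<in> Arr C; Cod C \<tau> = Dom C \<sigma>; x \<in> El P (Cod C \<sigma>)\<rbrakk> \<Longrightarrow>
    Act P (Cmp C \<sigma> \<tau>) x = Act P \<tau> (Act P \<sigma> x)"
  unfolding presheaf_def by blast

lemma nt_El: "\<lbrakk>nat_trans P Q \<alpha>; \<Gamma> \<in> Obj C; x \<in> El P \<Gamma>\<rbrakk> \<Longrightarrow> \<alpha> \<Gamma> x \<in> El Q \<Gamma>"
  unfolding nat_trans_def by blast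

lemma nt_Act: "\<lbrakk>nat_trans P Q \<alpha>; \<sigma> \<in> Arr C; Cod C \<sigma> = \<Gamma>; x \<in> El P \<Gamma>\<rbrakk> \<Longrightarrow>
    \<alpha> (Dom C \<sigma>) (Act P \<sigma> x) = Act Q \<sigma> (\<alpha> \<Gamma> x)"
  unfolding nat_trans_def by blast

lemma nat_transI:
  assumes "\<And>\<Gamma> x. \<lbrakk>\<Gamma> \<in> Obj C; x \<in> El P \<Gamma>\<rbrakk> \<Longrightarrow> \<alpha> \<Gamma> x \<in> El Q \<Gamma>"
    and "\<And>\<sigma> x. \<lbrakk>\<sigma> \<in> Arr C; x \<in> El P (Cod C \<sigma>)\<rbrakk> \<Longrightarrow> \<alpha> (Dom C \<sigma>) (Act P \<sigma> x) = Act Q \<sigma> (\<alpha> (Cod C \<sigma>) x)"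
  shows "nat_trans P Q \<alpha>"
  using assms unfolding nat_trans_def by blast

lemma nat_trans_comp: "\<lbrakk>nat_trans P Q \<alpha>; nat_trans Q R \<beta>\<rbrakk> \<Longrightarrow> nat_trans P R (nt_comp \<beta> \<alpha>)"
  unfolding nat_trans_def nt_comp_def by (simp add: Cod_in)

lemma nat_trans_id: "nat_trans P P nt_id"
  unfolding nat_trans_def nt_id_def by simp

lemma morphismD:
  assumes "morphism f"
  shows "presheaf (mdom f)" "presheaf (mcod f)" "nat_trans (mdom f) (mcod f) (mmap f)"
  using assms unfolding morphism_def by auto

lemma presheafI:
  assumes "\<And>\<sigma> x. \<lbrakk>\<sigma> \<in> Arr C; x \<in> El P (Cod C \<sigma>)\<rbrakk> \<Longrightarrow> Act P \<sigma> x \<in> El P (Dom C \<sigma>)"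
    and "\<And>\<Gamma> x. \<lbrakk>\<Gamma> \<in> Obj C; x \<in> El P \<Gamma>\<rbrakk> \<Longrightarrow> Act P (Idn C \<Gamma>) x = x"
    and "\<And>\<sigma> \<tau> x. \<lbrakk>\<sigma> \<in> Arr C; \<tau> \<in> Arr C; Cod C \<tau> = Dom C \<sigma>; x \<in> El P (Cod C \<sigma>)\<rbrakk> \<Longrightarrow>
      Act P (Cmp C \<sigma> \<tau>) x = Act P \<tau> (Act P \<sigma> x)"
  shows "presheaf P"
  using assms unfolding presheaf_def by blast

section \<open>Extensions of polynomials\<close>

lemma fib_iff: "(\<sigma>, b) \<in> fib f \<Gamma> a \<longleftrightarrow> \<sigma> \<in> Arr C \<and> Cod C \<sigma> = \<Gamma> \<and> b \<in> El (mdom f) (Dom C \<sigma>) \<and>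
    mmap f (Dom C \<sigma>) b = Act (mcod f) \<sigma> a"
  unfolding fib_def by simp

lemma fibD:
  assumes "(\<sigma>, b) \<in> fib f \<Gamma> a"
  shows "\<sigma> \<in> Arr C" "Cod C \<sigma> = \<Gamma>" "Dom C \<sigma> \<in> Obj C" "\<Gamma> \<in> Obj C" "b \<in> El (mdom f) (Dom C \<sigma>)"
    "mmap f (Dom C \<sigma>) b = Act (mcod f) \<sigma> a"
  using assms unfolding fib_iff by (auto simp: Dom_in Cod_in)

text \<open>This is the restriction map of the presheaf \<open>y(\<Gamma>) \<times>_A B\<close>; it
  exists because \<open>mmap f\<close> is natural and restriction in the base is functorial.\<close>

lemma fib_Cmp:
  assumes f: "morphism f" and a: "a \<in> El (mcod f) \<Gamma>" and b: "(\<sigma>, b) \<in> fib f \<Gamma> a"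
    and \<tau>: "\<tau> \<in> Arr C" "Cod C \<tau> = Dom C \<sigma>"
  shows "(Cmp C \<sigma> \<tau>, Act (mdom f) \<tau> b) \<in> fib f \<Gamma> a"
  using fibD[OF b] \<tau> a morphismD[OF f] unfolding fib_iff
  by (auto simp: Cmp_in Dom_Cmp Cod_Cmp Act_El Act_Cmp nt_Act)

text \<open>Restricting \<open>a\<close> along \<sigma> and then along \<tau> is restricting it
  along \<open>Cmp C \<sigma> \<tau>\<close>. So passing to a restricted base leaves
  \<open>b\<close> alone and only composes its arrow with \<sigma>.\<close>

lemma fib_Act_iff:
  assumes f: "morphism f" and \<sigma>: "\<sigma> \<in> Arr C" "Cod C \<sigma> = \<Gamma>" and a: "a \<in> El (mcod f) \<Gamma>"
  shows "(\<tau>, b) \<in> fib f (Dom C \<sigma>) (Act (mcod f) \<sigma> a) \<longleftrightarrow>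
    \<tau> \<in> Arr C \<and> Cod C \<tau> = Dom C \<sigma> \<and> (Cmp C \<sigma> \<tau>, b) \<in> fib f \<Gamma> a"
  using \<sigma> a morphismD[OF f] unfolding fib_iff
  by (auto simp: Cmp_in Dom_Cmp Cod_Cmp Act_El Act_Cmp nt_Act)

text \<open>Turns ordinary elements over \<open>a\<close> into elements of the fibre at the identity
  stage, which is where \<open>comp_dom\<close> evaluates exponentials.\<close>

lemma fib_Idn:
  assumes f: "morphism f" and "\<Gamma> \<in> Obj C" "b \<in> El (mdom f) \<Gamma>" "mmap f \<Gamma> b = a"
  shows "(Idn C \<Gamma>, b) \<in> fib f \<Gamma> a"
  using assms(2-) morphismD[OF f] nt_El[OF morphismD(3)[OF f]] unfolding fib_iff
  by (auto simp: Idn_in Dom_Idn Cod_Idn Act_Idn)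

section \<open>Elements of P_f(X) and functoriality in X\<close>

lemma pext_iff: "w \<in> El (pext f X) \<Gamma> \<longleftrightarrow>
    fst w \<in> El (mcod f) \<Gamma> \<and> snd w \<in> extensional (fib f \<Gamma> (fst w)) \<and>
    (\<forall>\<sigma> b. (\<sigma>, b) \<in> fib f \<Gamma> (fst w) \<longrightarrow> snd w (\<sigma>, b) \<in> El X (Dom C \<sigma>)) \<and>
    (\<forall>\<sigma> b \<tau>. (\<sigma>, b) \<in> fib f \<Gamma> (fst w) \<longrightarrow> \<tau> \<in> Arr C \<longrightarrow> Cod C \<tau> = Dom C \<sigma> \<longrightarrow>
       snd w (Cmp C \<sigma> \<tau>, Act (mdom f) \<tau> b) = Act X \<tau> (snd w (\<sigma>, b)))"
  unfolding pext_def by (cases w) auto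

lemma pextD:
  assumes "w \<in> El (pext f X) \<Gamma>"
  shows "fst w \<in> El (mcod f) \<Gamma>" "snd w \<in> extensional (fib f \<Gamma> (fst w))"
    and "(\<sigma>, b) \<in> fib f \<Gamma> (fst w) \<Longrightarrow> snd w (\<sigma>, b) \<in> El X (Dom C \<sigma>)"
    and "\<lbrakk>(\<sigma>, b) \<in> fib f \<Gamma> (fst w); \<tau> \<in> Arr C; Cod C \<tau> = Dom C \<sigma>\<rbrakk> \<Longrightarrow>
       snd w (Cmp C \<sigma> \<tau>, Act (mdom f) \<tau> b) = Act X \<tau> (snd w (\<sigma>, b))"
  using assms unfolding pext_iff by blast+

text \<open>\<open>extensional\<close> pins the function to a default value outside the fibre, so
  agreement on the fibre is enough. Equalities between elements of extensions are mostly proved this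
  way below.\<close>

lemma pext_eqI:
  assumes "w \<in> El (pext f X) \<Gamma>" "w' \<in> El (pext f X) \<Gamma>" "fst w = fst w'"
    and "\<And>\<sigma> b. (\<sigma>, b) \<in> fib f \<Gamma> (fst w) \<Longrightarrow> snd w (\<sigma>, b) = snd w' (\<sigma>, b)"
  shows "w = w'"
proof (rule prod_eqI)
  show "snd w = snd w'"
    using pextD(2)[OF assms(1)] pextD(2)[OF assms(2)] assms(3,4)
    by (intro extensionalityI[of _ "fib f \<Gamma> (fst w)"]) auto
qed fact

lemma fst_pext_Act: "fst (Act (pext f X) \<sigma> w) = Act (mcod f) \<sigma> (fst w)"
  by (simp add: pext_def split: prod.split)

lemma snd_pext_Act: "snd (Act (pext f X) \<sigma> w) =
    restrict (\<lambda>(\<tau>, b). snd w (Cmp C \<sigma> \<tau>, b)) (fib f (Dom C \<sigma>) (Act (mcod f) \<sigma> (fst w)))"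
  by (simp add: pext_def split: prod.split)

lemma snd_pext_Act_app: "(\<tau>, b) \<in> fib f (Dom C \<sigma>) (Act (mcod f) \<sigma> (fst w)) \<Longrightarrow>
    snd (Act (pext f X) \<sigma> w) (\<tau>, b) = snd w (Cmp C \<sigma> \<tau>, b)"
  by (simp add: snd_pext_Act)

lemma fst_pext_map: "fst (pext_map f h \<Gamma> w) = fst w"
  by (simp add: pext_map_def split: prod.split)

lemma snd_pext_map: "snd (pext_map f h \<Gamma> w) =
    restrict (\<lambda>(\<sigma>, b). h (Dom C \<sigma>) (snd w (\<sigma>, b))) (fib f \<Gamma> (fst w))"
  by (simp add: pext_map_def split: prod.split)

lemma snd_pext_map_app: "(\<sigma>, b) \<in> fib f \<Gamma> (fst w) \<Longrightarrow>
    snd (pext_map f h \<Gamma> w) (\<sigma>, b) = h (Dom C \<sigma>) (snd w (\<sigma>, b))"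
  by (simp add: snd_pext_map)

text \<open>At \<tau> the restricted family has the value of the old one at
  \<open>Cmp C \<sigma> \<tau>\<close>, so its compatibility with a further arrow is that of the old
  family, by associativity.\<close>

lemma pext_Act_El:
  assumes f: "morphism f" and X: "presheaf X" and \<sigma>: "\<sigma> \<in> Arr C" and w: "w \<in> El (pext f X) (Cod C \<sigma>)"
  shows "Act (pext f X) \<sigma> w \<in> El (pext f X) (Dom C \<sigma>)"
proof -
  note w' = pextD[OF w]
  have fi: "(\<tau>, b) \<in> fib f (Dom C \<sigma>) (Act (mcod f) \<sigma> (fst w)) \<longleftrightarrow>
      \<tau> \<in> Arr C \<and> Cod C \<tau> = Dom C \<sigma> \<and> (Cmp C \<sigma> \<tau>, b) \<in> fib f (Cod C \<sigma>) (fst w)" for \<tau> b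
    by (rule fib_Act_iff[OF f \<sigma> refl w'(1)])
  have a: "Act (mcod f) \<sigma> (fst w) \<in> El (mcod f) (Dom C \<sigma>)"
    using Act_El[OF morphismD(2)[OF f] \<sigma> refl w'(1)] .
  show ?thesis
    unfolding pext_iff fst_pext_Act
  proof (intro conjI allI impI)
    show "snd (Act (pext f X) \<sigma> w) \<in> extensional (fib f (Dom C \<sigma>) (Act (mcod f) \<sigma> (fst w)))"
      by (simp add: snd_pext_Act)
  next
    fix \<tau> b assume b: "(\<tau>, b) \<in> fib f (Dom C \<sigma>) (Act (mcod f) \<sigma> (fst w))"
    then show "snd (Act (pext f X) \<sigma> w) (\<tau>, b) \<in> El X (Dom C \<tau>)"
      using w'(3)[of "Cmp C \<sigma> \<tau>" b] fi \<sigma> by (simp add: snd_pext_Act_app Dom_Cmp)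
  next
    fix \<tau> b \<rho> assume b: "(\<tau>, b) \<in> fib f (Dom C \<sigma>) (Act (mcod f) \<sigma> (fst w))"
      and \<rho>: "\<rho> \<in> Arr C" "Cod C \<rho> = Dom C \<tau>"
    have "(Cmp C \<tau> \<rho>, Act (mdom f) \<rho> b) \<in> fib f (Dom C \<sigma>) (Act (mcod f) \<sigma> (fst w))"
      by (rule fib_Cmp[OF f a b \<rho>])
    then show "snd (Act (pext f X) \<sigma> w) (Cmp C \<tau> \<rho>, Act (mdom f) \<rho> b) =
        Act X \<rho> (snd (Act (pext f X) \<sigma> w) (\<tau>, b))"
      using w'(4)[of "Cmp C \<sigma> \<tau>" b \<rho>] b \<rho> fi \<sigma> by (simp add: snd_pext_Act_app Dom_Cmp Cmp_assoc)
  qed fact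
qed

lemma presheaf_pext:
  assumes f: "morphism f" and X: "presheaf X"
  shows "presheaf (pext f X)"
proof (rule presheafI)
  fix \<sigma> w assume "\<sigma> \<in> Arr C" "w \<in> El (pext f X) (Cod C \<sigma>)"
  then show "Act (pext f X) \<sigma> w \<in> El (pext f X) (Dom C \<sigma>)" by (rule pext_Act_El[OF f X])
next
  fix \<Gamma> w assume \<Gamma>: "\<Gamma> \<in> Obj C" and w: "w \<in> El (pext f X) \<Gamma>"
  have a: "Act (mcod f) (Idn C \<Gamma>) (fst w) = fst w"
    using Act_Idn[OF morphismD(2)[OF f] \<Gamma>] pextD(1)[OF w] .
  have I: "Idn C \<Gamma> \<in> Arr C" "Dom C (Idn C \<Gamma>) = \<Gamma>" "Cod C (Idn C \<Gamma>) = \<Gamma>"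
    using \<Gamma> by (auto simp: Idn_in Dom_Idn Cod_Idn)
  show "Act (pext f X) (Idn C \<Gamma>) w = w"
  proof (rule pext_eqI[OF _ w])
    show "Act (pext f X) (Idn C \<Gamma>) w \<in> El (pext f X) \<Gamma>"
      using pext_Act_El[OF f X I(1)] w I by simp
    fix \<tau> b assume "(\<tau>, b) \<in> fib f \<Gamma> (fst (Act (pext f X) (Idn C \<Gamma>) w))"
    then have b: "(\<tau>, b) \<in> fib f \<Gamma> (fst w)" by (simp add: fst_pext_Act a)
    then have "Cmp C (Idn C \<Gamma>) \<tau> = \<tau>" using Cmp_Idn_left[of \<tau>] fibD[OF b] by simp
    then show "snd (Act (pext f X) (Idn C \<Gamma>) w) (\<tau>, b) = snd w (\<tau>, b)"
      using b by (simp add: snd_pext_Act I a)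
  qed (simp add: fst_pext_Act a)
next
  fix \<sigma> \<tau> w assume \<sigma>: "\<sigma> \<in> Arr C" and \<tau>: "\<tau> \<in> Arr C" "Cod C \<tau> = Dom C \<sigma>"
    and w: "w \<in> El (pext f X) (Cod C \<sigma>)"
  note st = Cmp_in[OF \<sigma> \<tau>] Dom_Cmp[OF \<sigma> \<tau>] Cod_Cmp[OF \<sigma> \<tau>]
  have w\<sigma>: "Act (pext f X) \<sigma> w \<in> El (pext f X) (Cod C \<tau>)" using pext_Act_El[OF f X \<sigma> w] \<tau> by simp
  have a: "Act (mcod f) (Cmp C \<sigma> \<tau>) (fst w) = Act (mcod f) \<tau> (Act (mcod f) \<sigma> (fst w))"
    using Act_Cmp[OF morphismD(2)[OF f] \<sigma> \<tau>] pextD(1)[OF w] .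
  show "Act (pext f X) (Cmp C \<sigma> \<tau>) w = Act (pext f X) \<tau> (Act (pext f X) \<sigma> w)"
  proof (rule pext_eqI)
    show "Act (pext f X) (Cmp C \<sigma> \<tau>) w \<in> El (pext f X) (Dom C \<tau>)"
      using pext_Act_El[OF f X st(1)] w st by simp
    show "Act (pext f X) \<tau> (Act (pext f X) \<sigma> w) \<in> El (pext f X) (Dom C \<tau>)"
      by (rule pext_Act_El[OF f X \<tau>(1) w\<sigma>])
    fix \<rho> b assume "(\<rho>, b) \<in> fib f (Dom C \<tau>) (fst (Act (pext f X) (Cmp C \<sigma> \<tau>) w))"
    then have b: "(\<rho>, b) \<in> fib f (Dom C \<tau>) (Act (mcod f) \<tau> (Act (mcod f) \<sigma> (fst w)))"
      by (simp add: fst_pext_Act a)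
    then have b': "(Cmp C \<tau> \<rho>, b) \<in> fib f (Dom C \<sigma>) (Act (mcod f) \<sigma> (fst w))"
      using fib_Act_iff[OF f \<tau>(1) refl] Act_El[OF morphismD(2)[OF f] \<sigma> refl pextD(1)[OF w]] \<tau> by auto
    show "snd (Act (pext f X) (Cmp C \<sigma> \<tau>) w) (\<rho>, b) =
        snd (Act (pext f X) \<tau> (Act (pext f X) \<sigma> w)) (\<rho>, b)"
      using b b' fibD[OF b] \<sigma> \<tau> by (simp add: snd_pext_Act fst_pext_Act a st Cmp_assoc)
  qed (simp add: fst_pext_Act a)
qed

text \<open>Postcomposition with \<open>h\<close> changes values and not stages, so it commutes with
  restriction; naturality of \<open>h\<close> enters in keeping the new family natural.\<close>

lemma nat_trans_pext_map:
  assumes f: "morphism f" and X: "presheaf X" and Y: "presheaf Y" and h: "nat_trans X Y h"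
  shows "nat_trans (pext f X) (pext f Y) (pext_map f h)"
proof -
  have in_El: "pext_map f h \<Gamma> w \<in> El (pext f Y) \<Gamma>" if w: "w \<in> El (pext f X) \<Gamma>" for \<Gamma> w
    unfolding pext_iff fst_pext_map
  proof (intro conjI allI impI)
    show "fst w \<in> El (mcod f) \<Gamma>" by (rule pextD(1)[OF w])
    show "snd (pext_map f h \<Gamma> w) \<in> extensional (fib f \<Gamma> (fst w))" by (simp add: snd_pext_map)
  next
    fix \<sigma> b assume b: "(\<sigma>, b) \<in> fib f \<Gamma> (fst w)"
    then show "snd (pext_map f h \<Gamma> w) (\<sigma>, b) \<in> El Y (Dom C \<sigma>)"
      using pextD(3)[OF w b] nt_El[OF h] fibD[OF b] by (simp add: snd_pext_map_app)
  next
    fix \<sigma> b \<tau> assume b: "(\<sigma>, b) \<in> fib f \<Gamma> (fst w)" and \<tau>: "\<tau> \<in> Arr C" "Cod C \<tau> = Dom C \<sigma>"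
    show "snd (pext_map f h \<Gamma> w) (Cmp C \<sigma> \<tau>, Act (mdom f) \<tau> b) = Act Y \<tau> (snd (pext_map f h \<Gamma> w) (\<sigma>, b))"
      using b fib_Cmp[OF f pextD(1)[OF w] b \<tau>] pextD(3,4)[OF w b] fibD[OF b] \<tau>
      by (simp add: snd_pext_map_app Dom_Cmp nt_Act[OF h])
  qed
  show ?thesis
  proof (rule nat_transI)
    fix \<sigma> w assume \<sigma>: "\<sigma> \<in> Arr C" and w: "w \<in> El (pext f X) (Cod C \<sigma>)"
    note w\<sigma> = pext_Act_El[OF f X \<sigma> w]
    show "pext_map f h (Dom C \<sigma>) (Act (pext f X) \<sigma> w) = Act (pext f Y) \<sigma> (pext_map f h (Cod C \<sigma>) w)"
    proof (rule pext_eqI[OF in_El[OF w\<sigma>] pext_Act_El[OF f Y \<sigma> in_El[OF w]]])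
      fix \<tau> b
      assume "(\<tau>, b) \<in> fib f (Dom C \<sigma>) (fst (pext_map f h (Dom C \<sigma>) (Act (pext f X) \<sigma> w)))"
      then have b: "(\<tau>, b) \<in> fib f (Dom C \<sigma>) (Act (mcod f) \<sigma> (fst w))"
        by (simp add: fst_pext_map fst_pext_Act)
      then have "(Cmp C \<sigma> \<tau>, b) \<in> fib f (Cod C \<sigma>) (fst w)"
        using fib_Act_iff[OF f \<sigma> refl pextD(1)[OF w]] by simp
      then show "snd (pext_map f h (Dom C \<sigma>) (Act (pext f X) \<sigma> w)) (\<tau>, b) =
          snd (Act (pext f Y) \<sigma> (pext_map f h (Cod C \<sigma>) w)) (\<tau>, b)"
        using b fibD[OF b] \<sigma>
        by (simp add: snd_pext_map_app snd_pext_Act_app fst_pext_map fst_pext_Act Dom_Cmp)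
    qed (simp add: fst_pext_map fst_pext_Act)
  qed (rule in_El)
qed

text \<open>Both sides cut their functions off at the same fibre, so this is an equality for
  arbitrary \<open>w\<close>. The identity law below, by contrast, rests on \<open>w\<close> being
  extensional.\<close>

lemma pext_map_comp:
  "pext_map f k \<Gamma> (pext_map f h \<Gamma> w) = pext_map f (nt_comp k h) \<Gamma> w"
  by (rule prod_eqI) (auto simp: fst_pext_map snd_pext_map nt_comp_def)

lemma pext_map_cong:
  assumes "w \<in> El (pext f X) \<Gamma>" "nt_eq X h k"
  shows "pext_map f h \<Gamma> w = pext_map f k \<Gamma> w"
  using pextD(3)[OF assms(1)] assms(2)
  by (intro prod_eqI) (auto simp: fst_pext_map snd_pext_map nt_eq_def fun_eq_iff restrict_def dest: fibD(3))

lemma pext_map_id: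
  assumes "w \<in> El (pext f X) \<Gamma>"
  shows "pext_map f nt_id \<Gamma> w = w"
  using pextD(2)[OF assms]
  by (intro prod_eqI) (auto simp: fst_pext_map snd_pext_map nt_id_def fun_eq_iff restrict_def extensional_def)

lemma morphism_pcomp:
  assumes g: "morphism g" and f: "morphism f"
  shows "morphism (g \<odot> f)"
proof -
  have P: "presheaf (pext g (mcod f))" by (rule presheaf_pext[OF g morphismD(2)[OF f]])
  have "presheaf (comp_dom g f)"
  proof (rule presheafI)
    fix \<sigma> z assume \<sigma>: "\<sigma> \<in> Arr C" and "z \<in> El (comp_dom g f) (Cod C \<sigma>)"
    then obtain w d b where z: "z = (w, d, b)" and w: "w \<in> El (pext g (mcod f)) (Cod C \<sigma>)"
      and d: "d \<in> El (mdom g) (Cod C \<sigma>)" "mmap g (Cod C \<sigma>) d = fst w"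
      and b: "b \<in> El (mdom f) (Cod C \<sigma>)" "mmap f (Cod C \<sigma>) b = snd w (Idn C (Cod C \<sigma>), d)"
      unfolding comp_dom_def by auto
    let ?d = "Act (mdom g) \<sigma> d"
    have d': "?d \<in> El (mdom g) (Dom C \<sigma>)" "mmap g (Dom C \<sigma>) ?d = Act (mcod g) \<sigma> (fst w)"
      using Act_El[OF morphismD(1)[OF g] \<sigma> refl d(1)] nt_Act[OF morphismD(3)[OF g] \<sigma> refl d(1)] d(2) by auto
    have i: "(Idn C (Dom C \<sigma>), ?d) \<in> fib g (Dom C \<sigma>) (Act (mcod g) \<sigma> (fst w))"
      using fib_Idn[OF g Dom_in[OF \<sigma>] d'] .
    have i': "(Idn C (Cod C \<sigma>), d) \<in> fib g (Cod C \<sigma>) (fst w)"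
      using fib_Idn[OF g Cod_in[OF \<sigma>] d] .
    \<comment> \<open>Naturality of the family \<open>w\<close> at the identity stage, along
      \<sigma>: evaluation at \<open>d\<close> commutes with restriction, which keeps
      \<open>b\<close> over the right value.\<close>
    have "snd w (\<sigma>, ?d) = Act (mcod f) \<sigma> (snd w (Idn C (Cod C \<sigma>), d))"
      using pextD(4)[OF w i' \<sigma>] Cmp_Idn_left[OF \<sigma>] by (simp add: Dom_Idn Cod_in[OF \<sigma>])
    then have "mmap f (Dom C \<sigma>) (Act (mdom f) \<sigma> b) = snd (Act (pext g (mcod f)) \<sigma> w) (Idn C (Dom C \<sigma>), ?d)"
      using i nt_Act[OF morphismD(3)[OF f] \<sigma> refl b(1)] b(2) Cmp_Idn_right[OF \<sigma>]
      by (simp add: snd_pext_Act_app)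
    then show "Act (comp_dom g f) \<sigma> z \<in> El (comp_dom g f) (Dom C \<sigma>)"
      using d' Act_El[OF P \<sigma> refl w] Act_El[OF morphismD(1)[OF f] \<sigma> refl b(1)]
      unfolding z comp_dom_def by (simp add: fst_pext_Act)
  next
    fix \<Gamma> z assume "\<Gamma> \<in> Obj C" "z \<in> El (comp_dom g f) \<Gamma>"
    then show "Act (comp_dom g f) (Idn C \<Gamma>) z = z"
      using Act_Idn[OF P] Act_Idn[OF morphismD(1)[OF f]] Act_Idn[OF morphismD(1)[OF g]]
      unfolding comp_dom_def by auto
  next
    fix \<sigma> \<tau> z assume "\<sigma> \<in> Arr C" "\<tau> \<in> Arr C" "Cod C \<tau> = Dom C \<sigma>" "z \<in> El (comp_dom g f) (Cod C \<sigma>)"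
    then show "Act (comp_dom g f) (Cmp C \<sigma> \<tau>) z = Act (comp_dom g f) \<tau> (Act (comp_dom g f) \<sigma> z)"
      using Act_Cmp[OF P] Act_Cmp[OF morphismD(1)[OF f]] Act_Cmp[OF morphismD(1)[OF g]]
      unfolding comp_dom_def by auto
  qed
  moreover have "nat_trans (comp_dom g f) (pext g (mcod f)) (\<lambda>\<Gamma>. fst)"
    unfolding nat_trans_def comp_dom_def by auto
  ultimately show ?thesis using P unfolding morphism_def pcomp_def by simp
qed

section \<open>Cartesian squares\<close>

text \<open>A pullback square read as an arrow from \<open>f\<close> to \<open>g\<close>, with the
  bottom side before the top side as in \<open>of_square\<close>. Horizontal pasting then becomes
  composition of such arrows.\<close>

definition csq ::
  "('o, 'm, 'b, 'a) mor \<Rightarrow> ('o, 'm, 'd, 'c) mor \<Rightarrow> ('o \<Rightarrow> 'a \<Rightarrow> 'c) \<Rightarrow> ('o \<Rightarrow> 'b \<Rightarrow> 'd) \<Rightarrow> bool" where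
  "csq f g h k \<longleftrightarrow> pullback_square (mdom f) (mdom g) (mcod f) (mcod g) k (mmap f) (mmap g) h"

lemma csqI:
  assumes "morphism f" "morphism g" "nat_trans (mcod f) (mcod g) h" "nat_trans (mdom f) (mdom g) k"
    and "\<And>\<Gamma> b. \<lbrakk>\<Gamma> \<in> Obj C; b \<in> El (mdom f) \<Gamma>\<rbrakk> \<Longrightarrow> mmap g \<Gamma> (k \<Gamma> b) = h \<Gamma> (mmap f \<Gamma> b)"
    and "\<And>\<Gamma> a d. \<lbrakk>\<Gamma> \<in> Obj C; a \<in> El (mcod f) \<Gamma>; d \<in> El (mdom g) \<Gamma>; mmap g \<Gamma> d = h \<Gamma> a\<rbrakk> \<Longrightarrow>
      \<exists>!b. b \<in> El (mdom f) \<Gamma> \<and> k \<Gamma> b = d \<and> mmap f \<Gamma> b = a"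
  shows "csq f g h k"
  using assms unfolding csq_def pullback_square_iff morphism_def nt_eq_def nt_comp_def by auto

lemma csqD:
  assumes "csq f g h k"
  shows "morphism f" "morphism g" "nat_trans (mcod f) (mcod g) h" "nat_trans (mdom f) (mdom g) k"
    and "\<lbrakk>\<Gamma> \<in> Obj C; b \<in> El (mdom f) \<Gamma>\<rbrakk> \<Longrightarrow> mmap g \<Gamma> (k \<Gamma> b) = h \<Gamma> (mmap f \<Gamma> b)"
    and "\<lbrakk>\<Gamma> \<in> Obj C; a \<in> El (mcod f) \<Gamma>; d \<in> El (mdom g) \<Gamma>; mmap g \<Gamma> d = h \<Gamma> a\<rbrakk> \<Longrightarrow>
      \<exists>!b. b \<in> El (mdom f) \<Gamma> \<and> k \<Gamma> b = d \<and> mmap f \<Gamma> b = a"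
  using assms unfolding csq_def pullback_square_iff morphism_def nt_eq_def nt_comp_def by auto

text \<open>Pasting of pullbacks: an element is lifted through the right square to one over
  \<open>h \<Gamma> a\<close>, and this one is lifted through the left square.\<close>

lemma csq_comp:
  assumes l: "csq f g h k" and r: "csq g j h' k'"
  shows "csq f j (nt_comp h' h) (nt_comp k' k)"
proof (rule csqI)
  note L = csqD[OF l] and R = csqD[OF r]
  show "morphism f" "morphism j" by fact+
  show "nat_trans (mcod f) (mcod j) (nt_comp h' h)" "nat_trans (mdom f) (mdom j) (nt_comp k' k)"
    using nat_trans_comp[OF L(3) R(3)] nat_trans_comp[OF L(4) R(4)] .
  fix \<Gamma> assume \<Gamma>: "\<Gamma> \<in> Obj C"
  show "mmap j \<Gamma> (nt_comp k' k \<Gamma> b) = nt_comp h' h \<Gamma> (mmap f \<Gamma> b)" if "b \<in> El (mdom f) \<Gamma>" for b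
    using L(5)[OF \<Gamma> that] R(5)[OF \<Gamma> nt_El[OF L(4) \<Gamma> that]] by (simp add: nt_comp_def)
  fix a e assume a: "a \<in> El (mcod f) \<Gamma>" and e: "e \<in> El (mdom j) \<Gamma>" "mmap j \<Gamma> e = nt_comp h' h \<Gamma> a"
  have "\<exists>!d. d \<in> El (mdom g) \<Gamma> \<and> k' \<Gamma> d = e \<and> mmap g \<Gamma> d = h \<Gamma> a"
    using R(6)[OF \<Gamma> nt_El[OF L(3) \<Gamma> a] e(1)] e(2) by (simp add: nt_comp_def)
  then obtain d where d: "d \<in> El (mdom g) \<Gamma>" "k' \<Gamma> d = e" "mmap g \<Gamma> d = h \<Gamma> a"
    and du: "\<And>d'. \<lbrakk>d' \<in> El (mdom g) \<Gamma>; k' \<Gamma> d' = e; mmap g \<Gamma> d' = h \<Gamma> a\<rbrakk> \<Longrightarrow> d' = d" by metis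
  from L(6)[OF \<Gamma> a d(1,3)] obtain b where b: "b \<in> El (mdom f) \<Gamma>" "k \<Gamma> b = d" "mmap f \<Gamma> b = a"
    and bu: "\<And>b'. \<lbrakk>b' \<in> El (mdom f) \<Gamma>; k \<Gamma> b' = d; mmap f \<Gamma> b' = a\<rbrakk> \<Longrightarrow> b' = b" by metis
  show "\<exists>!b. b \<in> El (mdom f) \<Gamma> \<and> nt_comp k' k \<Gamma> b = e \<and> mmap f \<Gamma> b = a"
  proof (rule ex1I)
    show "b \<in> El (mdom f) \<Gamma> \<and> nt_comp k' k \<Gamma> b = e \<and> mmap f \<Gamma> b = a" using b d by (simp add: nt_comp_def)
    fix b' assume b': "b' \<in> El (mdom f) \<Gamma> \<and> nt_comp k' k \<Gamma> b' = e \<and> mmap f \<Gamma> b' = a"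
    \<comment> \<open>Commutativity of the left square puts \<open>k \<Gamma> b'\<close> over
      \<open>h \<Gamma> a\<close>, so uniqueness in the right square applies.\<close>
    then have "k \<Gamma> b' = d" using du[OF nt_El[OF L(4) \<Gamma>]] L(5)[OF \<Gamma>] by (auto simp: nt_comp_def)
    then show "b' = b" using bu b' by blast
  qed
qed

text \<open>Serves for squares whose horizontal sides are isomorphisms. Injectivity at the bottom
  suffices because lifting concerns a base \<open>h \<Gamma> a\<close> with \<open>a\<close> already
  given.\<close>

lemma csq_bij:
  assumes f: "morphism f" "morphism g" "nat_trans (mcod f) (mcod g) h" "nat_trans (mdom f) (mdom g) k"
    and comm: "\<And>\<Gamma> b. \<lbrakk>\<Gamma> \<in> Obj C; b \<in> El (mdom f) \<Gamma>\<rbrakk> \<Longrightarrow> mmap g \<Gamma> (k \<Gamma> b) = h \<Gamma> (mmap f \<Gamma> b)"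
    and h: "\<And>\<Gamma>. \<Gamma> \<in> Obj C \<Longrightarrow> inj_on (h \<Gamma>) (El (mcod f) \<Gamma>)"
    and k: "\<And>\<Gamma>. \<Gamma> \<in> Obj C \<Longrightarrow> bij_betw (k \<Gamma>) (El (mdom f) \<Gamma>) (El (mdom g) \<Gamma>)"
  shows "csq f g h k"
proof (rule csqI[OF f comm])
  fix \<Gamma> a d assume \<Gamma>: "\<Gamma> \<in> Obj C" and a: "a \<in> El (mcod f) \<Gamma>" and d: "d \<in> El (mdom g) \<Gamma>" "mmap g \<Gamma> d = h \<Gamma> a"
  obtain b where b: "b \<in> El (mdom f) \<Gamma>" "k \<Gamma> b = d"
    using k[OF \<Gamma>] d(1) unfolding bij_betw_def by (metis imageE)
  have "mmap f \<Gamma> b = a"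
    using comm[OF \<Gamma> b(1)] b(2) d(2) inj_onD[OF h[OF \<Gamma>] _ nt_El[OF morphismD(3)[OF f(1)] \<Gamma> b(1)] a] by simp
  then show "\<exists>!b. b \<in> El (mdom f) \<Gamma> \<and> k \<Gamma> b = d \<and> mmap f \<Gamma> b = a"
    using b inj_onD[OF bij_betw_imp_inj_on[OF k[OF \<Gamma>]]] by blast
qed

text \<open>The restriction of a preimage is a preimage of the restriction, so the pointwise inverse
  is natural; invertibility can then be checked object by object.\<close>

lemma invertible_iff:
  assumes P: "presheaf P" and \<alpha>: "nat_trans P Q \<alpha>"
  shows "invertible P Q \<alpha> \<longleftrightarrow> (\<forall>\<Gamma>\<in>Obj C. \<forall>y\<in>El Q \<Gamma>. \<exists>!x. x \<in> El P \<Gamma> \<and> \<alpha> \<Gamma> x = y)"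
proof
  assume "invertible P Q \<alpha>"
  then obtain \<beta> where "nat_trans Q P \<beta>" "nt_eq P (nt_comp \<beta> \<alpha>) nt_id" "nt_eq Q (nt_comp \<alpha> \<beta>) nt_id"
    unfolding invertible_def by blast
  then show "\<forall>\<Gamma>\<in>Obj C. \<forall>y\<in>El Q \<Gamma>. \<exists>!x. x \<in> El P \<Gamma> \<and> \<alpha> \<Gamma> x = y"
    unfolding nt_eq_def nt_comp_def nt_id_def nat_trans_def by metis
next
  assume ex1: "\<forall>\<Gamma>\<in>Obj C. \<forall>y\<in>El Q \<Gamma>. \<exists>!x. x \<in> El P \<Gamma> \<and> \<alpha> \<Gamma> x = y"
  define \<beta> where "\<beta> = (\<lambda>\<Gamma> y. THE x. x \<in> El P \<Gamma> \<and> \<alpha> \<Gamma> x = y)"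
  have \<beta>: "\<beta> \<Gamma> y \<in> El P \<Gamma> \<and> \<alpha> \<Gamma> (\<beta> \<Gamma> y) = y" if "\<Gamma> \<in> Obj C" "y \<in> El Q \<Gamma>" for \<Gamma> y
    unfolding \<beta>_def by (rule theI') (use ex1 that in blast)
  have \<beta>u: "\<beta> \<Gamma> (\<alpha> \<Gamma> x) = x" if "\<Gamma> \<in> Obj C" "x \<in> El P \<Gamma>" for \<Gamma> x
    using ex1 \<beta> nt_El[OF \<alpha>] that by metis
  have "nat_trans Q P \<beta>"
  proof (rule nat_transI)
    fix \<sigma> y assume \<sigma>: "\<sigma> \<in> Arr C" and y: "y \<in> El Q (Cod C \<sigma>)"
    note b = \<beta>[OF Cod_in[OF \<sigma>] y]
    then show "\<beta> (Dom C \<sigma>) (Act Q \<sigma> y) = Act P \<sigma> (\<beta> (Cod C \<sigma>) y)"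
      using \<beta>u[OF Dom_in[OF \<sigma>] Act_El[OF P \<sigma> refl]] nt_Act[OF \<alpha> \<sigma> refl] by metis
  qed (use \<beta> in blast)
  then show "invertible P Q \<alpha>"
    using \<beta> \<beta>u unfolding invertible_def nt_eq_def nt_comp_def nt_id_def by blast
qed

section \<open>Cartesian morphisms\<close>

text \<open>The composite of \<open>proj \<phi>\<close> with the inverse of
  \<open>bwd \<phi>\<close>: the top side of the pullback square that a cartesian morphism amounts
  to. It is meaningful where \<open>bwd \<phi>\<close> is bijective.\<close>

definition top_map :: "('o, 'm, 'b, 'a, 'd, 'c, 'e) pmor \<Rightarrow> 'o \<Rightarrow> 'b \<Rightarrow> 'd" where
  "top_map \<phi> = (\<lambda>\<Gamma> b. proj \<phi> \<Gamma> (THE e. e \<in> El (apex \<phi>) \<Gamma> \<and> bwd \<phi> \<Gamma> e = b))"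

text \<open>A pullback square stays one when its corner is replaced along a bijection, here by the
  apex. Composites are shown to be cartesian by exhibiting a square and a bijective
  \<open>bwd\<close>, without touching the universal property of the apex.\<close>

lemma cartesianI:
  assumes st: "src \<phi> = f" "tgt \<phi> = g" and P: "presheaf (apex \<phi>)"
    and b: "nat_trans (apex \<phi>) (mdom f) (bwd \<phi>)"
    and ex1: "\<And>\<Gamma> b. \<lbrakk>\<Gamma> \<in> Obj C; b \<in> El (mdom f) \<Gamma>\<rbrakk> \<Longrightarrow> \<exists>!e. e \<in> El (apex \<phi>) \<Gamma> \<and> bwd \<phi> \<Gamma> e = b"
    and sq: "csq f g (base \<phi>) k"
    and k: "\<And>\<Gamma> e. \<lbrakk>\<Gamma> \<in> Obj C; e \<in> El (apex \<phi>) \<Gamma>\<rbrakk> \<Longrightarrow> proj \<phi> \<Gamma> e = k \<Gamma> (bwd \<phi> \<Gamma> e)"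
  shows "cartesian f g \<phi>"
proof -
  note S = csqD[OF sq]
  have pr: "nat_trans (apex \<phi>) (mdom g) (proj \<phi>)"
    using nat_trans_comp[OF b S(4)] k P unfolding nat_trans_def nt_comp_def presheaf_def
    by (simp add: Dom_in Cod_in)
  have "pullback_square (apex \<phi>) (mdom g) (mcod f) (mcod g)
      (proj \<phi>) (nt_comp (mmap f) (bwd \<phi>)) (mmap g) (base \<phi>)"
    unfolding pullback_square_iff
  proof (intro conjI ballI impI)
    show "nt_eq (apex \<phi>) (nt_comp (mmap g) (proj \<phi>)) (nt_comp (base \<phi>) (nt_comp (mmap f) (bwd \<phi>)))"
      using S(5) k nt_El[OF b] unfolding nt_eq_def nt_comp_def by simp
    fix \<Gamma> d a assume \<Gamma>: "\<Gamma> \<in> Obj C" and d: "d \<in> El (mdom g) \<Gamma>" and a: "a \<in> El (mcod f) \<Gamma>"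
      and eq: "mmap g \<Gamma> d = base \<phi> \<Gamma> a"
    from S(6)[OF \<Gamma> a d eq] obtain b' where b': "b' \<in> El (mdom f) \<Gamma>" "k \<Gamma> b' = d" "mmap f \<Gamma> b' = a"
      and b'u: "\<And>b. \<lbrakk>b \<in> El (mdom f) \<Gamma>; k \<Gamma> b = d; mmap f \<Gamma> b = a\<rbrakk> \<Longrightarrow> b = b'" by metis
    from ex1[OF \<Gamma> b'(1)] obtain e where e: "e \<in> El (apex \<phi>) \<Gamma>" "bwd \<phi> \<Gamma> e = b'"
      and eu: "\<And>x. \<lbrakk>x \<in> El (apex \<phi>) \<Gamma>; bwd \<phi> \<Gamma> x = b'\<rbrakk> \<Longrightarrow> x = e" by metis
    show "\<exists>!e. e \<in> El (apex \<phi>) \<Gamma> \<and> proj \<phi> \<Gamma> e = d \<and> nt_comp (mmap f) (bwd \<phi>) \<Gamma> e = a"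
      using e eu b' b'u k[OF \<Gamma>] nt_El[OF b \<Gamma>] unfolding nt_comp_def by metis
  qed (use S P pr nat_trans_comp[OF b] morphismD in blast)+
  then show ?thesis
    using st b S invertible_iff[OF P b] ex1 unfolding cartesian_def poly_mor_def by blast
qed

lemma cartesianD:
  assumes "cartesian f g \<phi>"
  shows "src \<phi> = f" "tgt \<phi> = g" "morphism f" "morphism g" "presheaf (apex \<phi>)"
    and "nat_trans (mcod f) (mcod g) (base \<phi>)" "nat_trans (apex \<phi>) (mdom g) (proj \<phi>)"
    and "nat_trans (apex \<phi>) (mdom f) (bwd \<phi>)" "invertible (apex \<phi>) (mdom f) (bwd \<phi>)"
    and "poly_mor f g \<phi>"
  using assms unfolding cartesian_def poly_mor_def pullback_square_iff by auto

lemma cartesian_bij: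
  assumes "cartesian f g \<phi>" "\<Gamma> \<in> Obj C" "b \<in> El (mdom f) \<Gamma>"
  shows "\<exists>!e. e \<in> El (apex \<phi>) \<Gamma> \<and> bwd \<phi> \<Gamma> e = b"
  using cartesianD(9)[OF assms(1)] invertible_iff[OF cartesianD(5,8)[OF assms(1)]] assms(2,3) by blast

text \<open>The source of every uniqueness statement about adjustments below.\<close>

lemma cartesian_inj:
  assumes "cartesian f g \<phi>" "\<Gamma> \<in> Obj C" "e \<in> El (apex \<phi>) \<Gamma>" "e' \<in> El (apex \<phi>) \<Gamma>" "bwd \<phi> \<Gamma> e = bwd \<phi> \<Gamma> e'"
  shows "e = e'"
  using cartesian_bij[OF assms(1,2) nt_El[OF cartesianD(8)[OF assms(1)] assms(2,3)]] assms(3-) by metis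

lemma top_map_bwd:
  assumes "cartesian f g \<phi>" "\<Gamma> \<in> Obj C" "e \<in> El (apex \<phi>) \<Gamma>"
  shows "top_map \<phi> \<Gamma> (bwd \<phi> \<Gamma> e) = proj \<phi> \<Gamma> e"
  unfolding top_map_def using cartesian_inj[OF assms(1,2)] assms(3)
  by (intro arg_cong[where f = "proj \<phi> \<Gamma>"] the_equality) auto

text \<open>The universal property is carried from the apex to the domain of \<open>f\<close> along
  the inverse of \<open>bwd \<phi>\<close>. In this way type formers are read off from pseudomonad
  and pseudoalgebra data.\<close>

lemma cartesian_csq:
  assumes c: "cartesian f g \<phi>"
  shows "csq f g (base \<phi>) (top_map \<phi>)"
proof (rule csqI)
  note D = cartesianD[OF c]
  have pb: "pullback_square (apex \<phi>) (mdom g) (mcod f) (mcod g)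
       (proj \<phi>) (nt_comp (mmap f) (bwd \<phi>)) (mmap g) (base \<phi>)"
    using D(10) unfolding poly_mor_def by blast
  obtain \<beta> where \<beta>: "nat_trans (mdom f) (apex \<phi>) \<beta>" and \<beta>b: "nt_eq (mdom f) (nt_comp (bwd \<phi>) \<beta>) nt_id"
    using D(9) unfolding invertible_def by blast
  have \<beta>b: "bwd \<phi> \<Gamma> (\<beta> \<Gamma> b) = b" if "\<Gamma> \<in> Obj C" "b \<in> El (mdom f) \<Gamma>" for \<Gamma> b
    using \<beta>b that unfolding nt_eq_def nt_comp_def nt_id_def by blast
  have top: "top_map \<phi> \<Gamma> b = proj \<phi> \<Gamma> (\<beta> \<Gamma> b)" if "\<Gamma> \<in> Obj C" "b \<in> El (mdom f) \<Gamma>" for \<Gamma> b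
    using top_map_bwd[OF c that(1) nt_El[OF \<beta> that]] \<beta>b[OF that] by simp
  show "morphism f" "morphism g" "nat_trans (mcod f) (mcod g) (base \<phi>)" by fact+
  show "nat_trans (mdom f) (mdom g) (top_map \<phi>)"
    using nat_trans_comp[OF \<beta> D(7)] top Act_El[OF morphismD(1)[OF D(3)]] unfolding nat_trans_def nt_comp_def
    by (simp add: Dom_in Cod_in)
  fix \<Gamma> assume \<Gamma>: "\<Gamma> \<in> Obj C"
  show "mmap g \<Gamma> (top_map \<phi> \<Gamma> b) = base \<phi> \<Gamma> (mmap f \<Gamma> b)" if b: "b \<in> El (mdom f) \<Gamma>" for b
  proof -
    have "nt_eq (apex \<phi>) (nt_comp (mmap g) (proj \<phi>)) (nt_comp (base \<phi>) (nt_comp (mmap f) (bwd \<phi>)))"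
      using pb unfolding pullback_square_def by blast
    then have "mmap g \<Gamma> (proj \<phi> \<Gamma> (\<beta> \<Gamma> b)) = base \<phi> \<Gamma> (mmap f \<Gamma> (bwd \<phi> \<Gamma> (\<beta> \<Gamma> b)))"
      using \<Gamma> nt_El[OF \<beta> \<Gamma> b] unfolding nt_eq_def nt_comp_def by blast
    then show ?thesis using top[OF \<Gamma> b] \<beta>b[OF \<Gamma> b] by simp
  qed
  fix a d assume a: "a \<in> El (mcod f) \<Gamma>" and d: "d \<in> El (mdom g) \<Gamma>" and eq: "mmap g \<Gamma> d = base \<phi> \<Gamma> a"
  have "\<exists>!e. e \<in> El (apex \<phi>) \<Gamma> \<and> proj \<phi> \<Gamma> e = d \<and> nt_comp (mmap f) (bwd \<phi>) \<Gamma> e = a"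
    using pb \<Gamma> a d eq unfolding pullback_square_iff by blast
  then obtain e where e: "e \<in> El (apex \<phi>) \<Gamma>" "proj \<phi> \<Gamma> e = d" "mmap f \<Gamma> (bwd \<phi> \<Gamma> e) = a"
    and eu: "\<And>e'. \<lbrakk>e' \<in> El (apex \<phi>) \<Gamma>; proj \<phi> \<Gamma> e' = d; mmap f \<Gamma> (bwd \<phi> \<Gamma> e') = a\<rbrakk> \<Longrightarrow> e' = e"
    unfolding nt_comp_def by metis
  show "\<exists>!b. b \<in> El (mdom f) \<Gamma> \<and> top_map \<phi> \<Gamma> b = d \<and> mmap f \<Gamma> b = a"
  proof (rule ex1I)
    show "bwd \<phi> \<Gamma> e \<in> El (mdom f) \<Gamma> \<and> top_map \<phi> \<Gamma> (bwd \<phi> \<Gamma> e) = d \<and> mmap f \<Gamma> (bwd \<phi> \<Gamma> e) = a"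
      using e top_map_bwd[OF c \<Gamma> e(1)] nt_El[OF D(8) \<Gamma> e(1)] by simp
    fix b assume b: "b \<in> El (mdom f) \<Gamma> \<and> top_map \<phi> \<Gamma> b = d \<and> mmap f \<Gamma> b = a"
    then have b: "b \<in> El (mdom f) \<Gamma>" "top_map \<phi> \<Gamma> b = d" "mmap f \<Gamma> b = a" by blast+
    \<comment> \<open>Uniqueness in the apex, applied to the preimage of \<open>b\<close> under
      \<open>bwd \<phi>\<close>.\<close>
    have "\<beta> \<Gamma> b = e"
      by (rule eu[OF nt_El[OF \<beta> \<Gamma> b(1)]])
        (simp_all only: top[OF \<Gamma> b(1), symmetric] \<beta>b[OF \<Gamma> b(1)] b)
    then show "b = bwd \<phi> \<Gamma> e" using \<beta>b[OF \<Gamma> b(1)] by simp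
  qed
qed

lemma cartesian_of_square:
  assumes "csq f g h k"
  shows "cartesian f g (of_square f g h k)"
  using csqD(1)[OF assms] assms
  by (intro cartesianI[where k = k]) (auto simp: of_square_def morphismD nat_trans_id, auto simp: nt_id_def)

lemma cartesian_id_mor: "morphism f \<Longrightarrow> cartesian f f (id_mor f)"
  unfolding id_mor_def
  by (intro cartesian_of_square csqI) (auto simp: nat_trans_id, auto simp: nt_id_def)

text \<open>The apex is the pullback of \<open>bwd \<psi>\<close>, which is bijective, so a pair in
  it is determined by its first component, and that component ranges over the whole apex of \<phi>.
  The squares themselves paste by \<open>csq_comp\<close>.\<close>

lemma cartesian_vcomp:
  assumes \<psi>: "cartesian g h \<psi>" and \<phi>: "cartesian f g \<phi>"
  shows "cartesian f h (\<psi> \<bullet> \<phi>)"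
proof (rule cartesianI)
  note D = cartesianD[OF \<phi>] and E = cartesianD[OF \<psi>]
  show "src (\<psi> \<bullet> \<phi>) = f" "tgt (\<psi> \<bullet> \<phi>) = h" using D E by (auto simp: vcomp_def)
  show "presheaf (apex (\<psi> \<bullet> \<phi>))"
    using D(5) E(5) nt_Act[OF D(7)] nt_Act[OF E(8)] unfolding presheaf_def vcomp_def by auto
  show "nat_trans (apex (\<psi> \<bullet> \<phi>)) (mdom f) (bwd (\<psi> \<bullet> \<phi>))"
    using D(8) unfolding nat_trans_def vcomp_def by auto
  show "csq f h (base (\<psi> \<bullet> \<phi>)) (nt_comp (top_map \<psi>) (top_map \<phi>))"
    using csq_comp[OF cartesian_csq[OF \<phi>] cartesian_csq[OF \<psi>]] by (simp add: vcomp_def)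
  fix \<Gamma> assume \<Gamma>: "\<Gamma> \<in> Obj C"
  show "proj (\<psi> \<bullet> \<phi>) \<Gamma> e = nt_comp (top_map \<psi>) (top_map \<phi>) \<Gamma> (bwd (\<psi> \<bullet> \<phi>) \<Gamma> e)"
    if "e \<in> El (apex (\<psi> \<bullet> \<phi>)) \<Gamma>" for e
    using that top_map_bwd[OF \<phi> \<Gamma>] top_map_bwd[OF \<psi> \<Gamma>] by (auto simp: vcomp_def nt_comp_def)
  fix b assume "b \<in> El (mdom f) \<Gamma>"
  from cartesian_bij[OF \<phi> \<Gamma> this] obtain x where x: "x \<in> El (apex \<phi>) \<Gamma>" "bwd \<phi> \<Gamma> x = b" by blast
  from cartesian_bij[OF \<psi> \<Gamma> nt_El[OF D(7) \<Gamma> x(1)]]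
  obtain y where y: "y \<in> El (apex \<psi>) \<Gamma>" "bwd \<psi> \<Gamma> y = proj \<phi> \<Gamma> x" by blast
  show "\<exists>!e. e \<in> El (apex (\<psi> \<bullet> \<phi>)) \<Gamma> \<and> bwd (\<psi> \<bullet> \<phi>) \<Gamma> e = b"
  proof (rule ex1I)
    show "(x, y) \<in> El (apex (\<psi> \<bullet> \<phi>)) \<Gamma> \<and> bwd (\<psi> \<bullet> \<phi>) \<Gamma> (x, y) = b"
      using x y by (simp add: vcomp_def)
    fix e assume "e \<in> El (apex (\<psi> \<bullet> \<phi>)) \<Gamma> \<and> bwd (\<psi> \<bullet> \<phi>) \<Gamma> e = b"
    then obtain x' y' where e: "e = (x', y')" "x' \<in> El (apex \<phi>) \<Gamma>" "bwd \<phi> \<Gamma> x' = b"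
      "y' \<in> El (apex \<psi>) \<Gamma>" "bwd \<psi> \<Gamma> y' = proj \<phi> \<Gamma> x'"
      by (auto simp: vcomp_def)
    have "x' = x" by (rule cartesian_inj[OF \<phi> \<Gamma> e(2) x(1)]) (simp add: e x)
    moreover from this have "y' = y" by (intro cartesian_inj[OF \<psi> \<Gamma> e(4) y(1)]) (simp add: e y)
    ultimately show "e = (x, y)" using e by simp
  qed
qed

section \<open>Extensions preserve cartesian squares\<close>

text \<open>Lifting through the square at the stage of \<sigma>, over the restriction of
  \<open>a\<close>, makes \<open>k\<close> a bijection from the fibre over \<open>a\<close> to the
  fibre over \<open>h \<Gamma> a\<close>. In this form the pullback property acts on
  exponents.\<close>

lemma fib_csq:
  assumes sq: "csq f g h k" and a: "a \<in> El (mcod f) \<Gamma>"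
  shows "(\<sigma>, b) \<in> fib f \<Gamma> a \<Longrightarrow> (\<sigma>, k (Dom C \<sigma>) b) \<in> fib g \<Gamma> (h \<Gamma> a)"
    and "(\<sigma>, d) \<in> fib g \<Gamma> (h \<Gamma> a) \<Longrightarrow> \<exists>!b. (\<sigma>, b) \<in> fib f \<Gamma> a \<and> k (Dom C \<sigma>) b = d"
proof -
  note S = csqD[OF sq]
  show "(\<sigma>, k (Dom C \<sigma>) b) \<in> fib g \<Gamma> (h \<Gamma> a)" if "(\<sigma>, b) \<in> fib f \<Gamma> a"
    using fibD[OF that] S(5) nt_El[OF S(4)] nt_Act[OF S(3)] a unfolding fib_iff by auto
  show "\<exists>!b. (\<sigma>, b) \<in> fib f \<Gamma> a \<and> k (Dom C \<sigma>) b = d" if d: "(\<sigma>, d) \<in> fib g \<Gamma> (h \<Gamma> a)"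
  proof -
    note D = fibD[OF d]
    have "\<exists>!b. b \<in> El (mdom f) (Dom C \<sigma>) \<and> k (Dom C \<sigma>) b = d \<and> mmap f (Dom C \<sigma>) b = Act (mcod f) \<sigma> a"
      using S(6)[OF D(3) Act_El[OF morphismD(2)[OF S(1)] D(1,2) a] D(5)] D(6) nt_Act[OF S(3) D(1,2) a] by simp
    then show ?thesis unfolding fib_iff using D(1,2) by blast
  qed
qed

section \<open>The transformation P_\<phi> of a cartesian morphism\<close>

lemma fst_pext_nat: "fst (pext_nat \<phi> \<Gamma> w) = base \<phi> \<Gamma> (fst w)"
  by (simp add: pext_nat_def split: prod.split)

lemma pext_nat_extensional:
  "cartesian f g \<phi> \<Longrightarrow> snd (pext_nat \<phi> \<Gamma> w) \<in> extensional (fib g \<Gamma> (base \<phi> \<Gamma> (fst w)))"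
  by (simp add: pext_nat_def cartesianD(2) split: prod.split)

text \<open>The description in \<open>pext_nat\<close> finds the apex element behind
  \<open>b\<close>, so P_\<phi> is precomposition with the inverse of the fibre bijection. Every
  element of the target fibre is a value of \<open>top_map \<phi>\<close>, so this equation
  determines P_\<phi> and replaces the description from here on.\<close>

lemma snd_pext_nat_app:
  assumes c: "cartesian f g \<phi>" and a: "fst w \<in> El (mcod f) \<Gamma>" and b: "(\<sigma>, b) \<in> fib f \<Gamma> (fst w)"
  shows "snd (pext_nat \<phi> \<Gamma> w) (\<sigma>, top_map \<phi> (Dom C \<sigma>) b) = snd w (\<sigma>, b)"
proof -
  note sq = cartesian_csq[OF c] and B = fibD[OF b]
  obtain e where e: "e \<in> El (apex \<phi>) (Dom C \<sigma>)" "bwd \<phi> (Dom C \<sigma>) e = b"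
    using cartesian_bij[OF c B(3,5)] by blast
  have "(THE e. e \<in> El (apex \<phi>) (Dom C \<sigma>) \<and> proj \<phi> (Dom C \<sigma>) e = top_map \<phi> (Dom C \<sigma>) b \<and>
          mmap f (Dom C \<sigma>) (bwd \<phi> (Dom C \<sigma>) e) = Act (mcod f) \<sigma> (fst w)) = e"
  proof (rule the_equality)
    \<comment> \<open>Another candidate has its backward image in the same fibre with the same top
      value, and the fibre bijection identifies the two.\<close>
    fix e' assume e': "e' \<in> El (apex \<phi>) (Dom C \<sigma>) \<and> proj \<phi> (Dom C \<sigma>) e' = top_map \<phi> (Dom C \<sigma>) b \<and>
          mmap f (Dom C \<sigma>) (bwd \<phi> (Dom C \<sigma>) e') = Act (mcod f) \<sigma> (fst w)"
    then have "(\<sigma>, bwd \<phi> (Dom C \<sigma>) e') \<in> fib f \<Gamma> (fst w)"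
      using B nt_El[OF cartesianD(8)[OF c]] unfolding fib_iff by blast
    moreover have "top_map \<phi> (Dom C \<sigma>) (bwd \<phi> (Dom C \<sigma>) e') = top_map \<phi> (Dom C \<sigma>) b"
      using top_map_bwd[OF c B(3)] e' by simp
    ultimately have "bwd \<phi> (Dom C \<sigma>) e' = b"
      using fib_csq(2)[OF sq a fib_csq(1)[OF sq a b]] b by blast
    then show "e' = e" using cartesian_inj[OF c B(3)] e e' by blast
  qed (use e B top_map_bwd[OF c B(3) e(1)] in simp)
  then show ?thesis
    using fib_csq(1)[OF sq a b] e(2) cartesianD(1,2)[OF c]
    by (simp add: pext_nat_def case_prod_beta)
qed

lemma nat_trans_pext_nat:
  assumes c: "cartesian f g \<phi>" and X: "presheaf X"
  shows "nat_trans (pext f X) (pext g X) (pext_nat \<phi>)"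
proof -
  note sq = cartesian_csq[OF c] and D = cartesianD[OF c] note S = csqD[OF sq]
  have in_El: "pext_nat \<phi> \<Gamma> w \<in> El (pext g X) \<Gamma>" if \<Gamma>: "\<Gamma> \<in> Obj C" and w: "w \<in> El (pext f X) \<Gamma>" for \<Gamma> w
    unfolding pext_iff fst_pext_nat
  proof (intro conjI allI impI)
    note a = pextD(1)[OF w]
    show "base \<phi> \<Gamma> (fst w) \<in> El (mcod g) \<Gamma>" using nt_El[OF S(3) \<Gamma> a] .
    show "snd (pext_nat \<phi> \<Gamma> w) \<in> extensional (fib g \<Gamma> (base \<phi> \<Gamma> (fst w)))" by (rule pext_nat_extensional[OF c])
    fix \<sigma> d assume "(\<sigma>, d) \<in> fib g \<Gamma> (base \<phi> \<Gamma> (fst w))"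
    then obtain b where b: "(\<sigma>, b) \<in> fib f \<Gamma> (fst w)" "d = top_map \<phi> (Dom C \<sigma>) b"
      using fib_csq(2)[OF sq a] by blast
    note B = fibD[OF b(1)]
    show "snd (pext_nat \<phi> \<Gamma> w) (\<sigma>, d) \<in> El X (Dom C \<sigma>)"
      using snd_pext_nat_app[OF c a b(1)] b(2) pextD(3)[OF w b(1)] by simp
    fix \<tau> assume \<tau>: "\<tau> \<in> Arr C" "Cod C \<tau> = Dom C \<sigma>"
    have "Act (mdom g) \<tau> d = top_map \<phi> (Dom C (Cmp C \<sigma> \<tau>)) (Act (mdom f) \<tau> b)"
      using nt_Act[OF S(4) \<tau> B(5)] b(2) Dom_Cmp[OF B(1) \<tau>] by simp
    then show "snd (pext_nat \<phi> \<Gamma> w) (Cmp C \<sigma> \<tau>, Act (mdom g) \<tau> d) = Act X \<tau> (snd (pext_nat \<phi> \<Gamma> w) (\<sigma>, d))"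
      using snd_pext_nat_app[OF c a b(1)] snd_pext_nat_app[OF c a fib_Cmp[OF S(1) a b(1) \<tau>]] b(2)
        pextD(4)[OF w b(1) \<tau>] by simp
  qed
  show ?thesis
  proof (rule nat_transI)
    fix \<sigma> w assume \<sigma>: "\<sigma> \<in> Arr C" and w: "w \<in> El (pext f X) (Cod C \<sigma>)"
    note a = pextD(1)[OF w]
    note w\<sigma> = pext_Act_El[OF S(1) X \<sigma> w] note a\<sigma> = pextD(1)[OF w\<sigma>]
    have base: "base \<phi> (Dom C \<sigma>) (Act (mcod f) \<sigma> (fst w)) = Act (mcod g) \<sigma> (base \<phi> (Cod C \<sigma>) (fst w))"
      using nt_Act[OF S(3) \<sigma> refl a] .
    show "pext_nat \<phi> (Dom C \<sigma>) (Act (pext f X) \<sigma> w) = Act (pext g X) \<sigma> (pext_nat \<phi> (Cod C \<sigma>) w)"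
    proof (rule pext_eqI[OF in_El[OF Dom_in[OF \<sigma>] w\<sigma>] pext_Act_El[OF S(2) X \<sigma> in_El[OF Cod_in[OF \<sigma>] w]]])
      fix \<tau> d assume "(\<tau>, d) \<in> fib g (Dom C \<sigma>) (fst (pext_nat \<phi> (Dom C \<sigma>) (Act (pext f X) \<sigma> w)))"
      then have d: "(\<tau>, d) \<in> fib g (Dom C \<sigma>) (base \<phi> (Dom C \<sigma>) (fst (Act (pext f X) \<sigma> w)))"
        by (simp add: fst_pext_nat)
      then obtain b where b: "(\<tau>, b) \<in> fib f (Dom C \<sigma>) (fst (Act (pext f X) \<sigma> w))" "d = top_map \<phi> (Dom C \<tau>) b"
        using fib_csq(2)[OF sq a\<sigma>] by blast
      have b': "(Cmp C \<sigma> \<tau>, b) \<in> fib f (Cod C \<sigma>) (fst w)"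
        using b(1) fib_Act_iff[OF S(1) \<sigma> refl a] by (simp add: fst_pext_Act)
      have "snd (Act (pext g X) \<sigma> (pext_nat \<phi> (Cod C \<sigma>) w)) (\<tau>, d) = snd (pext_nat \<phi> (Cod C \<sigma>) w) (Cmp C \<sigma> \<tau>, d)"
        using d by (intro snd_pext_Act_app) (simp add: fst_pext_nat fst_pext_Act base)
      also have "\<dots> = snd w (Cmp C \<sigma> \<tau>, b)"
        using snd_pext_nat_app[OF c a b'] b(2) Dom_Cmp[OF \<sigma>] fibD[OF b(1)] by simp
      also have "\<dots> = snd (Act (pext f X) \<sigma> w) (\<tau>, b)"
        using b(1) by (simp add: snd_pext_Act_app fst_pext_Act)
      finally show "snd (pext_nat \<phi> (Dom C \<sigma>) (Act (pext f X) \<sigma> w)) (\<tau>, d) =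
          snd (Act (pext g X) \<sigma> (pext_nat \<phi> (Cod C \<sigma>) w)) (\<tau>, d)"
        using snd_pext_nat_app[OF c a\<sigma> b(1)] b(2) by simp
    qed (simp add: fst_pext_nat fst_pext_Act base)
  qed (rule in_El)
qed

text \<open>Cartesianness of P_\<phi> at the map from X to 1: the fibres over \<open>a\<close> and
  over \<open>base \<phi> \<Gamma> a\<close> correspond, hence so do the families on them.\<close>

lemma pext_nat_ex1:
  assumes c: "cartesian f g \<phi>" and X: "presheaf X" and \<Gamma>: "\<Gamma> \<in> Obj C"
    and a: "a \<in> El (mcod f) \<Gamma>" and v: "v \<in> El (pext g X) \<Gamma>" and va: "fst v = base \<phi> \<Gamma> a"
  shows "\<exists>!w. w \<in> El (pext f X) \<Gamma> \<and> fst w = a \<and> pext_nat \<phi> \<Gamma> w = v"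
proof (rule ex1I)
  note sq = cartesian_csq[OF c] note S = csqD[OF sq]
  \<comment> \<open>The family \<open>v\<close> transported back along the fibre bijection.\<close>
  define w where "w = (a, restrict (\<lambda>(\<sigma>, b). snd v (\<sigma>, top_map \<phi> (Dom C \<sigma>) b)) (fib f \<Gamma> a))"
  have w_app: "snd w (\<sigma>, b) = snd v (\<sigma>, top_map \<phi> (Dom C \<sigma>) b)" if "(\<sigma>, b) \<in> fib f \<Gamma> a" for \<sigma> b
    using that by (simp add: w_def)
  have fst_w: "fst w = a" by (simp add: w_def)
  have v_fib: "(\<sigma>, top_map \<phi> (Dom C \<sigma>) b) \<in> fib g \<Gamma> (fst v)" if "(\<sigma>, b) \<in> fib f \<Gamma> a" for \<sigma> b
    using fib_csq(1)[OF sq a that] va by simp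
  have w: "w \<in> El (pext f X) \<Gamma>"
    unfolding pext_iff fst_w
  proof (intro conjI allI impI)
    show "snd w \<in> extensional (fib f \<Gamma> a)" by (simp add: w_def)
    fix \<sigma> b assume b: "(\<sigma>, b) \<in> fib f \<Gamma> a"
    note B = fibD[OF b]
    show "snd w (\<sigma>, b) \<in> El X (Dom C \<sigma>)" using w_app[OF b] pextD(3)[OF v v_fib[OF b]] by simp
    fix \<tau> assume \<tau>: "\<tau> \<in> Arr C" "Cod C \<tau> = Dom C \<sigma>"
    show "snd w (Cmp C \<sigma> \<tau>, Act (mdom f) \<tau> b) = Act X \<tau> (snd w (\<sigma>, b))"
      using w_app[OF b] w_app[OF fib_Cmp[OF S(1) a b \<tau>]] pextD(4)[OF v v_fib[OF b] \<tau>]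
        nt_Act[OF S(4) \<tau> B(5)] Dom_Cmp[OF B(1) \<tau>] by simp
  qed fact
  have "pext_nat \<phi> \<Gamma> w = v"
  proof (rule pext_eqI[OF nt_El[OF nat_trans_pext_nat[OF c X] \<Gamma> w] v])
    show "fst (pext_nat \<phi> \<Gamma> w) = fst v" by (simp add: fst_pext_nat fst_w va)
    fix \<sigma> d assume "(\<sigma>, d) \<in> fib g \<Gamma> (fst (pext_nat \<phi> \<Gamma> w))"
    then have "(\<sigma>, d) \<in> fib g \<Gamma> (base \<phi> \<Gamma> a)" by (simp add: fst_pext_nat fst_w)
    then obtain b where b: "(\<sigma>, b) \<in> fib f \<Gamma> a" "d = top_map \<phi> (Dom C \<sigma>) b"
      using fib_csq(2)[OF sq a] by blast
    then show "snd (pext_nat \<phi> \<Gamma> w) (\<sigma>, d) = snd v (\<sigma>, d)"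
      using snd_pext_nat_app[OF c, of w \<Gamma>] a w_app by (simp add: fst_w)
  qed
  then show "w \<in> El (pext f X) \<Gamma> \<and> fst w = a \<and> pext_nat \<phi> \<Gamma> w = v" using w fst_w by simp
  fix w' assume w': "w' \<in> El (pext f X) \<Gamma> \<and> fst w' = a \<and> pext_nat \<phi> \<Gamma> w' = v"
  show "w' = w"
  proof (rule pext_eqI[OF _ w])
    fix \<sigma> b assume "(\<sigma>, b) \<in> fib f \<Gamma> (fst w')"
    then show "snd w' (\<sigma>, b) = snd w (\<sigma>, b)"
      using snd_pext_nat_app[OF c, of w' \<Gamma>] w' w_app a by auto
  qed (use w' fst_w in auto)
qed

lemma lift_obj_simps [simp]:
  "mdom (lift_obj p f) = pext p (mdom f)" "mcod (lift_obj p f) = pext p (mcod f)"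
  "mmap (lift_obj p f) = pext_map p (mmap f)"
  by (simp_all add: lift_obj_def)

lemma morphism_lift_obj: "\<lbrakk>morphism p; morphism f\<rbrakk> \<Longrightarrow> morphism (lift_obj p f)"
  using presheaf_pext nat_trans_pext_map morphismD
  by (intro morphism_def[THEN iffD2] conjI) (simp_all add: morphismD presheaf_pext nat_trans_pext_map)

text \<open>By \<open>pext_nat_ex1\<close> the naturality squares at the maps to 1 from the domain
  and from the codomain of \<open>x\<close> are pullbacks; cancelling the second from the first
  leaves the square at \<open>x\<close>.\<close>

lemma csq_pext_nat:
  assumes c: "cartesian f g \<phi>" and x: "morphism x"
  shows "csq (lift_obj f x) (lift_obj g x) (pext_nat \<phi>) (pext_nat \<phi>)"
proof (rule csqI)
  note sq = cartesian_csq[OF c] note S = csqD[OF sq] and X = morphismD[OF x]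
  note nx = nat_trans_pext_map[OF S(1) X] and nx' = nat_trans_pext_map[OF S(2) X]
    and n = nat_trans_pext_nat[OF c X(1)] and n' = nat_trans_pext_nat[OF c X(2)]
  show "morphism (lift_obj f x)" "morphism (lift_obj g x)" by (rule morphism_lift_obj, fact, fact)+
  show "nat_trans (mcod (lift_obj f x)) (mcod (lift_obj g x)) (pext_nat \<phi>)"
    "nat_trans (mdom (lift_obj f x)) (mdom (lift_obj g x)) (pext_nat \<phi>)"
    using n n' by simp_all
  have comm: "pext_map g (mmap x) \<Gamma> (pext_nat \<phi> \<Gamma> w) = pext_nat \<phi> \<Gamma> (pext_map f (mmap x) \<Gamma> w)"
    if \<Gamma>: "\<Gamma> \<in> Obj C" and w: "w \<in> El (pext f (mdom x)) \<Gamma>" for \<Gamma> w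
  proof (rule pext_eqI[OF nt_El[OF nx' \<Gamma> nt_El[OF n \<Gamma> w]] nt_El[OF n' \<Gamma> nt_El[OF nx \<Gamma> w]]])
    note a = pextD(1)[OF w]
    fix \<sigma> d assume "(\<sigma>, d) \<in> fib g \<Gamma> (fst (pext_map g (mmap x) \<Gamma> (pext_nat \<phi> \<Gamma> w)))"
    then have d: "(\<sigma>, d) \<in> fib g \<Gamma> (base \<phi> \<Gamma> (fst w))" by (simp add: fst_pext_map fst_pext_nat)
    then obtain b where b: "(\<sigma>, b) \<in> fib f \<Gamma> (fst w)" "d = top_map \<phi> (Dom C \<sigma>) b"
      using fib_csq(2)[OF sq a] by blast
    then show "snd (pext_map g (mmap x) \<Gamma> (pext_nat \<phi> \<Gamma> w)) (\<sigma>, d) =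
        snd (pext_nat \<phi> \<Gamma> (pext_map f (mmap x) \<Gamma> w)) (\<sigma>, d)"
      using snd_pext_nat_app[OF c a] snd_pext_nat_app[OF c, of "pext_map f (mmap x) \<Gamma> w" \<Gamma> \<sigma> b] a d
      by (simp add: snd_pext_map_app fst_pext_map fst_pext_nat)
  qed (simp add: fst_pext_map fst_pext_nat)
  fix \<Gamma> assume \<Gamma>: "\<Gamma> \<in> Obj C"
  show "mmap (lift_obj g x) \<Gamma> (pext_nat \<phi> \<Gamma> w) = pext_nat \<phi> \<Gamma> (mmap (lift_obj f x) \<Gamma> w)"
    if "w \<in> El (mdom (lift_obj f x)) \<Gamma>" for w
    using comm[OF \<Gamma>] that by simp
  fix y v assume "y \<in> El (mcod (lift_obj f x)) \<Gamma>" "v \<in> El (mdom (lift_obj g x)) \<Gamma>"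
    "mmap (lift_obj g x) \<Gamma> v = pext_nat \<phi> \<Gamma> y"
  then have y: "y \<in> El (pext f (mcod x)) \<Gamma>" and v: "v \<in> El (pext g (mdom x)) \<Gamma>"
    and eq: "pext_map g (mmap x) \<Gamma> v = pext_nat \<phi> \<Gamma> y" by simp_all
  have va: "fst v = base \<phi> \<Gamma> (fst y)" using arg_cong[OF eq, of fst] by (simp add: fst_pext_map fst_pext_nat)
  have ex1: "\<exists>!w. w \<in> El (pext f (mdom x)) \<Gamma> \<and> fst w = fst y \<and> pext_nat \<phi> \<Gamma> w = v"
    by (rule pext_nat_ex1[OF c X(1) \<Gamma> pextD(1)[OF y] v va])
  have yu: "\<exists>!w. w \<in> El (pext f (mcod x)) \<Gamma> \<and> fst w = fst y \<and> pext_nat \<phi> \<Gamma> w = pext_nat \<phi> \<Gamma> y"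
    by (rule pext_nat_ex1[OF c X(2) \<Gamma> pextD(1)[OF y] nt_El[OF n' \<Gamma> y] fst_pext_nat])
  \<comment> \<open>The cancellation: \<open>y\<close> and the image of \<open>w\<close> under
    \<open>pext_map f (mmap x)\<close> have the same image under \<open>pext_nat \<phi>\<close>, so
    by \<open>yu\<close> they agree as soon as their first components do.\<close>
  have iff: "fst w = fst y \<longleftrightarrow> pext_map f (mmap x) \<Gamma> w = y"
    if w: "w \<in> El (pext f (mdom x)) \<Gamma>" "pext_nat \<phi> \<Gamma> w = v" for w
    using yu y nt_El[OF nx \<Gamma> w(1)] comm[OF \<Gamma> w(1)] w(2) eq fst_pext_map by metis
  show "\<exists>!w. w \<in> El (mdom (lift_obj f x)) \<Gamma> \<and> pext_nat \<phi> \<Gamma> w = v \<and> mmap (lift_obj f x) \<Gamma> w = y"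
    unfolding lift_obj_simps using ex1 iff by metis
qed

text \<open>P_p preserves pullbacks because two matching families, \<open>snd v\<close> and
  \<open>snd y\<close>, can be glued value by value to a family in the pullback.\<close>

lemma csq_pext_map:
  assumes p: "morphism p" and sq: "csq f g h k"
  shows "csq (lift_obj p f) (lift_obj p g) (pext_map p h) (pext_map p k)"
proof (rule csqI)
  note S = csqD[OF sq] note F = morphismD[OF S(1)] and G = morphismD[OF S(2)]
  show "morphism (lift_obj p f)" "morphism (lift_obj p g)" by (rule morphism_lift_obj, fact, fact)+
  show "nat_trans (mcod (lift_obj p f)) (mcod (lift_obj p g)) (pext_map p h)"
    "nat_trans (mdom (lift_obj p f)) (mdom (lift_obj p g)) (pext_map p k)"
    using nat_trans_pext_map[OF p F(2) G(2) S(3)] nat_trans_pext_map[OF p F(1) G(1) S(4)] by simp_all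
  fix \<Gamma> assume \<Gamma>: "\<Gamma> \<in> Obj C"
  show "mmap (lift_obj p g) \<Gamma> (pext_map p k \<Gamma> w) = pext_map p h \<Gamma> (mmap (lift_obj p f) \<Gamma> w)"
    if "w \<in> El (mdom (lift_obj p f)) \<Gamma>" for w
    using that S(5) by (simp add: pext_map_comp) (rule pext_map_cong, assumption, simp add: nt_eq_def nt_comp_def)
  fix y v assume "y \<in> El (mcod (lift_obj p f)) \<Gamma>" "v \<in> El (mdom (lift_obj p g)) \<Gamma>"
    "mmap (lift_obj p g) \<Gamma> v = pext_map p h \<Gamma> y"
  then have y: "y \<in> El (pext p (mcod f)) \<Gamma>" and v: "v \<in> El (pext p (mdom g)) \<Gamma>"
    and eq: "pext_map p (mmap g) \<Gamma> v = pext_map p h \<Gamma> y" by simp_all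
  have fst_v: "fst v = fst y" using arg_cong[OF eq, of fst] by (simp add: fst_pext_map)
  have ex1: "\<exists>!z. z \<in> El (mdom f) (Dom C \<sigma>) \<and> k (Dom C \<sigma>) z = snd v (\<sigma>, b) \<and> mmap f (Dom C \<sigma>) z = snd y (\<sigma>, b)"
    if b: "(\<sigma>, b) \<in> fib p \<Gamma> (fst y)" for \<sigma> b
  proof (rule S(6))
    have b': "(\<sigma>, b) \<in> fib p \<Gamma> (fst v)" using b fst_v by simp
    show "Dom C \<sigma> \<in> Obj C" "snd y (\<sigma>, b) \<in> El (mcod f) (Dom C \<sigma>)" "snd v (\<sigma>, b) \<in> El (mdom g) (Dom C \<sigma>)"
      using fibD(3)[OF b] pextD(3)[OF y b] pextD(3)[OF v b'] .
    show "mmap g (Dom C \<sigma>) (snd v (\<sigma>, b)) = h (Dom C \<sigma>) (snd y (\<sigma>, b))"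
      using arg_cong[OF eq, of "\<lambda>w. snd w (\<sigma>, b)"] b b' by (simp add: snd_pext_map_app)
  qed
  define w where "w = (fst y, restrict (\<lambda>(\<sigma>, b). THE z. z \<in> El (mdom f) (Dom C \<sigma>) \<and>
    k (Dom C \<sigma>) z = snd v (\<sigma>, b) \<and> mmap f (Dom C \<sigma>) z = snd y (\<sigma>, b)) (fib p \<Gamma> (fst y)))"
  have fst_w: "fst w = fst y" by (simp add: w_def)
  have w_app: "snd w (\<sigma>, b) \<in> El (mdom f) (Dom C \<sigma>) \<and> k (Dom C \<sigma>) (snd w (\<sigma>, b)) = snd v (\<sigma>, b) \<and>
      mmap f (Dom C \<sigma>) (snd w (\<sigma>, b)) = snd y (\<sigma>, b)" if b: "(\<sigma>, b) \<in> fib p \<Gamma> (fst y)" for \<sigma> b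
    using theI'[OF ex1[OF b]] b by (simp add: w_def)
  have w: "w \<in> El (pext p (mdom f)) \<Gamma>"
    unfolding pext_iff fst_w
  proof (intro conjI allI impI)
    show "snd w \<in> extensional (fib p \<Gamma> (fst y))" by (simp add: w_def)
    fix \<sigma> b assume b: "(\<sigma>, b) \<in> fib p \<Gamma> (fst y)"
    note W = w_app[OF b]
    show "snd w (\<sigma>, b) \<in> El (mdom f) (Dom C \<sigma>)" using W by blast
    fix \<tau> assume \<tau>: "\<tau> \<in> Arr C" "Cod C \<tau> = Dom C \<sigma>"
    note b\<tau> = fib_Cmp[OF p pextD(1)[OF y] b \<tau>] note W\<tau> = w_app[OF b\<tau>]
    have D: "Dom C (Cmp C \<sigma> \<tau>) = Dom C \<tau>" using Dom_Cmp[OF fibD(1)[OF b] \<tau>] .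
    have "Act (mdom f) \<tau> (snd w (\<sigma>, b)) \<in> El (mdom f) (Dom C \<tau>)"
      using Act_El[OF F(1) \<tau>] W by blast
    moreover have "k (Dom C \<tau>) (Act (mdom f) \<tau> (snd w (\<sigma>, b))) = snd v (Cmp C \<sigma> \<tau>, Act (mdom p) \<tau> b)"
      using nt_Act[OF S(4) \<tau>] W pextD(4)[OF v _ \<tau>, of b] b fst_v by simp
    moreover have "mmap f (Dom C \<tau>) (Act (mdom f) \<tau> (snd w (\<sigma>, b))) = snd y (Cmp C \<sigma> \<tau>, Act (mdom p) \<tau> b)"
      using nt_Act[OF F(3) \<tau>] W pextD(4)[OF y b \<tau>] by simp
    \<comment> \<open>The restriction of a glued value solves the lifting problem at the later
      stage, so uniqueness there makes the glued family natural.\<close>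
    ultimately show "snd w (Cmp C \<sigma> \<tau>, Act (mdom p) \<tau> b) = Act (mdom f) \<tau> (snd w (\<sigma>, b))"
      using ex1[OF b\<tau>] W\<tau> D by metis
  qed (rule pextD(1)[OF y])
  show "\<exists>!w. w \<in> El (mdom (lift_obj p f)) \<Gamma> \<and> pext_map p k \<Gamma> w = v \<and> mmap (lift_obj p f) \<Gamma> w = y"
  proof (rule ex1I)
    have "pext_map p k \<Gamma> w = v"
      by (rule pext_eqI[OF nt_El[OF nat_trans_pext_map[OF p F(1) G(1) S(4)] \<Gamma> w] v])
        (use w_app in \<open>auto simp: snd_pext_map_app fst_pext_map fst_w fst_v\<close>)
    moreover have "pext_map p (mmap f) \<Gamma> w = y"
      by (rule pext_eqI[OF nt_El[OF nat_trans_pext_map[OF p F] \<Gamma> w] y])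
        (use w_app in \<open>auto simp: snd_pext_map_app fst_pext_map fst_w fst_v\<close>)
    ultimately show "w \<in> El (mdom (lift_obj p f)) \<Gamma> \<and> pext_map p k \<Gamma> w = v \<and> mmap (lift_obj p f) \<Gamma> w = y"
      using w by simp
    fix w' assume "w' \<in> El (mdom (lift_obj p f)) \<Gamma> \<and> pext_map p k \<Gamma> w' = v \<and> mmap (lift_obj p f) \<Gamma> w' = y"
    then have w': "w' \<in> El (pext p (mdom f)) \<Gamma>" and kv: "pext_map p k \<Gamma> w' = v" and fy: "pext_map p (mmap f) \<Gamma> w' = y"
      by simp_all
    have fst_w': "fst w' = fst y" using arg_cong[OF fy, of fst] by (simp add: fst_pext_map)
    show "w' = w"
    proof (rule pext_eqI[OF w' w])
      fix \<sigma> b assume b: "(\<sigma>, b) \<in> fib p \<Gamma> (fst w')"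
      have "k (Dom C \<sigma>) (snd w' (\<sigma>, b)) = snd v (\<sigma>, b)" "mmap f (Dom C \<sigma>) (snd w' (\<sigma>, b)) = snd y (\<sigma>, b)"
        using b kv fy by (auto simp: snd_pext_map_app)
      then show "snd w' (\<sigma>, b) = snd w (\<sigma>, b)"
        using ex1[of \<sigma> b] w_app[of \<sigma> b] pextD(3)[OF w' b] b fst_w' by metis
    qed (simp add: fst_w fst_w')
  qed
qed

text \<open>Functoriality of P_p carries \<open>bwd \<phi>\<close> and its inverse to mutually
  inverse maps, and \<open>csq_pext_map\<close> carries the square.\<close>

lemma cartesian_lift_mor:
  assumes p: "morphism p" and c: "cartesian f g \<phi>"
  shows "cartesian (lift_obj p f) (lift_obj p g) (lift_mor p \<phi>)"
proof (rule cartesianI)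
  note D = cartesianD[OF c] note F = morphismD[OF D(3)]
  obtain \<beta> where \<beta>: "nat_trans (mdom f) (apex \<phi>) \<beta>" "nt_eq (apex \<phi>) (nt_comp \<beta> (bwd \<phi>)) nt_id"
    "nt_eq (mdom f) (nt_comp (bwd \<phi>) \<beta>) nt_id"
    using D(9) unfolding invertible_def by blast
  show "src (lift_mor p \<phi>) = lift_obj p f" "tgt (lift_mor p \<phi>) = lift_obj p g"
    using D by (auto simp: lift_mor_def)
  show "presheaf (apex (lift_mor p \<phi>))" using presheaf_pext[OF p D(5)] by (simp add: lift_mor_def)
  show "nat_trans (apex (lift_mor p \<phi>)) (mdom (lift_obj p f)) (bwd (lift_mor p \<phi>))"
    using nat_trans_pext_map[OF p D(5) F(1) D(8)] by (simp add: lift_mor_def)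
  show "csq (lift_obj p f) (lift_obj p g) (base (lift_mor p \<phi>)) (pext_map p (top_map \<phi>))"
    using csq_pext_map[OF p cartesian_csq[OF c]] by (simp add: lift_mor_def)
  fix \<Gamma> assume \<Gamma>: "\<Gamma> \<in> Obj C"
  show "proj (lift_mor p \<phi>) \<Gamma> e = pext_map p (top_map \<phi>) \<Gamma> (bwd (lift_mor p \<phi>) \<Gamma> e)"
    if "e \<in> El (apex (lift_mor p \<phi>)) \<Gamma>" for e
    using that top_map_bwd[OF c] pext_map_cong[of e p "apex \<phi>" \<Gamma> "proj \<phi>" "nt_comp (top_map \<phi>) (bwd \<phi>)"]
    by (simp add: lift_mor_def pext_map_comp nt_eq_def nt_comp_def)
  fix w assume "w \<in> El (mdom (lift_obj p f)) \<Gamma>"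
  then have w: "w \<in> El (pext p (mdom f)) \<Gamma>" by simp
  show "\<exists>!e. e \<in> El (apex (lift_mor p \<phi>)) \<Gamma> \<and> bwd (lift_mor p \<phi>) \<Gamma> e = w"
  proof (rule ex1I[where a = "pext_map p \<beta> \<Gamma> w"])
    show "pext_map p \<beta> \<Gamma> w \<in> El (apex (lift_mor p \<phi>)) \<Gamma> \<and> bwd (lift_mor p \<phi>) \<Gamma> (pext_map p \<beta> \<Gamma> w) = w"
      using nt_El[OF nat_trans_pext_map[OF p F(1) D(5) \<beta>(1)] \<Gamma> w] pext_map_cong[OF w \<beta>(3)] pext_map_id[OF w]
      by (simp add: lift_mor_def pext_map_comp)
    fix e assume "e \<in> El (apex (lift_mor p \<phi>)) \<Gamma> \<and> bwd (lift_mor p \<phi>) \<Gamma> e = w"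
    then have e: "e \<in> El (pext p (apex \<phi>)) \<Gamma>" "w = pext_map p (bwd \<phi>) \<Gamma> e" by (auto simp: lift_mor_def)
    then show "e = pext_map p \<beta> \<Gamma> w"
      using pext_map_cong[OF e(1) \<beta>(2)] pext_map_id[OF e(1)] by (simp add: pext_map_comp)
  qed
qed

section \<open>Extensions of the identity and of composites\<close>

text \<open>An arrow is the identity composed with itself, so naturality expresses a value at a
  restricted element by the value at the identity stage, as in the Yoneda lemma.\<close>

lemma pext_at:
  assumes f: "morphism f" and w: "w \<in> El (pext f X) \<Gamma>" and b: "(Idn C \<Gamma>, b) \<in> fib f \<Gamma> (fst w)"
    and \<sigma>: "\<sigma> \<in> Arr C" "Cod C \<sigma> = \<Gamma>"
  shows "snd w (\<sigma>, Act (mdom f) \<sigma> b) = Act X \<sigma> (snd w (Idn C \<Gamma>, b))"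
  using pextD(4)[OF w b \<sigma>(1)] \<sigma> Cmp_Idn_left[OF \<sigma>(1)] fibD(4)[OF b] by (simp add: Dom_Idn)

text \<open>A value at a later stage is a value of the restricted family at the identity stage. This
  reconciles \<open>comp_dom\<close>, which evaluates at identities, with fibres, which range over
  all stages.\<close>

lemma pext_Act_at:
  assumes f: "morphism f" and w: "w \<in> El (pext f X) \<Gamma>" and b: "(\<sigma>, b) \<in> fib f \<Gamma> (fst w)"
  shows "(Idn C (Dom C \<sigma>), b) \<in> fib f (Dom C \<sigma>) (fst (Act (pext f X) \<sigma> w))"
    and "snd (Act (pext f X) \<sigma> w) (Idn C (Dom C \<sigma>), b) = snd w (\<sigma>, b)"
proof -
  note B = fibD[OF b]
  have *: "(Idn C (Dom C \<sigma>), b) \<in> fib f (Dom C \<sigma>) (Act (mcod f) \<sigma> (fst w))"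
    using fib_Idn[OF f B(3,5,6)] .
  then show "(Idn C (Dom C \<sigma>), b) \<in> fib f (Dom C \<sigma>) (fst (Act (pext f X) \<sigma> w))"
    by (simp add: fst_pext_Act)
  show "snd (Act (pext f X) \<sigma> w) (Idn C (Dom C \<sigma>), b) = snd w (\<sigma>, b)"
    using * Cmp_Idn_right[OF B(1)] by (simp add: snd_pext_Act_app)
qed

section \<open>The identity polynomial and the isomorphism of X with its extension\<close>

lemma presheaf_one_psh: "presheaf one_psh"
  by (simp add: presheaf_def one_psh_def)

lemma morphism_id_poly: "morphism id_poly"
  by (simp add: morphism_def id_poly_def presheaf_one_psh nat_trans_id)

lemma fib_id_poly: "(\<sigma>, b) \<in> fib id_poly \<Gamma> a \<longleftrightarrow> \<sigma> \<in> Arr C \<and> Cod C \<sigma> = \<Gamma>"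
  by (simp add: fib_iff id_poly_def one_psh_def)

lemma snd_ext_id: "\<lbrakk>\<sigma> \<in> Arr C; Cod C \<sigma> = \<Gamma>\<rbrakk> \<Longrightarrow> snd (ext_id X \<Gamma> x) (\<sigma>, b) = Act X \<sigma> x"
  by (simp add: ext_id_def fib_id_poly)

lemma nat_trans_ext_id:
  assumes X: "presheaf X"
  shows "nat_trans X (pext id_poly X) (ext_id X)"
proof -
  have in_El: "ext_id X \<Gamma> x \<in> El (pext id_poly X) \<Gamma>" if \<Gamma>: "\<Gamma> \<in> Obj C" and x: "x \<in> El X \<Gamma>" for \<Gamma> x
    unfolding pext_iff
  proof (intro conjI allI impI)
    show "fst (ext_id X \<Gamma> x) \<in> El (mcod id_poly) \<Gamma>" by (simp add: id_poly_def one_psh_def)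
    show "snd (ext_id X \<Gamma> x) \<in> extensional (fib id_poly \<Gamma> (fst (ext_id X \<Gamma> x)))" by (simp add: ext_id_def)
    fix \<sigma> b assume "(\<sigma>, b) \<in> fib id_poly \<Gamma> (fst (ext_id X \<Gamma> x))"
    then have \<sigma>: "\<sigma> \<in> Arr C" "Cod C \<sigma> = \<Gamma>" by (simp_all add: fib_id_poly)
    show "snd (ext_id X \<Gamma> x) (\<sigma>, b) \<in> El X (Dom C \<sigma>)" using Act_El[OF X \<sigma> x] \<sigma> by (simp add: snd_ext_id)
    fix \<tau> assume \<tau>: "\<tau> \<in> Arr C" "Cod C \<tau> = Dom C \<sigma>"
    show "snd (ext_id X \<Gamma> x) (Cmp C \<sigma> \<tau>, Act (mdom id_poly) \<tau> b) = Act X \<tau> (snd (ext_id X \<Gamma> x) (\<sigma>, b))"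
      using \<sigma> \<tau> x Act_Cmp[OF X] by (simp add: snd_ext_id Cmp_in Cod_Cmp)
  qed
  show ?thesis
  proof (rule nat_transI)
    fix \<sigma> x assume \<sigma>: "\<sigma> \<in> Arr C" and x: "x \<in> El X (Cod C \<sigma>)"
    note x\<sigma> = Act_El[OF X \<sigma> refl x]
    show "ext_id X (Dom C \<sigma>) (Act X \<sigma> x) = Act (pext id_poly X) \<sigma> (ext_id X (Cod C \<sigma>) x)"
    proof (rule pext_eqI[OF in_El[OF Dom_in[OF \<sigma>] x\<sigma>]
          pext_Act_El[OF morphism_id_poly X \<sigma> in_El[OF Cod_in[OF \<sigma>] x]]])
      fix \<tau> b assume "(\<tau>, b) \<in> fib id_poly (Dom C \<sigma>) (fst (ext_id X (Dom C \<sigma>) (Act X \<sigma> x)))"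
      then have \<tau>: "\<tau> \<in> Arr C" "Cod C \<tau> = Dom C \<sigma>" by (simp_all add: fib_id_poly)
      show "snd (ext_id X (Dom C \<sigma>) (Act X \<sigma> x)) (\<tau>, b) = snd (Act (pext id_poly X) \<sigma> (ext_id X (Cod C \<sigma>) x)) (\<tau>, b)"
        using \<sigma> \<tau> x by (simp add: snd_ext_id snd_pext_Act_app fib_id_poly Act_Cmp[OF X] Cmp_in Cod_Cmp)
    qed simp
  qed (rule in_El)
qed

text \<open>The fibre of the identity polynomial at \<Gamma> is \<open>yoneda \<Gamma>\<close> up to
  a unit component, so this is the Yoneda lemma, with evaluation at the identity arrow as
  inverse.\<close>

lemma bij_betw_ext_id:
  assumes X: "presheaf X" and \<Gamma>: "\<Gamma> \<in> Obj C"
  shows "bij_betw (ext_id X \<Gamma>) (El X \<Gamma>) (El (pext id_poly X) \<Gamma>)"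
proof (rule bij_betw_byWitness[where f' = "\<lambda>w. snd w (Idn C \<Gamma>, ())"])
  note n = nat_trans_ext_id[OF X] and I = Idn_in[OF \<Gamma>] Dom_Idn[OF \<Gamma>] Cod_Idn[OF \<Gamma>]
  show "\<forall>x\<in>El X \<Gamma>. snd (ext_id X \<Gamma> x) (Idn C \<Gamma>, ()) = x"
    using Act_Idn[OF X \<Gamma>] I by (simp add: snd_ext_id)
  show "ext_id X \<Gamma> ` El X \<Gamma> \<subseteq> El (pext id_poly X) \<Gamma>" using nt_El[OF n \<Gamma>] by blast
  have i: "(Idn C \<Gamma>, ()) \<in> fib id_poly \<Gamma> a" for a using I by (simp add: fib_id_poly)
  have at_El: "snd w (Idn C \<Gamma>, ()) \<in> El X \<Gamma>" if "w \<in> El (pext id_poly X) \<Gamma>" for w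
    using pextD(3)[OF that i] I by simp
  then show "(\<lambda>w. snd w (Idn C \<Gamma>, ())) ` El (pext id_poly X) \<Gamma> \<subseteq> El X \<Gamma>" by blast
  show "\<forall>w\<in>El (pext id_poly X) \<Gamma>. ext_id X \<Gamma> (snd w (Idn C \<Gamma>, ())) = w"
  proof
    fix w assume w: "w \<in> El (pext id_poly X) \<Gamma>"
    show "ext_id X \<Gamma> (snd w (Idn C \<Gamma>, ())) = w"
    proof (rule pext_eqI[OF nt_El[OF n \<Gamma> at_El[OF w]] w])
      fix \<sigma> b assume "(\<sigma>, b) \<in> fib id_poly \<Gamma> (fst (ext_id X \<Gamma> (snd w (Idn C \<Gamma>, ()))))"
      then have "\<sigma> \<in> Arr C" "Cod C \<sigma> = \<Gamma>" by (simp_all add: fib_id_poly)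
      then show "snd (ext_id X \<Gamma> (snd w (Idn C \<Gamma>, ()))) (\<sigma>, b) = snd w (\<sigma>, b)"
        using pext_at[OF morphism_id_poly w i] by (simp add: snd_ext_id)
    qed simp
  qed
qed

lemma csq_ext_id:
  assumes x: "morphism x"
  shows "csq x (lift_obj id_poly x) (ext_id (mcod x)) (ext_id (mdom x))"
proof (rule csq_bij[OF x morphism_lift_obj[OF morphism_id_poly x]])
  note X = morphismD[OF x]
  show "nat_trans (mcod x) (mcod (lift_obj id_poly x)) (ext_id (mcod x))"
    "nat_trans (mdom x) (mdom (lift_obj id_poly x)) (ext_id (mdom x))"
    using nat_trans_ext_id X by simp_all
  fix \<Gamma> assume \<Gamma>: "\<Gamma> \<in> Obj C"
  show "inj_on (ext_id (mcod x) \<Gamma>) (El (mcod x) \<Gamma>)"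
    "bij_betw (ext_id (mdom x) \<Gamma>) (El (mdom x) \<Gamma>) (El (mdom (lift_obj id_poly x)) \<Gamma>)"
    using bij_betw_ext_id[OF X(1) \<Gamma>] bij_betw_ext_id[OF X(2) \<Gamma>] by (simp_all add: bij_betw_def)
  fix b assume b: "b \<in> El (mdom x) \<Gamma>"
  have "pext_map id_poly (mmap x) \<Gamma> (ext_id (mdom x) \<Gamma> b) = ext_id (mcod x) \<Gamma> (mmap x \<Gamma> b)"
  proof (rule pext_eqI)
    show "pext_map id_poly (mmap x) \<Gamma> (ext_id (mdom x) \<Gamma> b) \<in> El (pext id_poly (mcod x)) \<Gamma>"
      using nt_El[OF nat_trans_pext_map[OF morphism_id_poly X] \<Gamma> nt_El[OF nat_trans_ext_id[OF X(1)] \<Gamma> b]] .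
    show "ext_id (mcod x) \<Gamma> (mmap x \<Gamma> b) \<in> El (pext id_poly (mcod x)) \<Gamma>"
      using nt_El[OF nat_trans_ext_id[OF X(2)] \<Gamma> nt_El[OF X(3) \<Gamma> b]] .
    fix \<sigma> c assume "(\<sigma>, c) \<in> fib id_poly \<Gamma> (fst (pext_map id_poly (mmap x) \<Gamma> (ext_id (mdom x) \<Gamma> b)))"
    then have \<sigma>: "\<sigma> \<in> Arr C" "Cod C \<sigma> = \<Gamma>" by (simp_all add: fib_id_poly)
    show "snd (pext_map id_poly (mmap x) \<Gamma> (ext_id (mdom x) \<Gamma> b)) (\<sigma>, c) = snd (ext_id (mcod x) \<Gamma> (mmap x \<Gamma> b)) (\<sigma>, c)"
      using \<sigma> nt_Act[OF X(3) \<sigma> b] by (simp add: snd_pext_map_app fib_id_poly snd_ext_id)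
  qed simp
  then show "mmap (lift_obj id_poly x) \<Gamma> (ext_id (mdom x) \<Gamma> b) = ext_id (mcod x) \<Gamma> (mmap x \<Gamma> b)" by simp
qed

text \<open>Pastes the isomorphism square of \<open>ext_id\<close> with the cartesian naturality
  square of \<eta>.\<close>

lemma cartesian_lift_unit:
  assumes \<eta>: "cartesian id_poly p \<eta>" and f: "morphism f"
  shows "cartesian f (lift_obj p f) (lift_unit p \<eta> f)"
  unfolding lift_unit_def using csq_comp[OF csq_ext_id[OF f] csq_pext_nat[OF \<eta> f]]
  by (rule cartesian_of_square)

section \<open>Composite polynomials and the isomorphism of P_g(P_f(X)) with the extension of the
  composite\<close>

lemma pcomp_simps [simp]:
  "mdom (g \<odot> f) = comp_dom g f" "mcod (g \<odot> f) = pext g (mcod f)" "mmap (g \<odot> f) = (\<lambda>\<Gamma>. fst)"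
  by (simp_all add: pcomp_def)

lemma comp_dom_iff: "(w, d, b) \<in> El (comp_dom g f) \<Gamma> \<longleftrightarrow> w \<in> El (pext g (mcod f)) \<Gamma> \<and>
    d \<in> El (mdom g) \<Gamma> \<and> mmap g \<Gamma> d = fst w \<and>
    b \<in> El (mdom f) \<Gamma> \<and> mmap f \<Gamma> b = snd w (Idn C \<Gamma>, d)"
  by (simp add: comp_dom_def)

lemma comp_dom_Act: "Act (comp_dom g f) \<sigma> (w, d, b) = (Act (pext g (mcod f)) \<sigma> w, Act (mdom g) \<sigma> d, Act (mdom f) \<sigma> b)"
  by (simp add: comp_dom_def)

text \<open>The component \<open>v\<close> is forced to be the restriction of \<open>u\<close>, so
  an element of the fibre amounts to \<open>d\<close> and \<open>b\<close> at a common stage.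
  \<open>pext_Act_at\<close> moves the evaluation from the identity stage to \<sigma>.\<close>

lemma fib_pcomp_iff:
  assumes g: "morphism g" and f: "morphism f" and u: "u \<in> El (pext g (mcod f)) \<Gamma>"
  shows "(\<sigma>, v, d, b) \<in> fib (g \<odot> f) \<Gamma> u \<longleftrightarrow> v = Act (pext g (mcod f)) \<sigma> u \<and> (\<sigma>, d) \<in> fib g \<Gamma> (fst u) \<and>
    b \<in> El (mdom f) (Dom C \<sigma>) \<and> mmap f (Dom C \<sigma>) b = snd u (\<sigma>, d)"
proof -
  have "snd (Act (pext g (mcod f)) \<sigma> u) (Idn C (Dom C \<sigma>), d) = snd u (\<sigma>, d)" if "(\<sigma>, d) \<in> fib g \<Gamma> (fst u)"
    using pext_Act_at[OF g u that] by simp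
  moreover have "Act (pext g (mcod f)) \<sigma> u \<in> El (pext g (mcod f)) (Dom C \<sigma>)" if "(\<sigma>, d) \<in> fib g \<Gamma> (fst u)"
    using pext_Act_El[OF g morphismD(2)[OF f]] fibD[OF that] u by simp
  ultimately show ?thesis
    by (auto simp: fib_iff comp_dom_iff fst_pext_Act)
qed

text \<open>Here \<open>b\<close> lives at a later stage than \<open>d\<close>; restricting
  \<open>d\<close> along \<tau> brings both to the stage of
  \<open>Cmp C \<sigma> \<tau>\<close>.\<close>

lemma fib_pcomp_nested:
  assumes g: "morphism g" and f: "morphism f" and u: "u \<in> El (pext g (mcod f)) \<Gamma>"
    and d: "(\<sigma>, d) \<in> fib g \<Gamma> (fst u)" and b: "(\<tau>, b) \<in> fib f (Dom C \<sigma>) (snd u (\<sigma>, d))"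
  shows "(Cmp C \<sigma> \<tau>, Act (pext g (mcod f)) (Cmp C \<sigma> \<tau>) u, Act (mdom g) \<tau> d, b) \<in> fib (g \<odot> f) \<Gamma> u"
  using fib_Cmp[OF g pextD(1)[OF u] d fibD(1,2)[OF b]] fibD[OF b] pextD(4)[OF u d fibD(1,2)[OF b]] fibD(1)[OF d]
  unfolding fib_pcomp_iff[OF g f u] by (simp add: Dom_Cmp)

lemma nat_trans_fst_pext:
  "nat_trans (pext f X) (mcod f) (\<lambda>\<Gamma>. fst)"
  by (rule nat_transI) (auto simp: pextD(1) fst_pext_Act)

text \<open>The new base forgets the inner functions: it is P_g applied to the projection from
  P_f(X) to the codomain of \<open>f\<close>.\<close>

lemma fst_ext_comp: "fst (ext_comp g f \<Gamma> w) = pext_map g (\<lambda>_. fst) \<Gamma> w"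
  by (simp add: ext_comp_def pext_map_def Let_def split: prod.split)

lemma snd_ext_comp_app:
  assumes "(\<sigma>, v, d, b) \<in> fib (g \<odot> f) \<Gamma> (fst (ext_comp g f \<Gamma> w))"
  shows "snd (ext_comp g f \<Gamma> w) (\<sigma>, v, d, b) = snd (snd w (\<sigma>, d)) (Idn C (Dom C \<sigma>), b)"
  using assms by (cases w) (simp add: ext_comp_def Let_def)

lemma ext_comp_extensional: "snd (ext_comp g f \<Gamma> w) \<in> extensional (fib (g \<odot> f) \<Gamma> (fst (ext_comp g f \<Gamma> w)))"
  by (cases w) (simp add: ext_comp_def Let_def)

lemma fst_ext_comp_El:
  assumes g: "morphism g" and f: "morphism f" and X: "presheaf X" and \<Gamma>: "\<Gamma> \<in> Obj C"
    and w: "w \<in> El (pext g (pext f X)) \<Gamma>"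
  shows "fst (ext_comp g f \<Gamma> w) \<in> El (pext g (mcod f)) \<Gamma>"
  unfolding fst_ext_comp
  by (rule nt_El[OF nat_trans_pext_map[OF g presheaf_pext[OF f X] morphismD(2)[OF f] nat_trans_fst_pext] \<Gamma> w])

lemma ext_comp_fibD:
  assumes g: "morphism g" and f: "morphism f" and X: "presheaf X" and \<Gamma>: "\<Gamma> \<in> Obj C"
    and w: "w \<in> El (pext g (pext f X)) \<Gamma>" and z: "(\<sigma>, v, d, b) \<in> fib (g \<odot> f) \<Gamma> (fst (ext_comp g f \<Gamma> w))"
  shows "(\<sigma>, d) \<in> fib g \<Gamma> (fst w)" "snd w (\<sigma>, d) \<in> El (pext f X) (Dom C \<sigma>)"
    and "(Idn C (Dom C \<sigma>), b) \<in> fib f (Dom C \<sigma>) (fst (snd w (\<sigma>, d)))"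
    and "v = Act (pext g (mcod f)) \<sigma> (fst (ext_comp g f \<Gamma> w))"
proof -
  note Z = z[unfolded fib_pcomp_iff[OF g f fst_ext_comp_El[OF g f X \<Gamma> w]]]
  show d: "(\<sigma>, d) \<in> fib g \<Gamma> (fst w)" using Z by (simp add: fst_ext_comp fst_pext_map)
  show "snd w (\<sigma>, d) \<in> El (pext f X) (Dom C \<sigma>)" by (rule pextD(3)[OF w d])
  have "snd (fst (ext_comp g f \<Gamma> w)) (\<sigma>, d) = fst (snd w (\<sigma>, d))"
    using d by (simp add: fst_ext_comp snd_pext_map_app)
  then show "(Idn C (Dom C \<sigma>), b) \<in> fib f (Dom C \<sigma>) (fst (snd w (\<sigma>, d)))"
    using Z fibD(3)[OF d] by (intro fib_Idn[OF f]) auto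
  show "v = Act (pext g (mcod f)) \<sigma> (fst (ext_comp g f \<Gamma> w))" using Z by simp
qed

lemma nat_trans_ext_comp:
  assumes g: "morphism g" and f: "morphism f" and X: "presheaf X"
  shows "nat_trans (pext g (pext f X)) (pext (g \<odot> f) X) (ext_comp g f)"
proof -
  note gf = morphism_pcomp[OF g f] and fX = presheaf_pext[OF f X]
  note ggX = nat_trans_pext_map[OF g fX morphismD(2)[OF f] nat_trans_fst_pext]
  have in_El: "ext_comp g f \<Gamma> w \<in> El (pext (g \<odot> f) X) \<Gamma>"
    if \<Gamma>: "\<Gamma> \<in> Obj C" and w: "w \<in> El (pext g (pext f X)) \<Gamma>" for \<Gamma> w
    unfolding pext_iff
  proof (intro conjI allI impI)
    let ?u = "fst (ext_comp g f \<Gamma> w)"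
    show "?u \<in> El (mcod (g \<odot> f)) \<Gamma>" using fst_ext_comp_El[OF g f X \<Gamma> w] by simp
    show "snd (ext_comp g f \<Gamma> w) \<in> extensional (fib (g \<odot> f) \<Gamma> ?u)" by (rule ext_comp_extensional)
    fix \<sigma> z assume z: "(\<sigma>, z) \<in> fib (g \<odot> f) \<Gamma> ?u"
    obtain v d b where zz: "z = (v, d, b)" by (cases z)
    note zf = z[unfolded zz]
    note F = ext_comp_fibD[OF g f X \<Gamma> w zf] and B = fibD[OF zf]
    show "snd (ext_comp g f \<Gamma> w) (\<sigma>, z) \<in> El X (Dom C \<sigma>)"
      using pextD(3)[OF F(2,3)] B(3) by (simp add: zz snd_ext_comp_app[OF zf] Dom_Idn)
    fix \<tau> assume \<tau>: "\<tau> \<in> Arr C" "Cod C \<tau> = Dom C \<sigma>"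
    have u: "?u \<in> El (mcod (g \<odot> f)) \<Gamma>" using fst_ext_comp_El[OF g f X \<Gamma> w] by simp
    note z\<tau> = fib_Cmp[OF gf u zf \<tau>, simplified, unfolded comp_dom_Act]
    have "snd (ext_comp g f \<Gamma> w) (Cmp C \<sigma> \<tau>, Act (mdom (g \<odot> f)) \<tau> z) =
        snd (snd w (Cmp C \<sigma> \<tau>, Act (mdom g) \<tau> d)) (Idn C (Dom C \<tau>), Act (mdom f) \<tau> b)"
      using snd_ext_comp_app[OF z\<tau>] by (simp add: zz comp_dom_Act Dom_Cmp[OF B(1) \<tau>])
    also have "\<dots> = snd (Act (pext f X) \<tau> (snd w (\<sigma>, d))) (Idn C (Dom C \<tau>), Act (mdom f) \<tau> b)"
      using pextD(4)[OF w F(1) \<tau>] by simp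
    \<comment> \<open>Moves the stage from the identity back to \<tau>, where naturality of the
      inner family applies.\<close>
    also have "\<dots> = snd (snd w (\<sigma>, d)) (\<tau>, Act (mdom f) \<tau> b)"
      using fib_Cmp[OF f pextD(1)[OF F(2)] F(3) \<tau>(1)] \<tau> B(3) Cmp_Idn_left[OF \<tau>(1)]
      by (intro pext_Act_at(2)[OF f F(2)]) (simp add: Dom_Idn)
    also have "\<dots> = Act X \<tau> (snd (snd w (\<sigma>, d)) (Idn C (Dom C \<sigma>), b))"
      by (rule pext_at[OF f F(2,3) \<tau>])
    finally show "snd (ext_comp g f \<Gamma> w) (Cmp C \<sigma> \<tau>, Act (mdom (g \<odot> f)) \<tau> z) =
        Act X \<tau> (snd (ext_comp g f \<Gamma> w) (\<sigma>, z))"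
      by (simp add: zz snd_ext_comp_app[OF zf])
  qed
  show ?thesis
  proof (rule nat_transI)
    fix \<sigma> w assume \<sigma>: "\<sigma> \<in> Arr C" and w: "w \<in> El (pext g (pext f X)) (Cod C \<sigma>)"
    note w\<sigma> = pext_Act_El[OF g fX \<sigma> w]
    note o = Dom_in[OF \<sigma>] Cod_in[OF \<sigma>]
    let ?l = "ext_comp g f (Dom C \<sigma>) (Act (pext g (pext f X)) \<sigma> w)"
    let ?r = "Act (pext (g \<odot> f) X) \<sigma> (ext_comp g f (Cod C \<sigma>) w)"
    have fst_eq: "fst ?l = fst ?r"
      using nt_Act[OF ggX \<sigma> refl w] by (simp add: fst_ext_comp fst_pext_Act)
    show "?l = ?r"
    proof (rule pext_eqI[OF in_El[OF o(1) w\<sigma>] pext_Act_El[OF gf X \<sigma> in_El[OF o(2) w]] fst_eq])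
      fix \<tau> z assume z: "(\<tau>, z) \<in> fib (g \<odot> f) (Dom C \<sigma>) (fst ?l)"
      obtain v d b where zz: "z = (v, d, b)" by (cases z)
      note zf = z[unfolded zz]
      note F = ext_comp_fibD[OF g f X o(1) w\<sigma> zf] and B = fibD[OF zf]
      have zr: "(\<tau>, v, d, b) \<in> fib (g \<odot> f) (Dom C \<sigma>) (Act (mcod (g \<odot> f)) \<sigma> (fst (ext_comp g f (Cod C \<sigma>) w)))"
        using zf unfolding fst_eq fst_pext_Act .
      have zc: "(Cmp C \<sigma> \<tau>, v, d, b) \<in> fib (g \<odot> f) (Cod C \<sigma>) (fst (ext_comp g f (Cod C \<sigma>) w))"
        using zr fib_Act_iff[OF gf \<sigma> refl, of "fst (ext_comp g f (Cod C \<sigma>) w)"] fst_ext_comp_El[OF g f X o(2) w]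
        by simp
      have "snd ?r (\<tau>, z) = snd (snd w (Cmp C \<sigma> \<tau>, d)) (Idn C (Dom C \<tau>), b)"
        using snd_pext_Act_app[OF zr] snd_ext_comp_app[OF zc] by (simp add: zz Dom_Cmp[OF \<sigma> B(1,2)])
      also have "\<dots> = snd ?l (\<tau>, z)"
        using F(1) snd_pext_Act_app[of \<tau> d g \<sigma> w "pext f X"]
        by (simp add: zz snd_ext_comp_app[OF zf] fst_pext_Act)
      finally show "snd ?l (\<tau>, z) = snd ?r (\<tau>, z)" by simp
    qed
  qed (rule in_El)
qed

text \<open>\<open>ext_comp\<close> evaluates inner families at identities only. Restricting
  \<open>d\<close> first recovers their values at later stages, so the whole nested family can be
  read from its image.\<close>

lemma ext_comp_nested:
  assumes g: "morphism g" and f: "morphism f" and X: "presheaf X" and \<Gamma>: "\<Gamma> \<in> Obj C"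
    and w: "w \<in> El (pext g (pext f X)) \<Gamma>"
    and d: "(\<sigma>, d) \<in> fib g \<Gamma> (fst w)" and b: "(\<tau>, b) \<in> fib f (Dom C \<sigma>) (fst (snd w (\<sigma>, d)))"
  defines "z \<equiv> (Cmp C \<sigma> \<tau>, Act (pext g (mcod f)) (Cmp C \<sigma> \<tau>) (fst (ext_comp g f \<Gamma> w)), Act (mdom g) \<tau> d, b)"
  shows "z \<in> fib (g \<odot> f) \<Gamma> (fst (ext_comp g f \<Gamma> w))"
    and "snd (ext_comp g f \<Gamma> w) z = snd (snd w (\<sigma>, d)) (\<tau>, b)"
proof -
  note u = fst_ext_comp_El[OF g f X \<Gamma> w] and B = fibD[OF b]
  have "snd (fst (ext_comp g f \<Gamma> w)) (\<sigma>, d) = fst (snd w (\<sigma>, d))"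
    using d by (simp add: fst_ext_comp snd_pext_map_app)
  then show zf: "z \<in> fib (g \<odot> f) \<Gamma> (fst (ext_comp g f \<Gamma> w))"
    unfolding z_def using d b
    by (intro fib_pcomp_nested[OF g f u]) (simp_all add: fst_ext_comp fst_pext_map)
  have "snd (ext_comp g f \<Gamma> w) z = snd (snd w (Cmp C \<sigma> \<tau>, Act (mdom g) \<tau> d)) (Idn C (Dom C \<tau>), b)"
    using snd_ext_comp_app[OF zf[unfolded z_def]] by (simp add: z_def Dom_Cmp[OF fibD(1)[OF d] B(1,2)])
  also have "\<dots> = snd (Act (pext f X) \<tau> (snd w (\<sigma>, d))) (Idn C (Dom C \<tau>), b)"
    using pextD(4)[OF w d B(1,2)] by simp
  also have "\<dots> = snd (snd w (\<sigma>, d)) (\<tau>, b)" by (rule pext_Act_at(2)[OF f pextD(3)[OF w d] b])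
  finally show "snd (ext_comp g f \<Gamma> w) z = snd (snd w (\<sigma>, d)) (\<tau>, b)" .
qed

text \<open>The first component of the image determines the outer and inner bases, and
  \<open>ext_comp_nested\<close> the inner values.\<close>

lemma inj_on_ext_comp:
  assumes g: "morphism g" and f: "morphism f" and X: "presheaf X" and \<Gamma>: "\<Gamma> \<in> Obj C"
  shows "inj_on (ext_comp g f \<Gamma>) (El (pext g (pext f X)) \<Gamma>)"
proof (rule inj_onI)
  fix w w' assume w: "w \<in> El (pext g (pext f X)) \<Gamma>" and w': "w' \<in> El (pext g (pext f X)) \<Gamma>"
    and eq: "ext_comp g f \<Gamma> w = ext_comp g f \<Gamma> w'"
  have eq1: "pext_map g (\<lambda>_. fst) \<Gamma> w = pext_map g (\<lambda>_. fst) \<Gamma> w'"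
    using arg_cong[OF eq, of fst] by (simp only: fst_ext_comp)
  have fst_eq: "fst w = fst w'" using arg_cong[OF eq1, of fst] by (simp add: fst_pext_map)
  show "w = w'"
  proof (rule pext_eqI[OF w w' fst_eq])
    fix \<sigma> d assume d: "(\<sigma>, d) \<in> fib g \<Gamma> (fst w)"
    then have d': "(\<sigma>, d) \<in> fib g \<Gamma> (fst w')" by (simp add: fst_eq)
    have n: "fst (snd w (\<sigma>, d)) = fst (snd w' (\<sigma>, d))"
      using arg_cong[OF eq1, of "\<lambda>u. snd u (\<sigma>, d)"] d d' by (simp add: snd_pext_map_app)
    show "snd w (\<sigma>, d) = snd w' (\<sigma>, d)"
    proof (rule pext_eqI[OF pextD(3)[OF w d] pextD(3)[OF w' d'] n])
      fix \<tau> b assume b: "(\<tau>, b) \<in> fib f (Dom C \<sigma>) (fst (snd w (\<sigma>, d)))"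
      then have b': "(\<tau>, b) \<in> fib f (Dom C \<sigma>) (fst (snd w' (\<sigma>, d)))" by (simp add: n)
      show "snd (snd w (\<sigma>, d)) (\<tau>, b) = snd (snd w' (\<sigma>, d)) (\<tau>, b)"
        using ext_comp_nested(2)[OF g f X \<Gamma> w d b] ext_comp_nested(2)[OF g f X \<Gamma> w' d' b'] eq by simp
    qed
  qed
qed

text \<open>Currying: a family on pairs of \<open>d\<close> and \<open>b\<close> becomes a family in
  \<open>d\<close> of families in \<open>b\<close>. The weight lies in surjectivity, where the
  curried family has to be natural in both stages.\<close>

lemma bij_betw_ext_comp:
  assumes g: "morphism g" and f: "morphism f" and X: "presheaf X" and \<Gamma>: "\<Gamma> \<in> Obj C"
  shows "bij_betw (ext_comp g f \<Gamma>) (El (pext g (pext f X)) \<Gamma>) (El (pext (g \<odot> f) X) \<Gamma>)"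
proof -
  note n = nat_trans_ext_comp[OF g f X]
  have "\<exists>w\<in>El (pext g (pext f X)) \<Gamma>. ext_comp g f \<Gamma> w = v" if v: "v \<in> El (pext (g \<odot> f) X) \<Gamma>" for v
  proof -
    define u where "u = fst v"
    have u: "u \<in> El (pext g (mcod f)) \<Gamma>" using pextD(1)[OF v] by (simp add: u_def)
    \<comment> \<open>\<open>v\<close> takes \<open>d\<close> and \<open>b\<close> at one stage, so
      \<open>d\<close> is first restricted to the stage of \<open>b\<close>.\<close>
    define s where "s = (\<lambda>\<sigma> d \<tau> b. snd v (Cmp C \<sigma> \<tau>, Act (pext g (mcod f)) (Cmp C \<sigma> \<tau>) u, Act (mdom g) \<tau> d, b))"
    define w where "w = (fst u, restrict (\<lambda>(\<sigma>, d). (snd u (\<sigma>, d),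
      restrict (\<lambda>(\<tau>, b). s \<sigma> d \<tau> b) (fib f (Dom C \<sigma>) (snd u (\<sigma>, d))))) (fib g \<Gamma> (fst u)))"
    have fst_w: "fst w = fst u" by (simp add: w_def)
    have fst_w_app: "fst (snd w (\<sigma>, d)) = snd u (\<sigma>, d)" if "(\<sigma>, d) \<in> fib g \<Gamma> (fst u)" for \<sigma> d
      using that by (simp add: w_def)
    have w_app: "snd (snd w (\<sigma>, d)) (\<tau>, b) = s \<sigma> d \<tau> b"
      if "(\<sigma>, d) \<in> fib g \<Gamma> (fst u)" "(\<tau>, b) \<in> fib f (Dom C \<sigma>) (snd u (\<sigma>, d))" for \<sigma> d \<tau> b
      using that by (simp add: w_def)
    have w_in: "snd w (\<sigma>, d) \<in> El (pext f X) (Dom C \<sigma>)" if d: "(\<sigma>, d) \<in> fib g \<Gamma> (fst u)" for \<sigma> d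
      unfolding pext_iff fst_w_app[OF d]
    proof (intro conjI allI impI)
      show ud: "snd u (\<sigma>, d) \<in> El (mcod f) (Dom C \<sigma>)" by (rule pextD(3)[OF u d])
      show "snd (snd w (\<sigma>, d)) \<in> extensional (fib f (Dom C \<sigma>) (snd u (\<sigma>, d)))"
        using d by (simp add: w_def)
      fix \<tau> b assume b: "(\<tau>, b) \<in> fib f (Dom C \<sigma>) (snd u (\<sigma>, d))"
      note B = fibD[OF b] and D = fibD[OF d]
      note zf = fib_pcomp_nested[OF g f u d b] note zv = zf[unfolded u_def]
      show "snd (snd w (\<sigma>, d)) (\<tau>, b) \<in> El X (Dom C \<tau>)"
        using pextD(3)[OF v zv] by (simp add: w_app[OF d b] s_def u_def Dom_Cmp[OF D(1) B(1,2)])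
      fix \<rho> assume \<rho>: "\<rho> \<in> Arr C" "Cod C \<rho> = Dom C \<tau>"
      have \<rho>': "Cod C \<rho> = Dom C (Cmp C \<sigma> \<tau>)" using \<rho> Dom_Cmp[OF D(1) B(1,2)] by simp
      have uA: "Act (pext g (mcod f)) \<rho> (Act (pext g (mcod f)) (Cmp C \<sigma> \<tau>) u) =
          Act (pext g (mcod f)) (Cmp C (Cmp C \<sigma> \<tau>) \<rho>) u"
        using Act_Cmp[OF presheaf_pext[OF g morphismD(2)[OF f]] Cmp_in[OF D(1) B(1,2)] \<rho>(1) \<rho>'] u D(2)
        by (simp add: Cod_Cmp[OF D(1) B(1,2)])
      have dA: "Act (mdom g) \<rho> (Act (mdom g) \<tau> d) = Act (mdom g) (Cmp C \<tau> \<rho>) d"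
        using Act_Cmp[OF morphismD(1)[OF g] B(1) \<rho>] D(5) B(2) by simp
      show "snd (snd w (\<sigma>, d)) (Cmp C \<tau> \<rho>, Act (mdom f) \<rho> b) = Act X \<rho> (snd (snd w (\<sigma>, d)) (\<tau>, b))"
        using pextD(4)[OF v zv \<rho>(1) \<rho>'] uA dA w_app[OF d b] w_app[OF d fib_Cmp[OF f ud b \<rho>]]
          Cmp_assoc[OF D(1) B(1) \<rho>(1) B(2) \<rho>(2)]
        by (simp add: s_def comp_dom_Act u_def)
    qed
    have w: "w \<in> El (pext g (pext f X)) \<Gamma>"
      unfolding pext_iff[of w g] fst_w
    proof (intro conjI allI impI)
      show "fst u \<in> El (mcod g) \<Gamma>" by (rule pextD(1)[OF u])
      show "snd w \<in> extensional (fib g \<Gamma> (fst u))" by (simp add: w_def)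
      fix \<sigma> d assume d: "(\<sigma>, d) \<in> fib g \<Gamma> (fst u)"
      note D = fibD[OF d]
      show "snd w (\<sigma>, d) \<in> El (pext f X) (Dom C \<sigma>)" by (rule w_in[OF d])
      fix \<tau> assume \<tau>: "\<tau> \<in> Arr C" "Cod C \<tau> = Dom C \<sigma>"
      note d\<tau> = fib_Cmp[OF g pextD(1)[OF u] d \<tau>]
      have ud: "snd u (Cmp C \<sigma> \<tau>, Act (mdom g) \<tau> d) = Act (mcod f) \<tau> (snd u (\<sigma>, d))"
        by (rule pextD(4)[OF u d \<tau>])
      \<comment> \<open>Naturality in \<open>d\<close>: both sides evaluate \<open>v\<close> at the
        composite of \<sigma>, \<tau> and \<rho>, bracketed differently.\<close>
      show "snd w (Cmp C \<sigma> \<tau>, Act (mdom g) \<tau> d) = Act (pext f X) \<tau> (snd w (\<sigma>, d))"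
      proof (rule pext_eqI)
        show "snd w (Cmp C \<sigma> \<tau>, Act (mdom g) \<tau> d) \<in> El (pext f X) (Dom C \<tau>)"
          using w_in[OF d\<tau>] by (simp add: Dom_Cmp[OF D(1) \<tau>])
        show "Act (pext f X) \<tau> (snd w (\<sigma>, d)) \<in> El (pext f X) (Dom C \<tau>)"
          using pext_Act_El[OF f X \<tau>(1)] w_in[OF d] \<tau>(2) by simp
        show "fst (snd w (Cmp C \<sigma> \<tau>, Act (mdom g) \<tau> d)) = fst (Act (pext f X) \<tau> (snd w (\<sigma>, d)))"
          by (simp add: fst_w_app[OF d\<tau>] fst_w_app[OF d] ud fst_pext_Act)
        fix \<rho> b assume "(\<rho>, b) \<in> fib f (Dom C \<tau>) (fst (snd w (Cmp C \<sigma> \<tau>, Act (mdom g) \<tau> d)))"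
        then have b: "(\<rho>, b) \<in> fib f (Dom C \<tau>) (Act (mcod f) \<tau> (snd u (\<sigma>, d)))"
          by (simp add: fst_w_app[OF d\<tau>] ud)
        then have b\<tau>: "(\<rho>, b) \<in> fib f (Dom C (Cmp C \<sigma> \<tau>)) (snd u (Cmp C \<sigma> \<tau>, Act (mdom g) \<tau> d))"
          by (simp add: ud Dom_Cmp[OF D(1) \<tau>])
        note B = fibD[OF b]
        have bc: "(Cmp C \<tau> \<rho>, b) \<in> fib f (Dom C \<sigma>) (snd u (\<sigma>, d))"
          using b fib_Act_iff[OF f \<tau> pextD(3)[OF u d]] by simp
        have dA: "Act (mdom g) \<rho> (Act (mdom g) \<tau> d) = Act (mdom g) (Cmp C \<tau> \<rho>) d"
          using Act_Cmp[OF morphismD(1)[OF g] \<tau>(1) B(1,2)] D(5) \<tau>(2) by simp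
        have "snd (Act (pext f X) \<tau> (snd w (\<sigma>, d))) (\<rho>, b) = s \<sigma> d (Cmp C \<tau> \<rho>) b"
          using b w_app[OF d bc] by (simp add: snd_pext_Act_app fst_w_app[OF d])
        then show "snd (snd w (Cmp C \<sigma> \<tau>, Act (mdom g) \<tau> d)) (\<rho>, b) = snd (Act (pext f X) \<tau> (snd w (\<sigma>, d))) (\<rho>, b)"
          using w_app[OF d\<tau> b\<tau>] Cmp_assoc[OF D(1) \<tau>(1) B(1) \<tau>(2) B(2)] by (simp add: s_def dA)
      qed
    qed
    have fst_eq: "fst (ext_comp g f \<Gamma> w) = fst v"
    proof -
      have "pext_map g (\<lambda>_. fst) \<Gamma> w = u"
        by (rule pext_eqI[OF fst_ext_comp_El[OF g f X \<Gamma> w, unfolded fst_ext_comp] u])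
          (simp_all add: fst_pext_map fst_w snd_pext_map_app fst_w_app)
      then show ?thesis by (simp only: fst_ext_comp u_def)
    qed
    have "ext_comp g f \<Gamma> w = v"
    proof (rule pext_eqI[OF nt_El[OF n \<Gamma> w] v fst_eq])
      fix \<sigma> z assume z: "(\<sigma>, z) \<in> fib (g \<odot> f) \<Gamma> (fst (ext_comp g f \<Gamma> w))"
      obtain v' d b where zz: "z = (v', d, b)" by (cases z)
      note zf = z[unfolded zz] note F = ext_comp_fibD[OF g f X \<Gamma> w zf]
      note d = F(1)[unfolded fst_w] note D = fibD[OF d]
      note b = F(3)[unfolded fst_w_app[OF d]]
      \<comment> \<open>At the identity as inner stage the arrow in \<open>s\<close> collapses to
        \<sigma> and \<open>d\<close> stays unrestricted, which gives \<open>v\<close> back.\<close>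
      show "snd (ext_comp g f \<Gamma> w) (\<sigma>, z) = snd v (\<sigma>, z)"
        using snd_ext_comp_app[OF zf] w_app[OF d b] F(4) Cmp_Idn_right[OF D(1)]
          Act_Idn[OF morphismD(1)[OF g] D(3,5)] fst_eq
        by (simp add: zz s_def u_def)
    qed
    then show ?thesis using w by blast
  qed
  then have "El (pext (g \<odot> f) X) \<Gamma> \<subseteq> ext_comp g f \<Gamma> ` El (pext g (pext f X)) \<Gamma>"
    by (metis imageI subsetI)
  moreover have "ext_comp g f \<Gamma> ` El (pext g (pext f X)) \<Gamma> \<subseteq> El (pext (g \<odot> f) X) \<Gamma>"
    using nt_El[OF n \<Gamma>] by blast
  ultimately show ?thesis using inj_on_ext_comp[OF g f X \<Gamma>] by (simp add: bij_betw_def)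
qed

text \<open>\<open>csq_bij\<close> reduces the claim to commutativity, which holds because
  \<open>mmap x\<close> acts on the innermost values whereas \<open>ext_comp\<close> rearranges
  arguments.\<close>

lemma csq_ext_comp:
  assumes g: "morphism g" and f: "morphism f" and x: "morphism x"
  shows "csq (lift_obj g (lift_obj f x)) (lift_obj (g \<odot> f) x) (ext_comp g f) (ext_comp g f)"
proof (rule csq_bij)
  note X = morphismD[OF x] and gf = morphism_pcomp[OF g f] and fx = morphism_lift_obj[OF f x]
  note n = nat_trans_ext_comp[OF g f X(1)] and n' = nat_trans_ext_comp[OF g f X(2)]
  note m = nat_trans_pext_map[OF gf X] note m' = morphismD(3)[OF morphism_lift_obj[OF g fx], simplified]
  show "morphism (lift_obj g (lift_obj f x))" "morphism (lift_obj (g \<odot> f) x)"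
    using morphism_lift_obj[OF g fx] morphism_lift_obj[OF gf x] .
  show "nat_trans (mcod (lift_obj g (lift_obj f x))) (mcod (lift_obj (g \<odot> f) x)) (ext_comp g f)"
    "nat_trans (mdom (lift_obj g (lift_obj f x))) (mdom (lift_obj (g \<odot> f) x)) (ext_comp g f)"
    using n n' by simp_all
  fix \<Gamma> assume \<Gamma>: "\<Gamma> \<in> Obj C"
  show "inj_on (ext_comp g f \<Gamma>) (El (mcod (lift_obj g (lift_obj f x))) \<Gamma>)"
    using inj_on_ext_comp[OF g f X(2) \<Gamma>] by simp
  show "bij_betw (ext_comp g f \<Gamma>) (El (mdom (lift_obj g (lift_obj f x))) \<Gamma>) (El (mdom (lift_obj (g \<odot> f) x)) \<Gamma>)"
    using bij_betw_ext_comp[OF g f X(1) \<Gamma>] by simp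
  fix w assume "w \<in> El (mdom (lift_obj g (lift_obj f x))) \<Gamma>"
  then have w: "w \<in> El (pext g (pext f (mdom x))) \<Gamma>" by simp
  let ?w = "pext_map g (pext_map f (mmap x)) \<Gamma> w"
  note w' = nt_El[OF m' \<Gamma> w]
  have fst_eq: "fst (ext_comp g f \<Gamma> ?w) = fst (ext_comp g f \<Gamma> w)"
    unfolding fst_ext_comp pext_map_comp
    by (rule pext_map_cong[OF w]) (simp add: nt_eq_def nt_comp_def fst_pext_map)
  have "pext_map (g \<odot> f) (mmap x) \<Gamma> (ext_comp g f \<Gamma> w) = ext_comp g f \<Gamma> ?w"
  proof (rule pext_eqI[OF nt_El[OF m \<Gamma> nt_El[OF n \<Gamma> w]] nt_El[OF n' \<Gamma> w']])
    fix \<sigma> z assume "(\<sigma>, z) \<in> fib (g \<odot> f) \<Gamma> (fst (pext_map (g \<odot> f) (mmap x) \<Gamma> (ext_comp g f \<Gamma> w)))"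
    then have z: "(\<sigma>, z) \<in> fib (g \<odot> f) \<Gamma> (fst (ext_comp g f \<Gamma> w))" by (simp add: fst_pext_map)
    obtain v d b where zz: "z = (v, d, b)" by (cases z)
    note zf = z[unfolded zz] note F = ext_comp_fibD[OF g f X(1) \<Gamma> w zf]
    show "snd (pext_map (g \<odot> f) (mmap x) \<Gamma> (ext_comp g f \<Gamma> w)) (\<sigma>, z) = snd (ext_comp g f \<Gamma> ?w) (\<sigma>, z)"
      using fibD(3)[OF F(1)]
      by (simp add: zz Dom_Idn snd_pext_map_app[OF zf] snd_ext_comp_app[OF zf] snd_ext_comp_app[OF zf[folded fst_eq]]
          snd_pext_map_app[OF F(1)] snd_pext_map_app[OF F(3)])
  qed (simp add: fst_pext_map fst_eq)
  then show "mmap (lift_obj (g \<odot> f) x) \<Gamma> (ext_comp g f \<Gamma> w) = ext_comp g f \<Gamma> (mmap (lift_obj g (lift_obj f x)) \<Gamma> w)"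
    by simp
qed

lemma cartesian_lift_mult:
  assumes p: "morphism p" and \<mu>: "cartesian (p \<odot> p) p \<mu>" and f: "morphism f"
  shows "cartesian (lift_obj p (lift_obj p f)) (lift_obj p f) (lift_mult p \<mu> f)"
  unfolding lift_mult_def using csq_comp[OF csq_ext_comp[OF p p f] csq_pext_nat[OF \<mu> f]]
  by (rule cartesian_of_square)

section \<open>Horizontal composition and the constraints\<close>

text \<open>The power of 1 by any fibre is a single point, so P_t(1) is the codomain of
  \<open>t\<close> again; \<open>h\<close> inserts that point.\<close>

lemma cartesian_runit:
  fixes t :: "('o, 'm, 'b, 'a) mor"
  assumes t: "morphism t"
  shows "cartesian t (t \<odot> id_poly) (runit t)"
proof -
  define h :: "'o \<Rightarrow> 'a \<Rightarrow> ('m, 'b, 'a, unit) ext_el" where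
    "h = (\<lambda>\<Gamma> a. (a, restrict (\<lambda>_. ()) (fib t \<Gamma> a)))"
  note T = morphismD[OF t] and one = morphismD(2)[OF morphism_id_poly]
  have h_El: "h \<Gamma> a \<in> El (pext t (mcod id_poly)) \<Gamma>" if "a \<in> El (mcod t) \<Gamma>" for \<Gamma> a
    using that by (simp add: pext_iff h_def id_poly_def one_psh_def)
  have h_fst: "h \<Gamma> (fst w) = w" if "w \<in> El (pext t (mcod id_poly)) \<Gamma>" for \<Gamma> w
    by (rule pext_eqI[OF h_El[OF pextD(1)[OF that]] that]) (simp_all add: h_def)
  have h_Act: "h (Dom C \<sigma>) (Act (mcod t) \<sigma> a) = Act (pext t (mcod id_poly)) \<sigma> (h (Cod C \<sigma>) a)"
    if \<sigma>: "\<sigma> \<in> Arr C" and a: "a \<in> El (mcod t) (Cod C \<sigma>)" for \<sigma> a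
    by (rule pext_eqI[OF h_El[OF Act_El[OF T(2) \<sigma> refl a]] pext_Act_El[OF t one \<sigma> h_El[OF a]]])
      (simp_all add: fst_pext_Act, simp_all add: h_def)
  have "csq t (t \<odot> id_poly) h (\<lambda>\<Gamma> b. (h \<Gamma> (mmap t \<Gamma> b), b, ()))"
  proof (rule csqI[OF t morphism_pcomp[OF t morphism_id_poly]])
    show "nat_trans (mcod t) (mcod (t \<odot> id_poly)) h"
      using h_El h_Act by (intro nat_transI) simp_all
    show "nat_trans (mdom t) (mdom (t \<odot> id_poly)) (\<lambda>\<Gamma> b. (h \<Gamma> (mmap t \<Gamma> b), b, ()))"
    proof (rule nat_transI)
      fix \<Gamma> b assume "\<Gamma> \<in> Obj C" "b \<in> El (mdom t) \<Gamma>"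
      then show "(h \<Gamma> (mmap t \<Gamma> b), b, ()) \<in> El (mdom (t \<odot> id_poly)) \<Gamma>"
        using h_El nt_El[OF T(3)] by (simp add: comp_dom_iff) (simp add: h_def id_poly_def one_psh_def)
    next
      fix \<sigma> b assume "\<sigma> \<in> Arr C" "b \<in> El (mdom t) (Cod C \<sigma>)"
      then show "(h (Dom C \<sigma>) (mmap t (Dom C \<sigma>) (Act (mdom t) \<sigma> b)), Act (mdom t) \<sigma> b, ()) =
          Act (mdom (t \<odot> id_poly)) \<sigma> (h (Cod C \<sigma>) (mmap t (Cod C \<sigma>) b), b, ())"
        using h_Act nt_Act[OF T(3)] nt_El[OF T(3)] by (simp add: comp_dom_Act Cod_in)
    qed
    fix \<Gamma> a z assume a: "a \<in> El (mcod t) \<Gamma>" and z: "z \<in> El (mdom (t \<odot> id_poly)) \<Gamma>"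
      and eq: "mmap (t \<odot> id_poly) \<Gamma> z = h \<Gamma> a"
    obtain w d u where zz: "z = (w, d, u)" by (cases z)
    have "w = h \<Gamma> a" using eq by (simp add: zz)
    moreover have "d \<in> El (mdom t) \<Gamma>" "mmap t \<Gamma> d = fst w" using z by (simp_all add: zz comp_dom_iff)
    moreover have "fst (h \<Gamma> a) = a" by (simp add: h_def)
    ultimately show "\<exists>!b. b \<in> El (mdom t) \<Gamma> \<and> (h \<Gamma> (mmap t \<Gamma> b), b, ()) = z \<and> mmap t \<Gamma> b = a"
      by (intro ex1I[where a = d]) (auto simp: zz)
  qed simp
  then show ?thesis unfolding runit_def h_def Let_def by (rule cartesian_of_square)
qed

text \<open>Evaluation at the identity arrow recovers \<open>a\<close> from \<open>ext_id\<close>,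
  so lying over \<open>a\<close> is the same condition on \<open>b\<close> in both domains.\<close>

lemma cartesian_lunit:
  assumes t: "morphism t"
  shows "cartesian t (id_poly \<odot> t) (lunit t)"
proof -
  note T = morphismD[OF t] note n = nat_trans_ext_id[OF T(2)]
  have at: "snd (ext_id (mcod t) \<Gamma> a) (Idn C \<Gamma>, u) = a" if "\<Gamma> \<in> Obj C" "a \<in> El (mcod t) \<Gamma>" for \<Gamma> a u
    using that by (simp add: snd_ext_id Idn_in Cod_Idn Act_Idn[OF T(2)])
  have "csq t (id_poly \<odot> t) (ext_id (mcod t)) (\<lambda>\<Gamma> b. (ext_id (mcod t) \<Gamma> (mmap t \<Gamma> b), (), b))"
  proof (rule csqI[OF t morphism_pcomp[OF morphism_id_poly t]])
    show "nat_trans (mcod t) (mcod (id_poly \<odot> t)) (ext_id (mcod t))" using n by simp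
    show "nat_trans (mdom t) (mdom (id_poly \<odot> t)) (\<lambda>\<Gamma> b. (ext_id (mcod t) \<Gamma> (mmap t \<Gamma> b), (), b))"
    proof (rule nat_transI)
      fix \<Gamma> b assume \<Gamma>: "\<Gamma> \<in> Obj C" and b: "b \<in> El (mdom t) \<Gamma>"
      then show "(ext_id (mcod t) \<Gamma> (mmap t \<Gamma> b), (), b) \<in> El (mdom (id_poly \<odot> t)) \<Gamma>"
        using nt_El[OF n \<Gamma> nt_El[OF T(3) \<Gamma> b]] at[OF \<Gamma> nt_El[OF T(3) \<Gamma> b]]
        by (simp add: comp_dom_iff) (simp add: id_poly_def one_psh_def)
    next
      fix \<sigma> b assume \<sigma>: "\<sigma> \<in> Arr C" and b: "b \<in> El (mdom t) (Cod C \<sigma>)"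
      show "(ext_id (mcod t) (Dom C \<sigma>) (mmap t (Dom C \<sigma>) (Act (mdom t) \<sigma> b)), (), Act (mdom t) \<sigma> b) =
          Act (mdom (id_poly \<odot> t)) \<sigma> (ext_id (mcod t) (Cod C \<sigma>) (mmap t (Cod C \<sigma>) b), (), b)"
        using nt_Act[OF n \<sigma> refl] nt_Act[OF T(3) \<sigma> refl b] nt_El[OF T(3) Cod_in[OF \<sigma>] b]
        by (simp add: comp_dom_Act)
    qed
    fix \<Gamma> a z assume \<Gamma>: "\<Gamma> \<in> Obj C" and a: "a \<in> El (mcod t) \<Gamma>" and z: "z \<in> El (mdom (id_poly \<odot> t)) \<Gamma>"
      and eq: "mmap (id_poly \<odot> t) \<Gamma> z = ext_id (mcod t) \<Gamma> a"
    obtain w u b where zz: "z = (w, u, b)" by (cases z)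
    have w: "w = ext_id (mcod t) \<Gamma> a" using eq by (simp add: zz)
    have "b \<in> El (mdom t) \<Gamma>" "mmap t \<Gamma> b = a" using z at[OF \<Gamma> a] by (simp_all add: zz w comp_dom_iff)
    then show "\<exists>!b. b \<in> El (mdom t) \<Gamma> \<and> (ext_id (mcod t) \<Gamma> (mmap t \<Gamma> b), (), b) = z \<and> mmap t \<Gamma> b = a"
      by (intro ex1I[where a = b]) (auto simp: zz w)
  qed simp
  then show ?thesis unfolding lunit_def by (rule cartesian_of_square)
qed

text \<open>Both domains consist of a nested family with matching \<open>z\<close>, \<open>d\<close>
  and \<open>b\<close>. Rebracketing loses nothing, because the one component it drops,
  \<open>v\<close>, is forced to be the value of \<open>w\<close> at \<open>z\<close>.\<close>

lemma cartesian_assoc: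
  assumes h: "morphism h" and g: "morphism g" and f: "morphism f"
  shows "cartesian (h \<odot> g \<odot> f) ((h \<odot> g) \<odot> f) (assoc h g f)"
proof -
  note F = morphismD[OF f] and hg = morphism_pcomp[OF h g] and gf = morphism_pcomp[OF g f]
  note n = nat_trans_ext_comp[OF h g F(2)]
  define k where "k = proj (assoc h g f)"
  have k: "assoc h g f = of_square (h \<odot> g \<odot> f) ((h \<odot> g) \<odot> f) (ext_comp h g) k"
    by (simp add: k_def assoc_def of_square_def)
  have k_app: "k \<Gamma> (w, z, (v, d, b)) = (ext_comp h g \<Gamma> w, (fst (ext_comp h g \<Gamma> w), z, d), b)" for \<Gamma> w z v d b
    by (simp add: k_def assoc_def of_square_def Let_def)
  \<comment> \<open>A tuple lies in the source exactly if \<open>v\<close> has its forced value and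
    the rebracketed tuple lies in the target; lifts through the square can then be read off.\<close>
  have mem: "(w, z, (v, d, b)) \<in> El (comp_dom h (g \<odot> f)) \<Gamma> \<longleftrightarrow>
      w \<in> El (pext h (pext g (mcod f))) \<Gamma> \<and> v = snd w (Idn C \<Gamma>, z) \<and>
      (ext_comp h g \<Gamma> w, (fst (ext_comp h g \<Gamma> w), z, d), b) \<in> El (comp_dom (h \<odot> g) f) \<Gamma>"
    if \<Gamma>: "\<Gamma> \<in> Obj C" for \<Gamma> w z v d b
  proof (cases "w \<in> El (pext h (pext g (mcod f))) \<Gamma> \<and> z \<in> El (mdom h) \<Gamma> \<and> mmap h \<Gamma> z = fst w")
    case True
    then have w: "w \<in> El (pext h (pext g (mcod f))) \<Gamma>" and z: "z \<in> El (mdom h) \<Gamma>" "mmap h \<Gamma> z = fst w" by auto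
    note iz = fib_Idn[OF h \<Gamma> z] note u = fst_ext_comp_El[OF h g F(2) \<Gamma> w]
    have wz: "snd w (Idn C \<Gamma>, z) \<in> El (pext g (mcod f)) \<Gamma>"
      using pextD(3)[OF w iz] \<Gamma> by (simp add: Dom_Idn)
    have fst_u: "fst (fst (ext_comp h g \<Gamma> w)) = fst w" by (simp add: fst_ext_comp fst_pext_map)
    have snd_u: "snd (fst (ext_comp h g \<Gamma> w)) (Idn C \<Gamma>, z) = fst (snd w (Idn C \<Gamma>, z))"
      using iz by (simp add: fst_ext_comp snd_pext_map_app)
    have snd_e: "snd (ext_comp h g \<Gamma> w) (Idn C \<Gamma>, fst (ext_comp h g \<Gamma> w), z, d) =
        snd (snd w (Idn C \<Gamma>, z)) (Idn C \<Gamma>, d)"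
      if d: "d \<in> El (mdom g) \<Gamma>" "mmap g \<Gamma> d = fst (snd w (Idn C \<Gamma>, z))"
    proof -
      have "(fst (ext_comp h g \<Gamma> w), z, d) \<in> El (mdom (h \<odot> g)) \<Gamma>"
        using u z d fst_u snd_u by (simp add: comp_dom_iff)
      then have "(Idn C \<Gamma>, fst (ext_comp h g \<Gamma> w), z, d) \<in> fib (h \<odot> g) \<Gamma> (fst (ext_comp h g \<Gamma> w))"
        by (intro fib_Idn[OF hg \<Gamma>]) simp_all
      then show ?thesis using \<Gamma> by (simp add: snd_ext_comp_app Dom_Idn)
    qed
    show ?thesis
      using w z wz u fst_u snd_u snd_e nt_El[OF n \<Gamma> w] by (auto simp: comp_dom_iff)
  next
    case False
    then show ?thesis by (auto simp: comp_dom_iff fst_ext_comp fst_pext_map)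
  qed
  have "csq (h \<odot> g \<odot> f) ((h \<odot> g) \<odot> f) (ext_comp h g) k"
  proof (rule csqI[OF morphism_pcomp[OF h gf] morphism_pcomp[OF hg f]])
    show "nat_trans (mcod (h \<odot> g \<odot> f)) (mcod ((h \<odot> g) \<odot> f)) (ext_comp h g)" using n by simp
    show "nat_trans (mdom (h \<odot> g \<odot> f)) (mdom ((h \<odot> g) \<odot> f)) k"
    proof (rule nat_transI)
      fix \<Gamma> x assume \<Gamma>: "\<Gamma> \<in> Obj C" and x: "x \<in> El (mdom (h \<odot> g \<odot> f)) \<Gamma>"
      obtain w z v d b where xx: "x = (w, z, (v, d, b))" by (metis prod.exhaust)
      show "k \<Gamma> x \<in> El (mdom ((h \<odot> g) \<odot> f)) \<Gamma>" using x mem[OF \<Gamma>] by (simp add: xx k_app)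
    next
      fix \<sigma> x assume \<sigma>: "\<sigma> \<in> Arr C" and x: "x \<in> El (mdom (h \<odot> g \<odot> f)) (Cod C \<sigma>)"
      obtain w z v d b where xx: "x = (w, z, (v, d, b))" by (metis prod.exhaust)
      have w: "w \<in> El (pext h (pext g (mcod f))) (Cod C \<sigma>)" using x by (simp add: xx comp_dom_iff)
      show "k (Dom C \<sigma>) (Act (mdom (h \<odot> g \<odot> f)) \<sigma> x) = Act (mdom ((h \<odot> g) \<odot> f)) \<sigma> (k (Cod C \<sigma>) x)"
        using nt_Act[OF n \<sigma> refl w] by (simp add: xx k_app comp_dom_Act fst_pext_Act)
    qed
    show "mmap ((h \<odot> g) \<odot> f) \<Gamma> (k \<Gamma> x) = ext_comp h g \<Gamma> (mmap (h \<odot> g \<odot> f) \<Gamma> x)" for \<Gamma> x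
      by (metis (no_types, lifting) fst_conv k_app pcomp_simps(3) prod.exhaust)
    fix \<Gamma> w y assume \<Gamma>: "\<Gamma> \<in> Obj C" and w: "w \<in> El (mcod (h \<odot> g \<odot> f)) \<Gamma>"
      and y: "y \<in> El (mdom ((h \<odot> g) \<odot> f)) \<Gamma>" and eq: "mmap ((h \<odot> g) \<odot> f) \<Gamma> y = ext_comp h g \<Gamma> w"
    obtain e v z d b where "y = (e, (v, z, d), b)" by (metis prod.exhaust)
    moreover from this have "e = ext_comp h g \<Gamma> w" "v = fst e" using eq y by (simp_all add: comp_dom_iff)
    ultimately have yy: "y = (ext_comp h g \<Gamma> w, (fst (ext_comp h g \<Gamma> w), z, d), b)" by simp
    show "\<exists>!x. x \<in> El (mdom (h \<odot> g \<odot> f)) \<Gamma> \<and> k \<Gamma> x = y \<and> mmap (h \<odot> g \<odot> f) \<Gamma> x = w"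
    proof (rule ex1I[where a = "(w, z, (snd w (Idn C \<Gamma>, z), d, b))"])
      show "(w, z, (snd w (Idn C \<Gamma>, z), d, b)) \<in> El (mdom (h \<odot> g \<odot> f)) \<Gamma> \<and>
          k \<Gamma> (w, z, (snd w (Idn C \<Gamma>, z), d, b)) = y \<and> mmap (h \<odot> g \<odot> f) \<Gamma> (w, z, (snd w (Idn C \<Gamma>, z), d, b)) = w"
        using w y mem[OF \<Gamma>] by (simp add: yy k_app)
      fix x assume x: "x \<in> El (mdom (h \<odot> g \<odot> f)) \<Gamma> \<and> k \<Gamma> x = y \<and> mmap (h \<odot> g \<odot> f) \<Gamma> x = w"
      obtain w' z' v' d' b' where xx: "x = (w', z', (v', d', b'))" by (metis prod.exhaust)
      show "x = (w, z, (snd w (Idn C \<Gamma>, z), d, b))"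
        using x mem[OF \<Gamma>] by (simp add: xx yy k_app)
    qed
  qed
  then show ?thesis unfolding k by (rule cartesian_of_square)
qed

text \<open>The underlying square acts by componentwise \<open>top_map\<close> on \<open>d\<close>
  and \<open>b\<close>. A lift finds \<open>d\<close> through the square of \<psi> first, because
  the base of \<open>b\<close> is the value of \<open>w\<close> at \<open>d\<close>; the square of
  \<phi> then gives \<open>b\<close>.\<close>

lemma cartesian_hcomp:
  assumes \<psi>: "cartesian g g' \<psi>" and \<phi>: "cartesian f f' \<phi>"
  shows "cartesian (g \<odot> f) (g' \<odot> f') (\<psi> \<star> \<phi>)"
proof -
  note D = cartesianD[OF \<psi>] and E = cartesianD[OF \<phi>]
  note P = csqD[OF cartesian_csq[OF \<psi>]] and Q = csqD[OF cartesian_csq[OF \<phi>]]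
  note G = morphismD[OF D(3)] and G' = morphismD[OF D(4)] and F = morphismD[OF E(3)] and F' = morphismD[OF E(4)]
  define h where "h = nt_comp (pext_nat \<psi>) (pext_map g (base \<phi>))"
  define k where "k = (\<lambda>\<Gamma> (w, d, b). (h \<Gamma> w, top_map \<psi> \<Gamma> d, top_map \<phi> \<Gamma> b))"
  have k_app: "k \<Gamma> (w, d, b) = (h \<Gamma> w, top_map \<psi> \<Gamma> d, top_map \<phi> \<Gamma> b)" for \<Gamma> w d b by (simp add: k_def)
  have h: "nat_trans (pext g (mcod f)) (pext g' (mcod f')) h"
    unfolding h_def
    by (rule nat_trans_comp[OF nat_trans_pext_map[OF D(3) F(2) F'(2) E(6)] nat_trans_pext_nat[OF \<psi> F'(2)]])
  have fst_h: "fst (h \<Gamma> w) = base \<psi> \<Gamma> (fst w)" for \<Gamma> w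
    by (simp add: h_def nt_comp_def fst_pext_nat fst_pext_map)
  \<comment> \<open>Evaluation is preserved: P_\<psi> undoes the passage from \<open>d\<close> to
    its top value, which leaves \<open>base \<phi>\<close> applied to the old value.\<close>
  have snd_h: "snd (h \<Gamma> w) (Idn C \<Gamma>, top_map \<psi> \<Gamma> d) = base \<phi> \<Gamma> (snd w (Idn C \<Gamma>, d))"
    if \<Gamma>: "\<Gamma> \<in> Obj C" and w: "w \<in> El (pext g (mcod f)) \<Gamma>" and d: "d \<in> El (mdom g) \<Gamma>" "mmap g \<Gamma> d = fst w" for \<Gamma> w d
  proof -
    have i: "(Idn C \<Gamma>, d) \<in> fib g \<Gamma> (fst w)" by (rule fib_Idn[OF D(3) \<Gamma> d])
    then show ?thesis
      using snd_pext_nat_app[OF \<psi>, of "pext_map g (base \<phi>) \<Gamma> w" \<Gamma> "Idn C \<Gamma>" d] pextD(1)[OF w] \<Gamma>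
      by (simp add: h_def nt_comp_def fst_pext_map snd_pext_map_app Dom_Idn)
  qed
  have sq: "csq (g \<odot> f) (g' \<odot> f') h k"
  proof (rule csqI[OF morphism_pcomp[OF D(3) E(3)] morphism_pcomp[OF D(4) E(4)]])
    show "nat_trans (mcod (g \<odot> f)) (mcod (g' \<odot> f')) h" using h by simp
    show "nat_trans (mdom (g \<odot> f)) (mdom (g' \<odot> f')) k"
    proof (rule nat_transI)
      fix \<Gamma> z assume \<Gamma>: "\<Gamma> \<in> Obj C" and z: "z \<in> El (mdom (g \<odot> f)) \<Gamma>"
      obtain w d b where zz: "z = (w, d, b)" by (cases z)
      have "w \<in> El (pext g (mcod f)) \<Gamma>" "d \<in> El (mdom g) \<Gamma>" "mmap g \<Gamma> d = fst w"
        "b \<in> El (mdom f) \<Gamma>" "mmap f \<Gamma> b = snd w (Idn C \<Gamma>, d)" using z by (simp_all add: zz comp_dom_iff)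
      then show "k \<Gamma> z \<in> El (mdom (g' \<odot> f')) \<Gamma>"
        using nt_El[OF h \<Gamma>] nt_El[OF P(4) \<Gamma>] nt_El[OF Q(4) \<Gamma>] P(5)[OF \<Gamma>] Q(5)[OF \<Gamma>] fst_h snd_h[OF \<Gamma>]
        by (simp add: zz k_app comp_dom_iff)
    next
      fix \<sigma> z assume \<sigma>: "\<sigma> \<in> Arr C" and z: "z \<in> El (mdom (g \<odot> f)) (Cod C \<sigma>)"
      obtain w d b where zz: "z = (w, d, b)" by (cases z)
      have "w \<in> El (pext g (mcod f)) (Cod C \<sigma>)" "d \<in> El (mdom g) (Cod C \<sigma>)" "b \<in> El (mdom f) (Cod C \<sigma>)"
        using z by (simp_all add: zz comp_dom_iff)
      then show "k (Dom C \<sigma>) (Act (mdom (g \<odot> f)) \<sigma> z) = Act (mdom (g' \<odot> f')) \<sigma> (k (Cod C \<sigma>) z)"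
        using nt_Act[OF h \<sigma> refl] nt_Act[OF P(4) \<sigma> refl] nt_Act[OF Q(4) \<sigma> refl] by (simp add: zz k_app comp_dom_Act)
    qed
    show "mmap (g' \<odot> f') \<Gamma> (k \<Gamma> z) = h \<Gamma> (mmap (g \<odot> f) \<Gamma> z)" for \<Gamma> z
      by (cases z) (simp add: k_app)
    fix \<Gamma> w y assume \<Gamma>: "\<Gamma> \<in> Obj C" and "w \<in> El (mcod (g \<odot> f)) \<Gamma>" and y: "y \<in> El (mdom (g' \<odot> f')) \<Gamma>"
      and eq: "mmap (g' \<odot> f') \<Gamma> y = h \<Gamma> w"
    then have w: "w \<in> El (pext g (mcod f)) \<Gamma>" by simp
    obtain w' d' b' where yy': "y = (w', d', b')" by (cases y)
    have yy: "y = (h \<Gamma> w, d', b')" using eq yy' by simp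
    have d': "d' \<in> El (mdom g') \<Gamma>" "mmap g' \<Gamma> d' = base \<psi> \<Gamma> (fst w)"
      and b': "b' \<in> El (mdom f') \<Gamma>" "mmap f' \<Gamma> b' = snd (h \<Gamma> w) (Idn C \<Gamma>, d')"
      using y by (simp_all add: yy comp_dom_iff fst_h)
    from P(6)[OF \<Gamma> pextD(1)[OF w] d'] obtain d where d: "d \<in> El (mdom g) \<Gamma>" "top_map \<psi> \<Gamma> d = d'" "mmap g \<Gamma> d = fst w"
      and du: "\<And>e. \<lbrakk>e \<in> El (mdom g) \<Gamma>; top_map \<psi> \<Gamma> e = d'; mmap g \<Gamma> e = fst w\<rbrakk> \<Longrightarrow> e = d" by metis
    have i: "(Idn C \<Gamma>, d) \<in> fib g \<Gamma> (fst w)" by (rule fib_Idn[OF D(3) \<Gamma> d(1,3)])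
    have wd: "snd w (Idn C \<Gamma>, d) \<in> El (mcod f) \<Gamma>" using pextD(3)[OF w i] \<Gamma> by (simp add: Dom_Idn)
    have "mmap f' \<Gamma> b' = base \<phi> \<Gamma> (snd w (Idn C \<Gamma>, d))" using snd_h[OF \<Gamma> w d(1,3)] b' d(2) by simp
    from Q(6)[OF \<Gamma> wd b'(1) this] obtain b where
      b: "b \<in> El (mdom f) \<Gamma>" "top_map \<phi> \<Gamma> b = b'" "mmap f \<Gamma> b = snd w (Idn C \<Gamma>, d)"
      and bu: "\<And>e. \<lbrakk>e \<in> El (mdom f) \<Gamma>; top_map \<phi> \<Gamma> e = b'; mmap f \<Gamma> e = snd w (Idn C \<Gamma>, d)\<rbrakk> \<Longrightarrow> e = b" by metis
    show "\<exists>!z. z \<in> El (mdom (g \<odot> f)) \<Gamma> \<and> k \<Gamma> z = y \<and> mmap (g \<odot> f) \<Gamma> z = w"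
    proof (rule ex1I[where a = "(w, d, b)"])
      show "(w, d, b) \<in> El (mdom (g \<odot> f)) \<Gamma> \<and> k \<Gamma> (w, d, b) = y \<and> mmap (g \<odot> f) \<Gamma> (w, d, b) = w"
        using w d b by (simp add: comp_dom_iff k_app yy)
      fix z assume z: "z \<in> El (mdom (g \<odot> f)) \<Gamma> \<and> k \<Gamma> z = y \<and> mmap (g \<odot> f) \<Gamma> z = w"
      obtain w1 d1 b1 where zz: "z = (w1, d1, b1)" by (cases z)
      have w1: "w1 = w" using z by (simp add: zz)
      have d1: "d1 = d" using z by (intro du) (simp_all add: zz w1 comp_dom_iff k_app yy)
      have "b1 = b" using z by (intro bu) (simp_all add: zz w1 d1 comp_dom_iff k_app yy)
      then show "z = (w, d, b)" by (simp add: zz w1 d1)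
    qed
  qed
  have hc: "src (\<psi> \<star> \<phi>) = g \<odot> f" "tgt (\<psi> \<star> \<phi>) = g' \<odot> f'" "base (\<psi> \<star> \<phi>) = h"
    "proj (\<psi> \<star> \<phi>) = (\<lambda>\<Gamma> (w, e, x). (h \<Gamma> w, proj \<psi> \<Gamma> e, proj \<phi> \<Gamma> x))"
    "bwd (\<psi> \<star> \<phi>) = (\<lambda>\<Gamma> (w, e, x). (w, bwd \<psi> \<Gamma> e, bwd \<phi> \<Gamma> x))"
    by (simp_all add: hcomp_def Let_def D E h_def)
  \<comment> \<open>Apart from the apexes of the factors, membership depends only on the backward
    image, so bijectivity of the composite \<open>bwd\<close> is inherited componentwise.\<close>
  have ap: "(w, e, x) \<in> El (apex (\<psi> \<star> \<phi>)) \<Gamma> \<longleftrightarrow> e \<in> El (apex \<psi>) \<Gamma> \<and> x \<in> El (apex \<phi>) \<Gamma> \<and>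
      (w, bwd \<psi> \<Gamma> e, bwd \<phi> \<Gamma> x) \<in> El (comp_dom g f) \<Gamma>" if "\<Gamma> \<in> Obj C" for \<Gamma> w e x
    using nt_El[OF D(8) that] nt_El[OF E(8) that] by (auto simp: hcomp_def Let_def D E comp_dom_iff)
  have act: "Act (apex (\<psi> \<star> \<phi>)) \<sigma> (w, e, x) = (Act (pext g (mcod f)) \<sigma> w, Act (apex \<psi>) \<sigma> e, Act (apex \<phi>) \<sigma> x)" for \<sigma> w e x
    by (simp add: hcomp_def Let_def D E)
  note cd = morphismD(1)[OF morphism_pcomp[OF D(3) E(3)], simplified]
  have b_nat: "bwd (\<psi> \<star> \<phi>) (Dom C \<sigma>) (Act (apex (\<psi> \<star> \<phi>)) \<sigma> z) = Act (comp_dom g f) \<sigma> (bwd (\<psi> \<star> \<phi>) (Cod C \<sigma>) z)"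
    if "\<sigma> \<in> Arr C" "z \<in> El (apex (\<psi> \<star> \<phi>)) (Cod C \<sigma>)" for \<sigma> z
  proof -
    obtain w e x where zz: "z = (w, e, x)" by (cases z)
    then show ?thesis
      using that ap[OF Cod_in[OF that(1)]] nt_Act[OF D(8) that(1) refl] nt_Act[OF E(8) that(1) refl]
      by (simp add: hc act comp_dom_Act)
  qed
  show ?thesis
  proof (rule cartesianI[OF hc(1,2)])
    show "csq (g \<odot> f) (g' \<odot> f') (base (\<psi> \<star> \<phi>)) k" using sq by (simp add: hc)
    \<comment> \<open>Since membership is read through \<open>bwd\<close>, closure follows from
      \<open>b_nat\<close> and the closure of \<open>comp_dom g f\<close> under restriction.\<close>
    have closed: "Act (apex (\<psi> \<star> \<phi>)) \<sigma> z \<in> El (apex (\<psi> \<star> \<phi>)) (Dom C \<sigma>)"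
      if \<sigma>: "\<sigma> \<in> Arr C" and z: "z \<in> El (apex (\<psi> \<star> \<phi>)) (Cod C \<sigma>)" for \<sigma> z
    proof -
      obtain w e x where zz: "z = (w, e, x)" by (cases z)
      have "bwd (\<psi> \<star> \<phi>) (Cod C \<sigma>) z \<in> El (comp_dom g f) (Cod C \<sigma>)"
        using z ap[OF Cod_in[OF \<sigma>]] by (simp add: zz hc)
      from Act_El[OF cd \<sigma> refl this] b_nat[OF \<sigma> z] show ?thesis
        using z ap[OF Cod_in[OF \<sigma>]] Act_El[OF D(5) \<sigma> refl] Act_El[OF E(5) \<sigma> refl]
        by (simp add: zz act ap[OF Dom_in[OF \<sigma>]] hc)
    qed
    note pgf = presheaf_pext[OF D(3) F(2)]
    show "presheaf (apex (\<psi> \<star> \<phi>))"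
    proof (rule presheafI)
      fix \<Gamma> z assume "\<Gamma> \<in> Obj C" "z \<in> El (apex (\<psi> \<star> \<phi>)) \<Gamma>"
      then show "Act (apex (\<psi> \<star> \<phi>)) (Idn C \<Gamma>) z = z"
        using Act_Idn[OF pgf] Act_Idn[OF D(5)] Act_Idn[OF E(5)]
        by (cases z) (simp add: ap act comp_dom_iff)
    next
      fix \<sigma> \<tau> z assume "\<sigma> \<in> Arr C" "\<tau> \<in> Arr C" "Cod C \<tau> = Dom C \<sigma>" "z \<in> El (apex (\<psi> \<star> \<phi>)) (Cod C \<sigma>)"
      then show "Act (apex (\<psi> \<star> \<phi>)) (Cmp C \<sigma> \<tau>) z = Act (apex (\<psi> \<star> \<phi>)) \<tau> (Act (apex (\<psi> \<star> \<phi>)) \<sigma> z)"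
        using Act_Cmp[OF pgf] Act_Cmp[OF D(5)] Act_Cmp[OF E(5)]
        by (cases z) (simp add: ap act comp_dom_iff Cod_in)
    qed (rule closed)
    show "nat_trans (apex (\<psi> \<star> \<phi>)) (mdom (g \<odot> f)) (bwd (\<psi> \<star> \<phi>))"
      using ap b_nat by (intro nat_transI) (auto simp: hc)
    fix \<Gamma> assume \<Gamma>: "\<Gamma> \<in> Obj C"
    show "proj (\<psi> \<star> \<phi>) \<Gamma> z = k \<Gamma> (bwd (\<psi> \<star> \<phi>) \<Gamma> z)" if "z \<in> El (apex (\<psi> \<star> \<phi>)) \<Gamma>" for z
      using that top_map_bwd[OF \<psi> \<Gamma>] top_map_bwd[OF \<phi> \<Gamma>] by (cases z) (simp add: ap[OF \<Gamma>] hc k_app)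
    fix y assume y: "y \<in> El (mdom (g \<odot> f)) \<Gamma>"
    obtain w d b where yy: "y = (w, d, b)" by (cases y)
    have "d \<in> El (mdom g) \<Gamma>" "b \<in> El (mdom f) \<Gamma>" using y by (simp_all add: yy comp_dom_iff)
    then obtain e x where e: "e \<in> El (apex \<psi>) \<Gamma>" "bwd \<psi> \<Gamma> e = d" and x: "x \<in> El (apex \<phi>) \<Gamma>" "bwd \<phi> \<Gamma> x = b"
      using cartesian_bij[OF \<psi> \<Gamma>] cartesian_bij[OF \<phi> \<Gamma>] by metis
    show "\<exists>!z. z \<in> El (apex (\<psi> \<star> \<phi>)) \<Gamma> \<and> bwd (\<psi> \<star> \<phi>) \<Gamma> z = y"
    proof (rule ex1I[where a = "(w, e, x)"])
      show "(w, e, x) \<in> El (apex (\<psi> \<star> \<phi>)) \<Gamma> \<and> bwd (\<psi> \<star> \<phi>) \<Gamma> (w, e, x) = y"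
        using e x y by (simp add: ap[OF \<Gamma>] hc yy)
      fix z assume z: "z \<in> El (apex (\<psi> \<star> \<phi>)) \<Gamma> \<and> bwd (\<psi> \<star> \<phi>) \<Gamma> z = y"
      obtain w1 e1 x1 where zz: "z = (w1, e1, x1)" by (cases z)
      have "e1 = e" by (rule cartesian_inj[OF \<psi> \<Gamma>]) (use z e in \<open>simp_all add: zz ap[OF \<Gamma>] hc yy\<close>)
      moreover have "x1 = x" by (rule cartesian_inj[OF \<phi> \<Gamma>]) (use z x in \<open>simp_all add: zz ap[OF \<Gamma>] hc yy\<close>)
      ultimately show "z = (w, e, x)" using z by (simp add: zz hc yy)
    qed
  qed
qed

section \<open>Adjustments between cartesian morphisms\<close>

text \<open>The condition on an adjustment without naturality. It is stable under composition and
  whiskering of cartesian morphisms and still strong enough for uniqueness.\<close>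

definition over ::
  "('o, 'm, 'b, 'a, 'd, 'c, 'e1) pmor \<Rightarrow> ('o, 'm, 'b, 'a, 'd, 'c, 'e2) pmor \<Rightarrow> ('o \<Rightarrow> 'e1 \<Rightarrow> 'e2) \<Rightarrow> bool" where
  "over \<phi> \<psi> \<alpha> \<longleftrightarrow> (\<forall>\<Gamma>\<in>Obj C. \<forall>x\<in>El (apex \<phi>) \<Gamma>. \<alpha> \<Gamma> x \<in> El (apex \<psi>) \<Gamma> \<and> bwd \<psi> \<Gamma> (\<alpha> \<Gamma> x) = bwd \<phi> \<Gamma> x)"

lemma overD:
  assumes "over \<phi> \<psi> \<alpha>" "\<Gamma> \<in> Obj C" "x \<in> El (apex \<phi>) \<Gamma>"
  shows "\<alpha> \<Gamma> x \<in> El (apex \<psi>) \<Gamma>" "bwd \<psi> \<Gamma> (\<alpha> \<Gamma> x) = bwd \<phi> \<Gamma> x"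
  using assms unfolding over_def by blast+

text \<open>Both maps have the same image under the injective \<open>bwd\<close> of the target. All
  coherence equations of pseudomonads and pseudoalgebras are instances.\<close>

lemma over_unique:
  assumes "over \<phi> \<psi> \<alpha>" "over \<phi> \<psi> \<beta>" "cartesian f g \<psi>"
  shows "nt_eq (apex \<phi>) \<alpha> \<beta>"
  unfolding nt_eq_def using overD[OF assms(1)] overD[OF assms(2)]
  by (auto intro: cartesian_inj[OF assms(3)])

lemma over_comp: "\<lbrakk>over \<phi> \<psi> \<alpha>; over \<psi> \<chi> \<beta>\<rbrakk> \<Longrightarrow> over \<phi> \<chi> (nt_comp \<beta> \<alpha>)"
  unfolding over_def nt_comp_def by simp

lemma over_coh:
  assumes \<phi>: "cartesian f g \<phi>" and \<psi>: "cartesian f g \<psi>"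
  shows "over \<phi> \<psi> (coh \<phi> \<psi>)"
  unfolding over_def
proof (intro ballI)
  fix \<Gamma> x assume "\<Gamma> \<in> Obj C" "x \<in> El (apex \<phi>) \<Gamma>"
  then have "\<exists>!y. y \<in> El (apex \<psi>) \<Gamma> \<and> bwd \<psi> \<Gamma> y = bwd \<phi> \<Gamma> x"
    using cartesian_bij[OF \<psi>] nt_El[OF cartesianD(8)[OF \<phi>]] by blast
  from theI'[OF this]
  show "coh \<phi> \<psi> \<Gamma> x \<in> El (apex \<psi>) \<Gamma> \<and> bwd \<psi> \<Gamma> (coh \<phi> \<psi> \<Gamma> x) = bwd \<phi> \<Gamma> x" unfolding coh_def .
qed

lemma over_pre: "over \<psi> \<psi>' \<alpha> \<Longrightarrow> over (\<psi> \<bullet> \<phi>) (\<psi>' \<bullet> \<phi>) (pre \<alpha>)"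
  unfolding over_def vcomp_def pre_def by auto

text \<open>The second component exists because \<open>bwd \<psi>\<close> is bijective. The backward
  map of a vertical composite sees only the first component, where \<alpha> respects it.\<close>

lemma over_post:
  assumes \<psi>: "cartesian g h \<psi>" and \<phi>': "cartesian f g \<phi>'" and \<alpha>: "over \<phi> \<phi>' \<alpha>"
  shows "over (\<psi> \<bullet> \<phi>) (\<psi> \<bullet> \<phi>') (post \<psi> \<phi>' \<alpha>)"
  unfolding over_def
proof (intro ballI)
  fix \<Gamma> z assume \<Gamma>: "\<Gamma> \<in> Obj C" and "z \<in> El (apex (\<psi> \<bullet> \<phi>)) \<Gamma>"
  then obtain x y where z: "z = (x, y)" "x \<in> El (apex \<phi>) \<Gamma>" by (auto simp: vcomp_def)
  note x = overD[OF \<alpha> \<Gamma> z(2)]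
  have "\<exists>!y'. y' \<in> El (apex \<psi>) \<Gamma> \<and> bwd \<psi> \<Gamma> y' = proj \<phi>' \<Gamma> (\<alpha> \<Gamma> x)"
    using cartesian_bij[OF \<psi> \<Gamma> nt_El[OF cartesianD(7)[OF \<phi>'] \<Gamma> x(1)]] .
  from theI'[OF this]
  show "post \<psi> \<phi>' \<alpha> \<Gamma> z \<in> El (apex (\<psi> \<bullet> \<phi>')) \<Gamma> \<and> bwd (\<psi> \<bullet> \<phi>') \<Gamma> (post \<psi> \<phi>' \<alpha> \<Gamma> z) = bwd (\<psi> \<bullet> \<phi>) \<Gamma> z"
    using x by (simp add: z vcomp_def post_def)
qed

text \<open>The apex of a horizontal composite constrains its last component \<open>x\<close> only
  by membership in the apex of \<phi> and by \<open>bwd \<phi> \<Gamma> x\<close>, and \<alpha>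
  respects both.\<close>

lemma over_hleft:
  assumes "cartesian f g \<phi>" "cartesian f g \<phi>'" "over \<phi> \<phi>' \<alpha>"
  shows "over (\<chi> \<star> \<phi>) (\<chi> \<star> \<phi>') (hleft \<alpha>)"
  using overD[OF assms(3)] cartesianD(1)[OF assms(1)] cartesianD(1)[OF assms(2)]
  unfolding over_def by (auto simp: hcomp_def Let_def hleft_def)

lemma over_hright:
  assumes "cartesian f g \<psi>" "cartesian f g \<psi>'" "over \<psi> \<psi>' \<alpha>"
  shows "over (\<psi> \<star> \<chi>) (\<psi>' \<star> \<chi>) (hright \<alpha>)"
  using overD[OF assms(3)] cartesianD(1)[OF assms(1)] cartesianD(1)[OF assms(2)]
  unfolding over_def by (auto simp: hcomp_def Let_def hright_def)

text \<open>Applying \<alpha> to the values of a natural family must give a natural family again,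
  hence the naturality assumption on top of \<open>over\<close>.\<close>

lemma over_lift_mor:
  assumes p: "morphism p" and \<phi>: "cartesian f g \<phi>" and \<psi>: "cartesian f g \<psi>"
    and n: "nat_trans (apex \<phi>) (apex \<psi>) \<alpha>" and \<alpha>: "over \<phi> \<psi> \<alpha>"
  shows "over (lift_mor p \<phi>) (lift_mor p \<psi>) (pext_map p \<alpha>)"
  unfolding over_def
proof (intro ballI conjI)
  fix \<Gamma> w assume \<Gamma>: "\<Gamma> \<in> Obj C" and "w \<in> El (apex (lift_mor p \<phi>)) \<Gamma>"
  then have w: "w \<in> El (pext p (apex \<phi>)) \<Gamma>" by (simp add: lift_mor_def)
  show "pext_map p \<alpha> \<Gamma> w \<in> El (apex (lift_mor p \<psi>)) \<Gamma>"
    using nt_El[OF nat_trans_pext_map[OF p cartesianD(5)[OF \<phi>] cartesianD(5)[OF \<psi>] n] \<Gamma> w]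
    by (simp add: lift_mor_def)
  have "nt_eq (apex \<phi>) (nt_comp (bwd \<psi>) \<alpha>) (bwd \<phi>)"
    using overD[OF \<alpha>] by (simp add: nt_eq_def nt_comp_def)
  from pext_map_cong[OF w this]
  show "bwd (lift_mor p \<psi>) \<Gamma> (pext_map p \<alpha> \<Gamma> w) = bwd (lift_mor p \<phi>) \<Gamma> w"
    by (simp add: lift_mor_def pext_map_comp)
qed

section \<open>Existence of invertible adjustments\<close>

lemma adjustmentD:
  assumes "inv_adjustment \<phi> \<psi> \<alpha>"
  shows "over \<phi> \<psi> \<alpha>" "nat_trans (apex \<phi>) (apex \<psi>) \<alpha>"
  using assms unfolding inv_adjustment_def adjustment_def over_def nt_eq_def nt_comp_def nat_trans_def
  by blast+

text \<open>The two sides of the naturality equation have the same image under the injective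
  \<open>bwd \<psi>\<close>.\<close>

lemma adjustment_coh:
  assumes \<phi>: "cartesian f g \<phi>" and \<psi>: "cartesian f g \<psi>"
  shows "adjustment \<phi> \<psi> (coh \<phi> \<psi>)"
proof -
  note D = cartesianD[OF \<phi>] and E = cartesianD[OF \<psi>] and o = overD[OF over_coh[OF \<phi> \<psi>]]
  have "nat_trans (apex \<phi>) (apex \<psi>) (coh \<phi> \<psi>)"
  proof (rule nat_transI)
    fix \<sigma> x assume \<sigma>: "\<sigma> \<in> Arr C" and x: "x \<in> El (apex \<phi>) (Cod C \<sigma>)"
    note x\<sigma> = Act_El[OF D(5) \<sigma> refl x] note c = o[OF Cod_in[OF \<sigma>] x]
    show "coh \<phi> \<psi> (Dom C \<sigma>) (Act (apex \<phi>) \<sigma> x) = Act (apex \<psi>) \<sigma> (coh \<phi> \<psi> (Cod C \<sigma>) x)"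
      by (rule cartesian_inj[OF \<psi> Dom_in[OF \<sigma>] o(1)[OF Dom_in[OF \<sigma>] x\<sigma>] Act_El[OF E(5) \<sigma> refl c(1)]])
        (simp add: o(2)[OF Dom_in[OF \<sigma>] x\<sigma>] nt_Act[OF D(8) \<sigma> refl x] nt_Act[OF E(8) \<sigma> refl c(1)] c(2))
  qed (rule o(1))
  then show ?thesis using D E o by (simp add: adjustment_def nt_eq_def nt_comp_def)
qed

text \<open>Each round trip and the identity are over the same cartesian morphism, so
  \<open>over_unique\<close> equates them.\<close>

lemma inv_adjustment_coh:
  assumes \<phi>: "cartesian f g \<phi>" and \<psi>: "cartesian f g \<psi>"
  shows "inv_adjustment \<phi> \<psi> (coh \<phi> \<psi>)"
proof -
  have id: "over \<chi> \<chi> nt_id" for \<chi> :: "('o, 'm, 'x, 'y, 'z, 'w, 'v) pmor" by (simp add: over_def nt_id_def)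
  have "nt_eq (apex \<phi>) (nt_comp (coh \<psi> \<phi>) (coh \<phi> \<psi>)) nt_id"
    by (rule over_unique[OF over_comp[OF over_coh over_coh] id]) fact+
  moreover have "nt_eq (apex \<psi>) (nt_comp (coh \<phi> \<psi>) (coh \<psi> \<phi>)) nt_id"
    by (rule over_unique[OF over_comp[OF over_coh over_coh] id]) fact+
  ultimately show ?thesis
    using adjustment_coh[OF \<phi> \<psi>] adjustment_coh[OF \<psi> \<phi>] unfolding inv_adjustment_def by blast
qed

text \<open>Rules directed by the outermost constructor of a composite; applied backwards, they show
  the composites in the axioms to be cartesian.\<close>

lemmas cartesian_rules = cartesian_vcomp cartesian_hcomp cartesian_id_mor cartesian_assoc
  cartesian_runit cartesian_lunit cartesian_lift_mor morphism_pcomp morphism_id_poly morphism_lift_obj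

lemmas over_rules = over_comp over_coh over_pre over_post over_hleft over_hright

section \<open>Pseudomonad and pseudoalgebra structures\<close>

text \<open>Both pastings are over the same cartesian target. The arguments written out in
  \<open>coh\<close> and \<open>post\<close> supply the intermediate composites that
  \<open>over_comp\<close> leaves open.\<close>

lemma pseudomonad_assoc_axiomI:
  assumes t: "morphism t" and \<mu>: "cartesian (t \<odot> t) t \<mu>"
    and \<alpha>: "over (\<mu> \<bullet> (id_mor t \<star> \<mu>)) (\<mu> \<bullet> (\<mu> \<star> id_mor t) \<bullet> assoc t t t) \<alpha>"
  shows "pseudomonad_assoc_axiom t \<mu> \<alpha>"
  unfolding pseudomonad_assoc_axiom_def Let_def
  by (rule over_unique) (rule \<alpha> over_rules t \<mu> cartesian_rules)+

lemma pseudomonad_unit_axiomI: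
  assumes t: "morphism t" and \<eta>: "cartesian id_poly t \<eta>" and \<mu>: "cartesian (t \<odot> t) t \<mu>"
    and \<alpha>: "over (\<mu> \<bullet> (id_mor t \<star> \<mu>)) (\<mu> \<bullet> (\<mu> \<star> id_mor t) \<bullet> assoc t t t) \<alpha>"
    and lam: "over (\<mu> \<bullet> (id_mor t \<star> \<eta>) \<bullet> runit t) (id_mor t) lam"
    and rho: "over (\<mu> \<bullet> (\<eta> \<star> id_mor t) \<bullet> lunit t) (id_mor t) rho"
  shows "pseudomonad_unit_axiom t \<eta> \<mu> \<alpha> lam rho"
  unfolding pseudomonad_unit_axiom_def Let_def
  by (rule over_unique) (rule \<alpha> lam rho over_rules t \<eta> \<mu> cartesian_rules)+

text \<open>P_p is applied to \<sigma> in one of the pastings, which calls for naturality of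
  \<sigma>; the associator and the naturality of the multiplication are instances of
  \<open>coh\<close>.\<close>

lemma pseudoalgebra_assoc_axiomI:
  assumes p: "morphism p" and f: "morphism f" and \<mu>: "cartesian (p \<odot> p) p \<mu>"
    and \<zeta>: "cartesian (lift_obj p f) f \<zeta>"
    and \<sigma>: "over (\<zeta> \<bullet> lift_mor p \<zeta>) (\<zeta> \<bullet> lift_mult p \<mu> f) \<sigma>"
    and n: "nat_trans (apex (\<zeta> \<bullet> lift_mor p \<zeta>)) (apex (\<zeta> \<bullet> lift_mult p \<mu> f)) \<sigma>"
  shows "pseudoalgebra_assoc_axiom p \<mu> f \<zeta> \<sigma>"
  \<comment> \<open>\<open>lift_mult_nat\<close> is written with the source and target of \<zeta>;
    rewriting these lets the composites match the rules.\<close>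
  unfolding pseudoalgebra_assoc_axiom_def Let_def lift_associator_def lift_mult_nat_def cartesianD(1,2)[OF \<zeta>]
  by (rule over_unique)
    (rule \<sigma> n over_rules over_lift_mor p f \<mu> \<zeta> cartesian_lift_mult[OF p \<mu>] cartesian_rules)+

text \<open>Here P_p is applied to \<tau>, so naturality is asked of \<tau>, while \<sigma> is only
  whiskered.\<close>

lemma pseudoalgebra_unit_axiomI:
  assumes p: "morphism p" and f: "morphism f" and \<eta>: "cartesian id_poly p \<eta>" and \<mu>: "cartesian (p \<odot> p) p \<mu>"
    and \<zeta>: "cartesian (lift_obj p f) f \<zeta>"
    and \<sigma>: "over (\<zeta> \<bullet> lift_mor p \<zeta>) (\<zeta> \<bullet> lift_mult p \<mu> f) \<sigma>"
    and \<tau>: "over (\<zeta> \<bullet> lift_unit p \<eta> f) (id_mor f) \<tau>"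
    and n: "nat_trans (apex (\<zeta> \<bullet> lift_unit p \<eta> f)) (apex (id_mor f)) \<tau>"
  shows "pseudoalgebra_unit_axiom p \<eta> \<mu> f \<zeta> \<sigma> \<tau>"
  unfolding pseudoalgebra_unit_axiom_def Let_def lift_unitor_def
  by (rule over_unique)
    (rule \<sigma> \<tau> n over_rules over_lift_mor p f \<eta> \<mu> \<zeta> cartesian_lift_unit[OF \<eta>] cartesian_lift_mult[OF p \<mu>]
      cartesian_rules)+

section \<open>Comparison with the type formers\<close>

lemma supports_unit_iff: "supports_unit p \<longleftrightarrow> (\<exists>h k. csq id_poly p h k)"
  unfolding supports_unit_def csq_def by (simp add: id_poly_def)

text \<open>Identifies the projection written out in \<open>supports_Sigma\<close> with the map of
  \<open>p \<odot> p\<close>.\<close>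

lemma case_prod_nested_fst: "(\<lambda>\<Gamma> ((A, B), a, b). (A, B)) = (\<lambda>\<Gamma>. fst)"
  by (auto simp: fun_eq_iff)

lemma supports_Sigma_iff: "supports_Sigma p \<longleftrightarrow> (\<exists>h k. csq (p \<odot> p) p h k)"
  unfolding supports_Sigma_def csq_def case_prod_nested_fst by auto

text \<open>The only choices lie in \<eta> and \<mu>. Forgetting the 2-cells leaves two pullback
  squares, and two pullback squares determine 2-cells by \<open>coh\<close>.\<close>

theorem has_pseudomonad_structure_iff:
  fixes p :: "('o, 'm, 'b, 'a) mor"
  assumes p: "morphism p"
  shows "has_pseudomonad_structure p \<longleftrightarrow> supports_unit p \<and> supports_Sigma p"
proof
  assume "has_pseudomonad_structure p"
  then obtain \<eta> :: "('o, 'm, unit, unit, 'b, 'a, unit) pmor"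
    and \<mu> :: "('o, 'm, ('m, 'b, 'a, 'b, 'a) comp_el, ('m, 'b, 'a, 'a) ext_el, 'b, 'a, ('m, 'b, 'a, 'b, 'a) comp_el) pmor"
    where "cartesian id_poly p \<eta>" "cartesian (p \<odot> p) p \<mu>"
    unfolding has_pseudomonad_structure_def polynomial_pseudomonad_def Let_def by auto
  then have sq: "csq id_poly p (base \<eta>) (top_map \<eta>)" "csq (p \<odot> p) p (base \<mu>) (top_map \<mu>)"
    by (simp_all add: cartesian_csq)
  then show "supports_unit p \<and> supports_Sigma p"
    unfolding supports_unit_iff supports_Sigma_iff by blast
next
  assume "supports_unit p \<and> supports_Sigma p"
  then obtain h k h' k' where sq: "csq id_poly p h k" "csq (p \<odot> p) p h' k'"
    unfolding supports_unit_iff supports_Sigma_iff by blast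
  \<comment> \<open>\<open>of_square\<close> takes the domain of the source as apex, which gives the
    element types prescribed by \<open>has_pseudomonad_structure\<close>.\<close>
  define \<eta> where "\<eta> = of_square id_poly p h k"
  define \<mu> where "\<mu> = of_square (p \<odot> p) p h' k'"
  have \<eta>: "cartesian id_poly p \<eta>" and \<mu>: "cartesian (p \<odot> p) p \<mu>"
    unfolding \<eta>_def \<mu>_def using sq by (simp_all add: cartesian_of_square)
  let ?I = "id_mor p"
  let ?A = "\<mu> \<bullet> (?I \<star> \<mu>)" and ?A' = "\<mu> \<bullet> (\<mu> \<star> ?I) \<bullet> assoc p p p"
    and ?L = "\<mu> \<bullet> (?I \<star> \<eta>) \<bullet> runit p" and ?R = "\<mu> \<bullet> (\<eta> \<star> ?I) \<bullet> lunit p"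
  have "inv_adjustment ?A ?A' (coh ?A ?A')" "inv_adjustment ?L ?I (coh ?L ?I)" "inv_adjustment ?R ?I (coh ?R ?I)"
    by (rule inv_adjustment_coh p \<eta> \<mu> cartesian_rules)+
  then have "polynomial_pseudomonad p
      \<lparr>p_eta = \<eta>, p_mu = \<mu>, p_alpha = coh ?A ?A', p_lam = coh ?L ?I, p_rho = coh ?R ?I\<rparr>"
    using p \<eta> \<mu> pseudomonad_assoc_axiomI[OF p \<mu>] pseudomonad_unit_axiomI[OF p \<eta> \<mu>]
    by (simp add: polynomial_pseudomonad_def Let_def adjustmentD(1))
  then show "has_pseudomonad_structure p" unfolding has_pseudomonad_structure_def by blast
qed

text \<open>For every \<open>M\<close> the lifted unit and multiplication are cartesian because
  \<eta> and \<mu> are, so existence of a structure comes down to a pullback square from P_p(f) to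
  \<open>f\<close>. For \<open>f\<close> equal to \<open>p\<close> this square is a dependent
  product structure.\<close>

theorem has_pseudoalgebra_structure_iff:
  fixes p :: "('o, 'm, 'b, 'a) mor" and f :: "('o, 'm, 'c, 'd) mor"
  assumes M: "polynomial_pseudomonad p M" and f: "morphism f"
  shows "has_pseudoalgebra_structure p M f \<longleftrightarrow>
    (\<exists>h k. pullback_square (pext p (mdom f)) (mdom f) (pext p (mcod f)) (mcod f) k (pext_map p (mmap f)) (mmap f) h)"
    (is "_ \<longleftrightarrow> ?R")
proof
  assume "has_pseudoalgebra_structure p M f"
  then obtain \<zeta> :: "('o, 'm, ('m, 'b, 'a, 'c) ext_el, ('m, 'b, 'a, 'd) ext_el, 'c, 'd, ('m, 'b, 'a, 'c) ext_el) pmor"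
    where "cartesian (lift_obj p f) f \<zeta>"
    unfolding has_pseudoalgebra_structure_def polynomial_pseudoalgebra_def by auto
  then show ?R using cartesian_csq unfolding csq_def by fastforce
next
  assume ?R
  then obtain h k where sq: "csq (lift_obj p f) f h k" unfolding csq_def by auto
  define \<zeta> where "\<zeta> = of_square (lift_obj p f) f h k"
  have \<zeta>: "cartesian (lift_obj p f) f \<zeta>" unfolding \<zeta>_def by (rule cartesian_of_square[OF sq])
  have p: "morphism p" and \<eta>: "cartesian id_poly p (p_eta M)" and \<mu>: "cartesian (p \<odot> p) p (p_mu M)"
    using M by (simp_all add: polynomial_pseudomonad_def Let_def)
  let ?L = "\<zeta> \<bullet> lift_mor p \<zeta>" and ?L' = "\<zeta> \<bullet> lift_mult p (p_mu M) f"
    and ?U = "\<zeta> \<bullet> lift_unit p (p_eta M) f"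
  have "inv_adjustment ?L ?L' (coh ?L ?L')" "inv_adjustment ?U (id_mor f) (coh ?U (id_mor f))"
    by (rule inv_adjustment_coh p f \<zeta> cartesian_lift_unit[OF \<eta>] cartesian_lift_mult[OF p \<mu>] cartesian_rules)+
  then have "polynomial_pseudoalgebra p M f \<zeta> (coh ?L ?L') (coh ?U (id_mor f))"
    using f \<zeta> pseudoalgebra_assoc_axiomI[OF p f \<mu> \<zeta>] pseudoalgebra_unit_axiomI[OF p f \<eta> \<mu> \<zeta>]
    by (simp add: polynomial_pseudoalgebra_def adjustmentD)
  then show "has_pseudoalgebra_structure p M f" unfolding has_pseudoalgebra_structure_def by blast
qed

end

text \<open>Part (b) ranges over all pseudomonad structures on \<open>p\<close>. By (a) there is one
  exactly if a unit type and sums are supported, which renders the word "additionally".\<close>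

theorem theorem3p2p24:
  fixes C :: "('o, 'm) cat_data"
    and emp :: 'o
    and p :: "('o, 'm, 'v, 'u) mor"
    and ctx :: "'o \<Rightarrow> 'u \<Rightarrow> 'o"
    and wk :: "'o \<Rightarrow> 'u \<Rightarrow> 'm"
    and var :: "'o \<Rightarrow> 'u \<Rightarrow> 'v"
  assumes "natural_model C emp p ctx wk var"
  shows "(category.supports_unit C p \<and> category.supports_Sigma C p
            \<longleftrightarrow> category.has_pseudomonad_structure C p) \<and>
         (\<forall>\<PP>. category.polynomial_pseudomonad C p \<PP> \<longrightarrow>
            (category.supports_Pi C p \<longleftrightarrow> category.has_pseudoalgebra_structure C p \<PP> p))"
proof -
  interpret natural_model C emp p ctx wk var by fact
  show ?thesis
    using has_pseudomonad_structure_iff[OF morphism_p] has_pseudoalgebra_structure_iff[OF _ morphism_p]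
    unfolding supports_Pi_def by blast
qed

end
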